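(* Let $\alpha\in(1,2)$, $\beta\in\{-1,0,1\}$, and let $w$, $f^0$ (with $\eta$ sufficiently small), the global solutions $f_c$, and the scattering states $f_c^+\in L^1(\mathbb{R}^6)$, $1\le c\le\infty$, be as in the context. Then the scattering states of the relativistic system converge to those of the non-relativistic system as $c\to\infty$; more specifically, for all $1\le c\le\infty$, $$\|f_c^+-f_\infty^+\|_{L^1_{x,p}(\mathbb{R}^6)}\lesssim\frac{1}{c^2}\,\big\|\langle p\rangle^3\nabla_{(x,p)}f^0\big\|_{L^1_{x,p}(\mathbb{R}^6)}.$$ Similarly, the respective fields and characteristic flows converge as $c\to\infty$ with the same order $\mathcal{O}(c^{-2})$ of convergence, in the sense that $$\sup_{t\ge0}\ \sup_{(x,p)\in\mathbb{R}^6}\frac{1}{\langle p\rangle^3}\big|\mathcal{W}_c(t)(x,p)-\mathcal{W}_\infty(t)(x,p)\big|\lesssim\frac{\eta_0}{c^2} \qquad\text{and}\qquad \|(E_c-E_\infty)(t)\|_{L^\infty_x(\mathbb{R}^3)}\lesssim\frac{\eta_0}{c^2\langle t\rangle^{\alpha+1}},$$ where $\mathcal{W}_c(t)(x,p)=\big(\mathcal{X}_c(t,0,x,p)-tv_c(\mathcal{P}_c(t,0,x,p)),\ \mathcal{P}_c(t,0,x,p)\big)$.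
   Context: Notation: $\langle y\rangle=\sqrt{1+|y|^2}$; $3^+$ denotes a preselected number larger than $3$ but arbitrarily close to $3$; $1/c^2=0$ when $c=\infty$. $A\lesssim B$ means $A\le CB$ with a constant $C>0$ independent of $t\ge0$, $c\in[1,\infty]$ and the small parameters $\eta,\eta_0>0$. For $1\le c<\infty$, $v_c(p)=p/\sqrt{1+|p|^2/c^2}$, $p\in\mathbb{R}^3$; $v_\infty(p)=p$. The potential $w:\mathbb{R}^3\to\mathbb{R}$ is a given function such that, for some $C>0$, $|w(x)|\le C|x|^{-\alpha}$ and $|\nabla w(x)|\le C|x|^{-(\alpha+1)}$ for $|x|$ sufficiently large. The initial datum $f^0:\mathbb{R}^3\times\mathbb{R}^3\to[0,\infty)$ (the same for all $c$) is such that $$\eta:=\|\langle x\rangle^{3^+}\langle p\rangle^8f^0\|_{L^\infty_{x,p}}+\|\langle x\rangle^{3^+}\langle p\rangle^9\nabla_{(x,p)}f^0\|_{L^\infty_{x,p}}$$ is sufficiently small. For each $1\le c\le\infty$, $f_c:[0,\infty)\times\mathbb{R}^3\times\mathbb{R}^3\to[0,\infty)$ is the unique global solution of $$\partial_tf_c+v_c(p)\cdot\nabla_xf_c+E_c\cdot\nabla_pf_c=0,\quad f_c(0)=f^0,\quad E_c=\beta\nabla w*\rho_{f_c},\quad \rho_{f_c}(t,x)=\int_{\mathbb{R}^3}f_c(t,x,p)\,dp,$$ (convolution in $x$) constructed under this smallness assumption, whose force field satisfies, for some constant $\eta_0$ with $0<\eta<\eta_0\ll1$ and uniformly in $c$,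 $\sup_{t\ge0}\{(1+t)^{\alpha+1}\|E_c(t)\|_{L^\infty_x}+(1+t)^{\alpha+2}\|\nabla_xE_c(t)\|_{L^\infty_x}\}\lesssim\eta_0$. The characteristics $(\mathcal{X}_c(s,t,x,p),\mathcal{P}_c(s,t,x,p))$ solve $\partial_s\mathcal{X}_c=v_c(\mathcal{P}_c)$, $\partial_s\mathcal{P}_c=E_c(s,\mathcal{X}_c)$, with $(\mathcal{X}_c,\mathcal{P}_c)=(x,p)$ at $s=t$, and $f_c(t,x,p)=f^0(\mathcal{X}_c(0,t,x,p),\mathcal{P}_c(0,t,x,p))$. The scattering state $f_c^+\in L^1(\mathbb{R}^6)$, $f_c^+\ge0$, is the time asymptotic limit $f_c^+(x,p)=\lim_{t\to\infty}f_c(t,x+tv_c(p),p)$, which exists pointwise and in $L^1_{x,p}(\mathbb{R}^6)$. *)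

theory Defs
  imports "HOL-Analysis.Analysis" "HOL-Probability.Essential_Supremum"
begin

type_synonym vec3 = "real^3"
type_synonym phase = "vec3 \<times> vec3"

definition jb :: "'a::real_normed_vector \<Rightarrow> real"
  where "jb y = sqrt (1 + (norm y)\<^sup>2)"

(* The speed of light ranges over c :: ereal with 1 <= c; in ereal, 1 / \<infinity> = 0. *)
definition inv_sq :: "ereal \<Rightarrow> real"
  where "inv_sq c = real_of_ereal (1 / c\<^sup>2)"

definition vel :: "ereal \<Rightarrow> vec3 \<Rightarrow> vec3"
  where "vel c p = p /\<^sub>R sqrt (1 + (norm p)\<^sup>2 * inv_sq c)"

subsection \<open>Lebesgue norms and weak gradients\<close>

definition Linf_norm :: "('a::euclidean_space \<Rightarrow> 'b::real_normed_vector) \<Rightarrow> ennreal"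
  where "Linf_norm u = esssup lebesgue (\<lambda>x. ennreal (norm (u x)))"

definition L1_norm :: "('a::euclidean_space \<Rightarrow> 'b::real_normed_vector) \<Rightarrow> ennreal"
  where "L1_norm u = (\<integral>\<^sup>+x. ennreal (norm (u x)) \<partial>lebesgue)"

(* phi is a C^1 function with compact support in U, and dphi is its gradient *)
definition test_function ::
    "'a::euclidean_space set \<Rightarrow> ('a \<Rightarrow> real) \<Rightarrow> ('a \<Rightarrow> 'a) \<Rightarrow> bool"
  where "test_function U \<phi> d\<phi> \<longleftrightarrow>
    (\<forall>x. GDERIV \<phi> x :> d\<phi> x) \<and> continuous_on UNIV d\<phi> \<and>
    (\<exists>K. compact K \<and> K \<subseteq> U \<and> (\<forall>x. x \<notin> K \<longrightarrow> \<phi> x = 0))"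

(* g represents the gradient of u on the open set U in the sense of distributions,
   both being locally integrable. The integrals may be taken over the whole space,
   since test functions vanish outside U. *)
definition has_weak_gradient ::
    "'a::euclidean_space set \<Rightarrow> ('a \<Rightarrow> real) \<Rightarrow> ('a \<Rightarrow> 'a) \<Rightarrow> bool"
  where "has_weak_gradient U u g \<longleftrightarrow>
    (\<forall>K. compact K \<and> K \<subseteq> U \<longrightarrow>
       set_integrable lebesgue K u \<and> set_integrable lebesgue K g) \<and>
    (\<forall>\<phi> d\<phi>. test_function U \<phi> d\<phi> \<longrightarrow>
       (LINT x|lebesgue. u x *\<^sub>R d\<phi> x) = - (LINT x|lebesgue. \<phi> x *\<^sub>R g x))"

subsection \<open>Potential, density, and force field\<close>

(* No regularity of w near the origin is imposed beyond local integrability of w and of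
   its gradient, without which the convolution with the gradient would be undefined. *)
definition admissible_potential :: "real \<Rightarrow> (vec3 \<Rightarrow> real) \<Rightarrow> (vec3 \<Rightarrow> vec3) \<Rightarrow> bool"
  where "admissible_potential \<alpha> w dw \<longleftrightarrow>
    has_weak_gradient UNIV w dw \<and>
    (\<exists>C>0. \<exists>R>0.
       (\<forall>x. norm x \<ge> R \<longrightarrow> \<bar>w x\<bar> \<le> C * norm x powr (- \<alpha>)) \<and>
       (AE x in lebesgue. norm x \<ge> R \<longrightarrow> norm (dw x) \<le> C * norm x powr (- (\<alpha> + 1))))"

definition density :: "(real \<Rightarrow> vec3 \<Rightarrow> vec3 \<Rightarrow> real) \<Rightarrow> real \<Rightarrow> vec3 \<Rightarrow> real"
  where "density f t x = (LINT p|lebesgue. f t x p)"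

definition force ::
    "real \<Rightarrow> (vec3 \<Rightarrow> vec3) \<Rightarrow> (real \<Rightarrow> vec3 \<Rightarrow> vec3 \<Rightarrow> real) \<Rightarrow> real \<Rightarrow> vec3 \<Rightarrow> vec3"
  where "force \<beta> dw f t x = \<beta> *\<^sub>R (LINT y|lebesgue. density f t y *\<^sub>R dw (x - y))"

definition force_decay :: "real \<Rightarrow> real \<Rightarrow> (real \<Rightarrow> vec3 \<Rightarrow> vec3) \<Rightarrow> bool"
  where "force_decay \<alpha> b E \<longleftrightarrow>
    (\<forall>t\<ge>0. \<forall>x. E t differentiable (at x)) \<and>
    (SUP t\<in>{0..}. ennreal ((1 + t) powr (\<alpha> + 1)) * Linf_norm (E t)
              + ennreal ((1 + t) powr (\<alpha> + 2)) * Linf_norm (\<lambda>x. jacobian (E t) (at x)))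
      \<le> ennreal b"

subsection \<open>Initial data and solutions\<close>

(* k plays the role of the exponent 3^+, and df0 is the weak gradient of f0 in (x,p) *)
definition data_size :: "real \<Rightarrow> (phase \<Rightarrow> real) \<Rightarrow> (phase \<Rightarrow> phase) \<Rightarrow> ennreal"
  where "data_size k f0 df0 =
    Linf_norm (\<lambda>(x, p). jb x powr k * jb p ^ 8 * f0 (x, p)) +
    Linf_norm (\<lambda>(x, p). (jb x powr k * jb p ^ 9) *\<^sub>R df0 (x, p))"

(* Data with finite data_size are Lipschitz but need not be C^1, so the transport equation
   is required almost everywhere, for the weak derivatives of the continuous function f.
   Only the values f t x p with t >= 0 are relevant. *)
definition vlasov_solution ::
    "ereal \<Rightarrow> real \<Rightarrow> (vec3 \<Rightarrow> vec3) \<Rightarrow> (phase \<Rightarrow> real) \<Rightarrow>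
     (real \<Rightarrow> vec3 \<Rightarrow> vec3 \<Rightarrow> real) \<Rightarrow> bool"
  where "vlasov_solution c \<beta> dw f0 f \<longleftrightarrow>
    (\<forall>t\<ge>0. \<forall>x p. 0 \<le> f t x p) \<and>
    continuous_on ({0..} \<times> UNIV \<times> UNIV) (\<lambda>(t, x, p). f t x p) \<and>
    (\<forall>t\<ge>0. \<forall>x. integrable lebesgue (f t x)) \<and>
    (\<forall>t\<ge>0. \<forall>x. integrable lebesgue (\<lambda>y. density f t y *\<^sub>R dw (x - y))) \<and>
    (\<forall>x p. f 0 x p = f0 (x, p)) \<and>
    (\<exists>ft fx fp.
       has_weak_gradient ({0<..} \<times> UNIV \<times> UNIV)
         (\<lambda>(t, x, p). f t x p) (\<lambda>z. (ft z, fx z, fp z)) \<and>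
       (AE (t, x, p) in lebesgue. t > 0 \<longrightarrow>
          ft (t, x, p) + vel c p \<bullet> fx (t, x, p) + force \<beta> dw f t x \<bullet> fp (t, x, p) = 0))"

(* X s t x p and P s t x p are position and momentum at time s of the characteristic
   that passes through (x, p) at time t *)
definition characteristics ::
    "ereal \<Rightarrow> (real \<Rightarrow> vec3 \<Rightarrow> vec3) \<Rightarrow>
     (real \<Rightarrow> real \<Rightarrow> vec3 \<Rightarrow> vec3 \<Rightarrow> vec3) \<Rightarrow> (real \<Rightarrow> real \<Rightarrow> vec3 \<Rightarrow> vec3 \<Rightarrow> vec3) \<Rightarrow> bool"
  where "characteristics c E X P \<longleftrightarrow>
    (\<forall>t\<ge>0. \<forall>x p. X t t x p = x \<and> P t t x p = p \<and>
      (\<forall>s\<ge>0.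
        ((\<lambda>s. X s t x p) has_vector_derivative vel c (P s t x p)) (at s within {0..}) \<and>
        ((\<lambda>s. P s t x p) has_vector_derivative E s (X s t x p)) (at s within {0..})))"

definition scattering_state ::
    "ereal \<Rightarrow> (real \<Rightarrow> vec3 \<Rightarrow> vec3 \<Rightarrow> real) \<Rightarrow> (vec3 \<Rightarrow> vec3 \<Rightarrow> real) \<Rightarrow> bool"
  where "scattering_state c f fplus \<longleftrightarrow>
    (\<forall>x p. 0 \<le> fplus x p) \<and>
    integrable lebesgue (\<lambda>(x, p). fplus x p) \<and>
    (\<forall>x p. ((\<lambda>t. f t (x + t *\<^sub>R vel c p) p) \<longlongrightarrow> fplus x p) at_top) \<and>
    ((\<lambda>t. L1_norm (\<lambda>(x, p). f t (x + t *\<^sub>R vel c p) p - fplus x p)) \<longlongrightarrow> 0) at_top"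

definition wave_map ::
    "ereal \<Rightarrow> (real \<Rightarrow> real \<Rightarrow> vec3 \<Rightarrow> vec3 \<Rightarrow> vec3) \<Rightarrow> (real \<Rightarrow> real \<Rightarrow> vec3 \<Rightarrow> vec3 \<Rightarrow> vec3) \<Rightarrow>
     real \<Rightarrow> vec3 \<Rightarrow> vec3 \<Rightarrow> phase"
  where "wave_map c X P t x p = (X t 0 x p - t *\<^sub>R vel c (P t 0 x p), P t 0 x p)"

end

theory Submission
  imports Defs
begin

text \<open>
  Everything is compared in profile coordinates (x - t v(p), p), in which free transport is at
  rest. Along a characteristic, Y = X - t v(P) satisfies Y' = - t Dv(P) E(t, X). Since the field and
  its gradient decay like t powr - (\<alpha> + 1) and t powr - (\<alpha> + 2), the right-hand side of the
  equation for (Y, P) and its Lipschitz constant are small multiples of t powr - \<alpha>, which is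
  integrable because \<alpha> > 1. Hence the map Z from the profile at time t to the initial state is, uniformly
  in t and c, a small perturbation of the identity, also in the Lipschitz sense
  (\<open>profile_drift\<close>, \<open>profile_lipschitz\<close>). Because |v_c(p) - p| is at most |p|^3 / c^2, the maps for
  c and for infinite speed differ by a multiple of (1 / c^2 + d) <p>^3, where d is the supremum of
  (1 + t) powr (\<alpha> + 1) |E_c - E_\<infinity>| (\<open>profile_speed_comparison\<close>).

  Conversely, d is controlled by the difference of these maps. The density is the integral over p of
  f0 (Z (x - t v(p), p)). A direct comparison of the two densities would lose a factor t, since the
  free trajectories separate at the speed |v_c(p) - p|. The substitution q = v_c(p) in the Newtonian density
  puts both integrals on the same trajectories, so that only the dependence on the momentum variable and
  the Jacobian (1 + |p|^2 / c^2) powr (- 5 / 2) have to be compared, and these are within 1 / c^2 of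
  their Newtonian values without growth in time (\<open>density_difference\<close>). The difference of the
  densities is therefore bounded by 1 / c^2 + d times a density of bounded mass that disperses like
  t powr - 3 (\<open>dispersed_le\<close>), and convolution with the force kernel turns this into the decay
  t powr - (\<alpha> + 1) of the field (\<open>force_kernel_convolution\<close>). The result is
  d \<le> C \<eta> (1 / c^2 + d), and for small \<eta> the term with d is absorbed (\<open>uniform_bootstrap\<close>).
  Only Lipschitz bounds for the flow enter, so one derivative of the field suffices.

  For the scattering states one needs the integral of |f0 (Z_c) - f0 (Z_\<infinity>)|. As f0 has only a weak
  gradient, it is mollified and differentiated along the segments between the two maps. The
  interpolated maps are close to the identity, hence expansive up to the factor 1 / 2, so the
  mollifier composed with them still has integral of order 1
  (\<open>L1_distance_of_compositions\<close>). Fatou's lemma removes first the mollification and then the finite time.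
\<close>

section \<open>Weights and the relativistic velocity\<close>

text \<open>Here a stands for 1 / c^2, which makes the Newtonian velocity the regular end point a = 0.\<close>

definition relvel :: "real \<Rightarrow> 'a::real_inner \<Rightarrow> 'a"
  where "relvel a p = p /\<^sub>R sqrt (1 + a * (norm p)\<^sup>2)"

lemma vel_relvel: "vel c = relvel (inv_sq c)"
  by (auto simp: vel_def relvel_def mult.commute)

lemma inv_sq_infinity [simp]: "inv_sq \<infinity> = 0"
  by (simp add: inv_sq_def)

lemma inv_sq_ereal: "1 \<le> r \<Longrightarrow> inv_sq (ereal r) = 1 / r\<^sup>2"
  by (simp add: inv_sq_def divide_ereal_def one_ereal_def inverse_eq_divide)

lemma jb_ge_1: "1 \<le> jb x"
  by (simp add: jb_def)

lemma jb_pos [simp]: "0 < jb x"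
  using jb_ge_1[of x] by linarith

lemma jb_neq_0 [simp]: "jb x \<noteq> 0"
  using jb_pos[of x] by linarith

lemma abs_jb [simp]: "\<bar>jb x\<bar> = jb x"
  using jb_pos[of x] by linarith

lemma jb_sq: "(jb x)\<^sup>2 = 1 + (norm x)\<^sup>2"
  by (simp add: jb_def)

lemma norm_le_jb: "norm x \<le> jb x"
  unfolding jb_def by (rule real_le_rsqrt) simp

lemma jb_le: "jb x \<le> 1 + norm x"
  unfolding jb_def by (rule real_le_lsqrt) (auto simp: power2_eq_square algebra_simps)

lemma jb_ge: "1 + norm x \<le> 2 * jb x"
  using jb_ge_1[of x] norm_le_jb[of x] by linarith

lemma jb_mono: "norm x \<le> norm y \<Longrightarrow> jb x \<le> jb y"
  by (simp add: jb_def power_mono)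

lemma jb_shift:
  assumes "norm (x - y) \<le> 1"
  shows "jb y \<le> 2 * jb x"
proof -
  have y: "norm y \<le> norm x + 1"
    using assms norm_triangle_sub[of y x] by (simp add: norm_minus_commute)
  then have "(norm y)\<^sup>2 \<le> (norm x + 1)\<^sup>2" by (intro power_mono) auto
  then have "(norm y)\<^sup>2 \<le> (norm x)\<^sup>2 + 2 * norm x + 1" by (simp add: power2_sum)
  moreover have "2 * norm x \<le> (norm x)\<^sup>2 + 1"
    using zero_le_power2[of "norm x - 1"] by (simp add: power2_diff)
  ultimately have "(norm y)\<^sup>2 \<le> 2 * (norm x)\<^sup>2 + 2" by linarith
  moreover have "0 \<le> (norm x)\<^sup>2" by simp
  ultimately have "1 + (norm y)\<^sup>2 \<le> 4 * (1 + (norm x)\<^sup>2)" unfolding distrib_left by linarith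
  then have "1 + (norm y)\<^sup>2 \<le> (2 * jb x)\<^sup>2"
    unfolding power_mult_distrib jb_sq by simp
  then show ?thesis unfolding jb_def[of y] by (rule real_le_lsqrt[rotated]) (simp add: less_imp_le)
qed

lemma jb_half:
  assumes "1/2 \<le> l" shows "jb x \<le> 2 * jb (l *\<^sub>R x)"
proof -
  have "jb (2 *\<^sub>R l *\<^sub>R x) \<le> 2 * jb (l *\<^sub>R x)"
    unfolding jb_def by (rule real_le_lsqrt) (auto simp: power_mult_distrib)
  moreover have "jb x \<le> jb (2 *\<^sub>R l *\<^sub>R x)"
    using assms by (intro jb_mono) (auto simp: mult_le_cancel_right1)
  ultimately show ?thesis by linarith
qed

lemma continuous_on_jb [continuous_intros]:
  "continuous_on S f \<Longrightarrow> continuous_on S (\<lambda>x. jb (f x))"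
  unfolding jb_def by (intro continuous_intros)

lemma borel_measurable_jb [measurable]: "jb \<in> borel_measurable borel"
  by (rule borel_measurable_continuous_onI) (intro continuous_intros)

definition lorentz :: "real \<Rightarrow> 'a::real_inner \<Rightarrow> real"
  where "lorentz a p = sqrt (1 + a * (norm p)\<^sup>2)"

lemma relvel_lorentz: "relvel a p = p /\<^sub>R lorentz a p"
  by (simp add: relvel_def lorentz_def)

text \<open>The derivative of the velocity at p, applied to h.\<close>

definition dvel :: "real \<Rightarrow> 'a::real_inner \<Rightarrow> 'a \<Rightarrow> 'a"
  where "dvel a p h = (h - (a * (p \<bullet> h) / (lorentz a p)\<^sup>2) *\<^sub>R p) /\<^sub>R lorentz a p"

context
  fixes a :: real
  assumes a: "0 \<le> a"
begin

lemma lorentz_ge_1: "1 \<le> lorentz a p"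
  using a by (simp add: lorentz_def)

lemma lorentz_pos: "0 < lorentz a p"
  using lorentz_ge_1[of p] by linarith

lemma lorentz_sq: "(lorentz a p)\<^sup>2 = 1 + a * (norm p)\<^sup>2"
  using a by (simp add: lorentz_def)

lemma sqrt_norm_le_lorentz: "sqrt a * norm p \<le> lorentz a p"
  unfolding lorentz_def by (rule real_le_rsqrt) (use a in \<open>simp add: power_mult_distrib\<close>)

text \<open>The Lorentz factor is the norm of the pair (1, sqrt a p).\<close>

lemma lorentz_lipschitz: "\<bar>lorentz a p - lorentz a q\<bar> \<le> sqrt a * norm (p - q)"
proof -
  have *: "lorentz a p = norm (1::real, sqrt a *\<^sub>R p)" for p :: 'a
    using a by (simp add: lorentz_def norm_Pair power_mult_distrib)
  have "\<bar>lorentz a p - lorentz a q\<bar> \<le> norm ((1::real, sqrt a *\<^sub>R p) - (1, sqrt a *\<^sub>R q))"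
    unfolding * by (rule norm_triangle_ineq3)
  also have "\<dots> = sqrt a * norm (p - q)"
    using a by (simp add: norm_Pair scaleR_diff_right[symmetric])
  finally show ?thesis .
qed

lemma inverse_lorentz_lipschitz:
  "\<bar>inverse (lorentz a p) - inverse (lorentz a q)\<bar> \<le> sqrt a * norm (p - q) * inverse (lorentz a q)"
proof -
  have "inverse (lorentz a p) - inverse (lorentz a q)
      = (lorentz a q - lorentz a p) * (inverse (lorentz a p) * inverse (lorentz a q))"
    using lorentz_pos[of p] lorentz_pos[of q] by (simp add: field_simps)
  then have "\<bar>inverse (lorentz a p) - inverse (lorentz a q)\<bar>
      = \<bar>lorentz a q - lorentz a p\<bar> * (inverse (lorentz a p) * inverse (lorentz a q))"
    using lorentz_pos[of p] lorentz_pos[of q] by (simp add: abs_mult)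
  also have "\<dots> \<le> (sqrt a * norm (p - q)) * (1 * inverse (lorentz a q))"
  proof (intro mult_mono)
    show "\<bar>lorentz a q - lorentz a p\<bar> \<le> sqrt a * norm (p - q)"
      using lorentz_lipschitz[of q p] by (simp add: norm_minus_commute)
    show "inverse (lorentz a p) \<le> 1" using lorentz_ge_1[of p] by (simp add: inverse_le_1_iff)
  qed (use a lorentz_pos[of p] lorentz_pos[of q] in auto)
  finally show ?thesis by simp
qed

lemma inverse_lorentz_le_1: "inverse (lorentz a p) \<le> 1"
  using lorentz_ge_1[of p] by (simp add: inverse_le_1_iff)

lemma one_minus_inverse_lorentz: "\<bar>1 - inverse (lorentz a p)\<bar> \<le> a * (norm p)\<^sup>2"
proof -
  have g: "1 \<le> lorentz a p" by (rule lorentz_ge_1)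
  have "1 - inverse (lorentz a p) \<le> lorentz a p - 1"
  proof -
    have "0 \<le> (lorentz a p - 1)\<^sup>2 * inverse (lorentz a p)" using g by simp
    also have "\<dots> = lorentz a p - 2 + inverse (lorentz a p)"
      using g by (simp add: field_simps power2_eq_square)
    finally show ?thesis by simp
  qed
  also have "\<dots> \<le> (lorentz a p)\<^sup>2 - 1" using g by (simp add: power2_eq_square)
  also have "\<dots> = a * (norm p)\<^sup>2" by (simp add: lorentz_sq)
  finally show ?thesis using inverse_lorentz_le_1[of p] by simp
qed

lemma norm_relvel_minus: "norm (relvel a p - p) \<le> a * norm p ^ 3"
proof -
  have "relvel a p - p = - ((1 - inverse (lorentz a p)) *\<^sub>R p)"
    by (simp add: relvel_lorentz algebra_simps)
  then have "norm (relvel a p - p) = \<bar>1 - inverse (lorentz a p)\<bar> * norm p" by simp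
  also have "\<dots> \<le> (a * (norm p)\<^sup>2) * norm p"
    by (intro mult_right_mono one_minus_inverse_lorentz) auto
  finally show ?thesis by (simp add: power2_eq_square power3_eq_cube)
qed

lemma norm_sqrt_relvel: "norm (sqrt a *\<^sub>R relvel a p) \<le> 1"
  using sqrt_norm_le_lorentz[of p] lorentz_pos[of p] a
  by (simp add: relvel_lorentz divide_inverse[symmetric] mult.commute field_simps)

lemma relvel_lipschitz: "norm (relvel a p - relvel a q) \<le> 2 * norm (p - q)"
proof -
  let ?g = "\<lambda>p. inverse (lorentz a p)"
  have "relvel a p - relvel a q = ?g p *\<^sub>R (p - q) + (?g p - ?g q) *\<^sub>R q"
    by (simp add: relvel_lorentz algebra_simps)
  also have "norm \<dots> \<le> norm (?g p *\<^sub>R (p - q)) + norm ((?g p - ?g q) *\<^sub>R q)"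
    by (rule norm_triangle_ineq)
  also have "norm (?g p *\<^sub>R (p - q)) \<le> norm (p - q)"
    using inverse_lorentz_le_1[of p] lorentz_pos[of p] by (simp add: mult_left_le_one_le)
  also have "norm ((?g p - ?g q) *\<^sub>R q) \<le> (sqrt a * norm (p - q) * ?g q) * norm q"
    by (simp add: inverse_lorentz_lipschitz mult_right_mono)
  also have "\<dots> = norm (p - q) * norm (sqrt a *\<^sub>R relvel a q)"
    using a lorentz_pos[of q] by (simp add: relvel_lorentz)
  also have "\<dots> \<le> norm (p - q)"
    using norm_sqrt_relvel[of q] by (intro mult_right_le_one_le) auto
  finally show ?thesis by simp
qed

text \<open>With n = sqrt a v(p), a vector of length at most 1, the derivative is (h - (n, h) n) / \<gamma>. Its
norm bound and its Lipschitz bound are read off from this form and are uniform in a \<le> 1.\<close>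

lemma dvel_eq:
  "dvel a p h = inverse (lorentz a p) *\<^sub>R (h - ((sqrt a *\<^sub>R relvel a p) \<bullet> h) *\<^sub>R (sqrt a *\<^sub>R relvel a p))"
proof -
  have "((sqrt a *\<^sub>R relvel a p) \<bullet> h) *\<^sub>R (sqrt a *\<^sub>R relvel a p)
      = ((sqrt a * sqrt a) * (p \<bullet> h) * inverse ((lorentz a p)\<^sup>2)) *\<^sub>R p"
    by (simp only: relvel_lorentz inner_scaleR_left scaleR_scaleR power2_eq_square inverse_mult_distrib mult_ac)
  also have "sqrt a * sqrt a = a" using a by simp
  finally show ?thesis by (simp add: dvel_def divide_inverse)
qed

lemma norm_projection_le: "norm n \<le> 1 \<Longrightarrow> norm (h - (n \<bullet> h) *\<^sub>R n) \<le> 2 * norm h"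
  for n h :: "'a::real_inner"
proof -
  assume n: "norm n \<le> 1"
  have "\<bar>n \<bullet> h\<bar> * norm n \<le> (norm n * norm h) * norm n"
    by (intro mult_right_mono Cauchy_Schwarz_ineq2) auto
  also have "\<dots> = norm h * (norm n * norm n)" by simp
  also have "\<dots> \<le> norm h * 1" using n by (intro mult_left_mono) (auto intro: mult_le_one)
  finally show ?thesis using norm_triangle_ineq4[of h "(n \<bullet> h) *\<^sub>R n"] by simp
qed

lemma norm_dvel: "norm (dvel a p h) \<le> 2 * norm h"
proof -
  have "norm (dvel a p h) \<le> 1 * (2 * norm h)"
    unfolding dvel_eq norm_scaleR
    by (intro mult_mono norm_projection_le norm_sqrt_relvel)
       (use inverse_lorentz_le_1[of p] lorentz_pos[of p] in auto)
  then show ?thesis by simp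
qed

lemma norm_dvel_minus: "norm (dvel a p h - h) \<le> 2 * a * (norm p)\<^sup>2 * norm h"
proof -
  define g where "g = inverse (lorentz a p)"
  have g: "0 \<le> g" "g \<le> 1" using inverse_lorentz_le_1[of p] lorentz_pos[of p] by (auto simp: g_def)
  have "dvel a p h - h = - ((1 - g) *\<^sub>R h) - (g * g * g * a * (p \<bullet> h)) *\<^sub>R p"
    by (simp add: dvel_def g_def divide_inverse power2_eq_square algebra_simps)
  also have "norm \<dots> \<le> norm ((1 - g) *\<^sub>R h) + norm ((g * g * g * a * (p \<bullet> h)) *\<^sub>R p)"
    by (metis norm_minus_cancel norm_triangle_ineq4)
  also have "norm ((1 - g) *\<^sub>R h) \<le> a * (norm p)\<^sup>2 * norm h"
    unfolding norm_scaleR g_def by (intro mult_right_mono one_minus_inverse_lorentz) simp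
  also have "norm ((g * g * g * a * (p \<bullet> h)) *\<^sub>R p) = (g * g * g) * a * (\<bar>p \<bullet> h\<bar> * norm p)"
    using a g by (simp add: abs_mult)
  also have "\<dots> \<le> 1 * a * ((norm p * norm h) * norm p)"
    using a g by (intro mult_mono Cauchy_Schwarz_ineq2) (auto intro!: mult_le_one)
  finally show ?thesis by (simp add: power2_eq_square mult_ac)
qed

lemma dvel_lipschitz: "norm (dvel a p h - dvel a q h) \<le> 6 * sqrt a * norm (p - q) * norm h"
proof -
  define n where "n = (\<lambda>p::'a. sqrt a *\<^sub>R relvel a p)"
  let ?g = "\<lambda>p::'a. inverse (lorentz a p)"
  let ?D = "sqrt a * norm (p - q) * norm h"
  have n1: "norm (n p) \<le> 1" for p unfolding n_def by (rule norm_sqrt_relvel)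
  have nn: "norm (n p - n q) \<le> 2 * (sqrt a * norm (p - q))"
    using mult_left_mono[OF relvel_lipschitz[of p q], of "sqrt a"] a
    by (simp add: n_def scaleR_diff_right[symmetric])
  have *: "(n q \<bullet> h) *\<^sub>R n q - (n p \<bullet> h) *\<^sub>R n p = (n q \<bullet> h) *\<^sub>R (n q - n p) + ((n q - n p) \<bullet> h) *\<^sub>R n p"
    by (simp add: algebra_simps)
  have "norm ((n q \<bullet> h) *\<^sub>R n q - (n p \<bullet> h) *\<^sub>R n p)
      \<le> (norm (n q) * norm h) * norm (n q - n p) + (norm (n q - n p) * norm h) * norm (n p)"
    unfolding *
    by (rule order_trans[OF norm_triangle_ineq]) (auto intro!: add_mono mult_mono Cauchy_Schwarz_ineq2)
  also have "\<dots> \<le> (1 * norm h) * norm (n q - n p) + (norm (n q - n p) * norm h) * 1"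
    using n1 by (intro add_mono mult_mono) auto
  also have "\<dots> = 2 * norm (n p - n q) * norm h" by (simp add: norm_minus_commute)
  also have "\<dots> \<le> 2 * (2 * (sqrt a * norm (p - q))) * norm h"
    using nn by (intro mult_right_mono mult_left_mono) auto
  finally have 1: "norm ((n q \<bullet> h) *\<^sub>R n q - (n p \<bullet> h) *\<^sub>R n p) \<le> 4 * ?D" by simp
  have dv: "dvel a p h = ?g p *\<^sub>R (h - (n p \<bullet> h) *\<^sub>R n p)" for p
    unfolding dvel_eq n_def by (rule refl)
  have "dvel a p h - dvel a q h = ?g p *\<^sub>R ((n q \<bullet> h) *\<^sub>R n q - (n p \<bullet> h) *\<^sub>R n p)
      + (?g p - ?g q) *\<^sub>R (h - (n q \<bullet> h) *\<^sub>R n q)"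
    unfolding dv by (simp add: algebra_simps)
  also have "norm \<dots> \<le> ?g p * norm ((n q \<bullet> h) *\<^sub>R n q - (n p \<bullet> h) *\<^sub>R n p)
      + \<bar>?g p - ?g q\<bar> * norm (h - (n q \<bullet> h) *\<^sub>R n q)"
    using lorentz_pos[of p] by (intro order_trans[OF norm_triangle_ineq]) auto
  also have "\<dots> \<le> 1 * (4 * ?D) + (sqrt a * norm (p - q)) * (2 * norm h)"
  proof (intro add_mono mult_mono 1 norm_projection_le n1)
    show "?g p \<le> 1" by (rule inverse_lorentz_le_1)
    have "\<bar>?g p - ?g q\<bar> \<le> sqrt a * norm (p - q) * ?g q" by (rule inverse_lorentz_lipschitz)
    also have "\<dots> \<le> sqrt a * norm (p - q) * 1"
      using a by (intro mult_left_mono inverse_lorentz_le_1) auto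
    finally show "\<bar>?g p - ?g q\<bar> \<le> sqrt a * norm (p - q)" by simp
  qed (use a in auto)
  finally show ?thesis by (simp add: mult_ac)
qed

lemma has_derivative_lorentz:
  "(lorentz a has_derivative (\<lambda>h. a * (p \<bullet> h) / lorentz a p)) (at p within S)"
proof -
  have "0 < 1 + a * (p \<bullet> p)" using a by (simp add: add_pos_nonneg)
  then show ?thesis
    unfolding lorentz_def[abs_def] power2_norm_eq_inner
    by (auto intro!: derivative_eq_intros simp: inner_commute field_simps)
qed

lemma has_derivative_relvel: "(relvel a has_derivative dvel a p) (at p within S)"
proof -
  have "((\<lambda>p. inverse (lorentz a p) *\<^sub>R p) has_derivative dvel a p) (at p within S)"
    using lorentz_pos[of p]
    by (auto intro!: derivative_eq_intros has_derivative_lorentz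
      simp: dvel_def fun_eq_iff algebra_simps power2_eq_square divide_inverse)
  then show ?thesis by (simp add: relvel_lorentz[abs_def])
qed

end

lemma relvel_0 [simp]: "relvel 0 p = p"
  by (simp add: relvel_def)

lemma dvel_0 [simp]: "dvel 0 p h = h"
  by (simp add: dvel_def lorentz_def)

section \<open>Bounds that hold almost everywhere\<close>

text \<open>The fundamental theorem for the Henstock-Kurzweil integral asks only for differentiability
everywhere, and its integral does not see the null set.\<close>

lemma lipschitz_of_AE_deriv_bound_real:
  fixes f :: "real \<Rightarrow> 'a::euclidean_space"
  assumes f: "\<And>t. (f has_vector_derivative f' t) (at t)"
    and ab: "a \<le> b" and N: "negligible N"
    and bd: "\<And>t. t \<in> {a..b} \<Longrightarrow> t \<notin> N \<Longrightarrow> norm (f' t) \<le> B" and B: "0 \<le> B"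
  shows "norm (f b - f a) \<le> B * (b - a)"
proof -
  have "(f' has_integral (f b - f a)) {a..b}"
    by (rule fundamental_theorem_of_calculus[OF ab]) (use f has_vector_derivative_at_within in blast)
  then have "((\<lambda>t. if t \<in> N then 0 else f' t) has_integral (f b - f a)) {a..b}"
    by (rule has_integral_spike[OF N, rotated]) auto
  then have "((\<lambda>t. if t \<in> N then 0 else f' t) has_integral (f b - f a)) (cbox a b)"
    by simp
  from has_integral_bound[OF B this] have "norm (f b - f a) \<le> B * measure lborel (cbox a b)"
    using bd B by auto
  then show ?thesis using ab by simp
qed

text \<open>By Fubini, almost every line in the direction x - y meets the exceptional set in a null set.
On these lines the one-dimensional bound applies; they are dense, and f is continuous.\<close>

lemma lipschitz_of_AE_deriv_bound:
  fixes f :: "'a::euclidean_space \<Rightarrow> 'b::euclidean_space"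
  assumes f: "\<And>x. (f has_derivative f' x) (at x)"
    and bd: "AE x in lebesgue. \<forall>h. norm (f' x h) \<le> B * norm h" and B: "0 \<le> B"
  shows "norm (f x - f y) \<le> B * norm (x - y)"
proof -
  define h where "h = x - y"
  have cont: "continuous_on UNIV f"
    by (intro continuous_at_imp_continuous_on ballI has_derivative_continuous[OF f])
  have "AE x in lborel. \<forall>h. norm (f' x h) \<le> B * norm h"
    using bd by (simp add: AE_completion_iff)
  then obtain N where N: "N \<in> null_sets lborel" and sub: "{x. \<not> (\<forall>h. norm (f' x h) \<le> B * norm h)} \<subseteq> N"
    by (auto elim!: AE_E simp: null_sets_def)
  have [measurable]: "N \<in> sets borel" using N by auto
  have line: "AE z in lborel. AE t in lborel. z + t *\<^sub>R h \<notin> N"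
  proof (subst lborel_pair.AE_commute[symmetric])
    show "AE t in (lborel::real measure). AE z in lborel. z + t *\<^sub>R h \<notin> N"
    proof (rule AE_I2)
      fix t :: real
      have "AE z in distr lborel borel (\<lambda>z. z + t *\<^sub>R h). z \<notin> N"
      proof -
        have "distr lborel borel (\<lambda>z. z + t *\<^sub>R h) = (lborel::'a measure)"
          using lborel_distr_plus[of "t *\<^sub>R h"] by (subst add.commute) simp
        then show ?thesis using AE_not_in[OF N] by (simp only:)
      qed
      then show "AE z in lborel. z + t *\<^sub>R h \<notin> N"
        by (subst (asm) AE_distr_iff) auto
    qed
  qed measurable
  define G where "G = {z. AE t in lborel. z + t *\<^sub>R h \<notin> N}"
  have good: "norm (f (z + h) - f z) \<le> B * norm h" if "z \<in> G" for z
  proof -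
    define M where "M = {t. z + t *\<^sub>R h \<in> N}"
    have "AE t in lborel. t \<notin> M" using that by (simp add: G_def M_def)
    moreover have "M \<in> sets borel" unfolding M_def by measurable
    ultimately have "M \<in> null_sets lborel" by (subst (asm) AE_iff_null_sets[symmetric]) auto
    then have M: "negligible M" by (simp add: negligible_iff_null_sets null_sets_completionI)
    have "((\<lambda>t. f (z + t *\<^sub>R h)) has_vector_derivative f' (z + t *\<^sub>R h) h) (at t)" for t
    proof -
      have "((\<lambda>t. z + t *\<^sub>R h) has_vector_derivative h) (at t)"
        by (auto intro!: derivative_eq_intros)
      from has_derivative_compose[OF this[unfolded has_vector_derivative_def] f]
      show ?thesis unfolding has_vector_derivative_def
        using linear_cmul[OF has_derivative_linear[OF f]] by simp
    qed
    from lipschitz_of_AE_deriv_bound_real[OF this, of 0 1 M "B * norm h"] M B sub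
    show ?thesis by (auto simp: M_def)
  qed
  have "AE z in lborel. z \<in> G" using line by (simp add: G_def)
  then have dense: "closure G = UNIV"
  proof -
    have "closure G = UNIV" if "AE z in lborel. z \<in> G"
    proof (rule ccontr)
      assume "closure G \<noteq> UNIV"
      then have "open (- closure G)" "- closure G \<noteq> {}" by auto
      moreover have "negligible (- closure G)"
      proof -
        have "AE z in lborel. z \<notin> - closure G"
          using that by eventually_elim (use closure_subset in auto)
        moreover have "- closure G \<in> sets lborel" by simp
        ultimately have "- closure G \<in> null_sets lborel" by (simp add: AE_iff_null_sets)
        then show ?thesis by (simp add: negligible_iff_null_sets null_sets_completionI)
      qed
      ultimately show False using open_not_negligible by blast
    qed
    then show ?thesis using \<open>AE z in lborel. z \<in> G\<close> by blast
  qed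
  have "closed {z. norm (f (z + h) - f z) \<le> B * norm h}"
    by (intro closed_Collect_le continuous_intros continuous_on_compose2[OF cont]) auto
  then have "closure G \<subseteq> {z. norm (f (z + h) - f z) \<le> B * norm h}"
    using good by (intro closure_minimal) auto
  with dense have "norm (f (y + h) - f y) \<le> B * norm h" by auto
  then show ?thesis by (simp add: h_def)
qed

lemma norm_matrix_vector_mult_le:
  fixes A :: "real^'n^'m"
  shows "norm (A *v x) \<le> norm A * norm x"
proof -
  have "norm (A *v x) = L2_set (\<lambda>i. \<bar>(A *v x) $ i\<bar>) UNIV" by (simp add: norm_vec_def)
  also have "\<dots> \<le> L2_set (\<lambda>i. norm (A $ i) * norm x) UNIV"
  proof (rule L2_set_mono)
    fix i
    have "(A *v x) $ i = A $ i \<bullet> x"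
      by (simp add: matrix_vector_mult_def inner_vec_def)
    then show "\<bar>(A *v x) $ i\<bar> \<le> norm (A $ i) * norm x" by (simp add: Cauchy_Schwarz_ineq2)
  qed auto
  also have "\<dots> = norm A * norm x" by (simp add: L2_set_left_distrib norm_vec_def)
  finally show ?thesis .
qed

text \<open>The set where the inequality fails is open, and nonempty open sets are not null.\<close>

lemma AE_le_continuous_imp_le:
  fixes u v :: "'a::euclidean_space \<Rightarrow> real"
  assumes ae: "AE x in lebesgue. u x \<le> v x"
    and u: "continuous_on UNIV u" and v: "continuous_on UNIV v"
  shows "u x \<le> v x"
proof (rule ccontr)
  let ?S = "{x. v x < u x}"
  assume "\<not> u x \<le> v x"
  then have "?S \<noteq> {}" by (auto simp: not_le)
  moreover have op: "open ?S" by (intro open_Collect_less u v)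
  moreover have "negligible ?S"
  proof -
    have "AE x in lborel. x \<notin> ?S"
      using ae by (simp add: AE_completion_iff not_less)
    moreover have "?S \<in> sets lborel" using op by simp
    ultimately have "?S \<in> null_sets lborel" by (simp add: AE_iff_null_sets)
    then show ?thesis by (simp add: negligible_iff_null_sets null_sets_completionI)
  qed
  ultimately show False using open_not_negligible by blast
qed

lemma AE_norm_le_Linf_norm:
  assumes "Linf_norm u \<le> ennreal B" "0 \<le> B"
  shows "AE x in lebesgue. norm (u x) \<le> B"
proof -
  have "AE x in lebesgue. ennreal (norm (u x)) \<le> Linf_norm u"
    unfolding Linf_norm_def by (rule esssup_AE)
  then show ?thesis
  proof eventually_elim
    case (elim x)
    then have "ennreal (norm (u x)) \<le> ennreal B" using assms(1) by (rule order_trans)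
    then show ?case using assms(2) by (simp add: ennreal_le_iff)
  qed
qed


section \<open>Flow lines in a decaying field\<close>

definition decaying_field :: "real \<Rightarrow> real \<Rightarrow> (real \<Rightarrow> vec3 \<Rightarrow> vec3) \<Rightarrow> bool"
  where "decaying_field \<alpha> b E \<longleftrightarrow> 0 \<le> b \<and>
    (\<forall>t\<ge>0. \<forall>x. norm (E t x) \<le> b * (1 + t) powr - (\<alpha> + 1)) \<and>
    (\<forall>t\<ge>0. \<forall>x y. norm (E t x - E t y) \<le> b * (1 + t) powr - (\<alpha> + 2) * norm (x - y))"

lemma decaying_fieldD:
  assumes "decaying_field \<alpha> b E"
  shows "0 \<le> b" "\<And>t x. 0 \<le> t \<Longrightarrow> norm (E t x) \<le> b * (1 + t) powr - (\<alpha> + 1)"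
    "\<And>t x y. 0 \<le> t \<Longrightarrow> norm (E t x - E t y) \<le> b * (1 + t) powr - (\<alpha> + 2) * norm (x - y)"
  using assms by (auto simp: decaying_field_def)

text \<open>Since the field is differentiable everywhere, its essential bounds are genuine pointwise and
Lipschitz bounds.\<close>

lemma force_decay_imp_decaying_field:
  assumes E: "force_decay \<alpha> b E" and b: "0 \<le> b"
  shows "decaying_field \<alpha> b E"
proof -
  have diff: "E t differentiable (at x)" if "0 \<le> t" for t x
    using E that by (auto simp: force_decay_def)
  have cont: "continuous_on UNIV (E t)" if "0 \<le> t" for t
    using diff[OF that] differentiable_imp_continuous_within continuous_at_imp_continuous_on by blast
  have le: "Linf_norm (E t) \<le> ennreal (b * (1 + t) powr - (\<alpha> + 1)) \<and>
      Linf_norm (\<lambda>x. jacobian (E t) (at x)) \<le> ennreal (b * (1 + t) powr - (\<alpha> + 2))" if t: "0 \<le> t" for t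
  proof -
    have *: "ennreal ((1 + t) powr (\<alpha> + 1)) * Linf_norm (E t)
              + ennreal ((1 + t) powr (\<alpha> + 2)) * Linf_norm (\<lambda>x. jacobian (E t) (at x)) \<le> ennreal b"
      using E t unfolding force_decay_def by (auto elim!: order_trans[rotated] intro!: SUP_upper2[of t])
    have **: "u \<le> ennreal (b * (1 + t) powr - m)" if u: "ennreal ((1 + t) powr m) * u \<le> ennreal b" for u m
    proof -
      have "u = ennreal ((1 + t) powr - m) * (ennreal ((1 + t) powr m) * u)"
        using t by (simp add: mult.assoc[symmetric] ennreal_mult[symmetric] powr_add[symmetric])
      also have "\<dots> \<le> ennreal ((1 + t) powr - m) * ennreal b" by (intro mult_left_mono u) simp
      also have "\<dots> = ennreal (b * (1 + t) powr - m)"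
        using b by (simp add: ennreal_mult[symmetric] mult.commute)
      finally show ?thesis .
    qed
    from * show ?thesis
      by (intro conjI **) (auto elim: order_trans[rotated] intro: add_increasing add_increasing2)
  qed
  show ?thesis
    unfolding decaying_field_def
  proof (intro conjI allI impI b)
    fix t :: real and x y assume t: "0 \<le> t"
    have "AE x in lebesgue. norm (E t x) \<le> b * (1 + t) powr - (\<alpha> + 1)"
      using le[OF t] b by (intro AE_norm_le_Linf_norm) auto
    then show "norm (E t x) \<le> b * (1 + t) powr - (\<alpha> + 1)"
      by (rule AE_le_continuous_imp_le) (intro continuous_intros cont[OF t])+
    have "AE x in lebesgue. norm (jacobian (E t) (at x)) \<le> b * (1 + t) powr - (\<alpha> + 2)"
      using le[OF t] b by (intro AE_norm_le_Linf_norm) auto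
    then have "AE x in lebesgue. \<forall>h. norm (jacobian (E t) (at x) *v h) \<le> b * (1 + t) powr - (\<alpha> + 2) * norm h"
    proof eventually_elim
      case (elim x)
      then show ?case
        using norm_matrix_vector_mult_le[of "jacobian (E t) (at x)"]
        by (meson mult_right_mono norm_ge_zero order_trans)
    qed
    then show "norm (E t x - E t y) \<le> b * (1 + t) powr - (\<alpha> + 2) * norm (x - y)"
      using diff[OF t] b unfolding jacobian_works
      by (intro lipschitz_of_AE_deriv_bound[where f' = "\<lambda>x h. jacobian (E t) (at x) *v h"]) auto
  qed
qed

text \<open>The integral of (1 + s) powr - \<alpha> over the half-line is 1 / (\<alpha> - 1); this is the place where
\<alpha> > 1 is decisive.\<close>

lemma decay_integral_bound:
  fixes u :: "real \<Rightarrow> 'a::real_normed_vector"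
  assumes u: "\<And>s. 0 \<le> s \<Longrightarrow> (u has_vector_derivative u' s) (at s within {0..})"
    and bd: "\<And>s. 0 \<le> s \<Longrightarrow> s \<le> T \<Longrightarrow> norm (u' s) \<le> K * (1 + s) powr - \<alpha>"
    and \<alpha>: "1 < \<alpha>" and K: "0 \<le> K" and st: "0 \<le> s" "0 \<le> t" "s \<le> T" "t \<le> T"
  shows "norm (u s - u t) \<le> K / (\<alpha> - 1)"
proof -
  define \<phi> where "\<phi> = (\<lambda>s. - (K / (\<alpha> - 1)) * (1 + s) powr (1 - \<alpha>))"
  have *: "norm (u q - u p) \<le> K / (\<alpha> - 1)" if pq: "0 \<le> p" "p < q" "q \<le> T" for p q
  proof -
    have ud: "(u has_vector_derivative u' x) (at x)" if "p < x" for x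
      proof -
      have "{p<..} \<subseteq> {0..}" using pq by auto
      then show ?thesis using u[of x] pq that at_within_open_subset[of x "{p<..}" "{0..}"] by auto
    qed
    have "norm (u q - u p) \<le> \<phi> q - \<phi> p"
    proof (rule differentiable_bound_general[OF pq(2)])
      show "continuous_on {p..q} u"
      proof (rule continuous_on_vector_derivative)
        fix x assume "x \<in> {p..q}"
        then show "(u has_vector_derivative u' x) (at x within {p..q})"
          using pq by (intro has_vector_derivative_within_subset[OF u]) auto
      qed
      show "continuous_on {p..q} \<phi>"
        unfolding \<phi>_def using pq by (intro continuous_intros) auto
    next
      fix x assume x: "p < x" "x < q"
      show "(u has_vector_derivative u' x) (at x)" using ud x by simp
      show "(\<phi> has_vector_derivative (K * (1 + x) powr - \<alpha>)) (at x)"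
      proof -
        have "(\<phi> has_real_derivative (- (K / (\<alpha> - 1)) * ((1 - \<alpha>) * (1 + x) powr (1 - \<alpha> - 1)))) (at x)"
          unfolding \<phi>_def using x pq \<alpha> by (auto intro!: derivative_eq_intros)
        moreover have "- (K / m) * (- m * W) = K * W" if "m \<noteq> 0" for m W :: real
          using that by simp
        from this[of "\<alpha> - 1" "(1 + x) powr - \<alpha>"]
        have "- (K / (\<alpha> - 1)) * ((1 - \<alpha>) * (1 + x) powr (1 - \<alpha> - 1)) = K * (1 + x) powr - \<alpha>"
          using \<alpha> by simp
        ultimately show ?thesis by (simp add: has_real_derivative_iff_has_vector_derivative)
      qed
      show "norm (u' x) \<le> K * (1 + x) powr - \<alpha>" using x pq by (intro bd) auto
    qed
    also have "\<phi> q - \<phi> p \<le> K / (\<alpha> - 1) * (1 + p) powr (1 - \<alpha>)"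
      using K \<alpha> by (simp add: \<phi>_def)
    also have "\<dots> \<le> K / (\<alpha> - 1) * 1"
      using K \<alpha> pq powr_mono2'[of "1 - \<alpha>" 1 "1 + p"] by (intro mult_left_mono) auto
    finally show ?thesis by simp
  qed
  have nn: "0 \<le> K / (\<alpha> - 1)" using K \<alpha> by simp
  consider "s < t" | "s = t" | "t < s" by linarith
  then show ?thesis
    using *[of s t] *[of t s] st nn by cases (auto simp: norm_minus_commute)
qed

text \<open>A Gronwall estimate obtained by absorption instead of exponentials: the largest value of |u| on a
compact time interval enters the increments of u with the total weight b / (\<alpha> - 1) \<le> 1 / 2. The base time
t may come before or after s, so the estimate serves both forward and backward characteristics.\<close>

lemma decay_growth_bound:
  fixes u :: "real \<Rightarrow> 'a::real_normed_vector"
  assumes u: "\<And>s. 0 \<le> s \<Longrightarrow> (u has_vector_derivative u' s) (at s within {0..})"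
    and bd: "\<And>s. 0 \<le> s \<Longrightarrow> norm (u' s) \<le> (b * norm (u s) + F) * (1 + s) powr - \<alpha>"
    and \<alpha>: "1 < \<alpha>" and b: "0 \<le> b" "b / (\<alpha> - 1) \<le> 1/2" and F: "0 \<le> F" and st: "0 \<le> s" "0 \<le> t"
  shows "norm (u s - u t) \<le> 2 / (\<alpha> - 1) * (b * norm (u t) + F)"
proof -
  define T where "T = max s t"
  define M where "M = 1 / (\<alpha> - 1)"
  have M: "0 \<le> M" "b * M \<le> 1/2" using \<alpha> b by (auto simp: M_def)
  have "continuous_on {0..T} u"
  proof (rule continuous_on_vector_derivative)
    fix x assume "x \<in> {0..T}"
    then show "(u has_vector_derivative u' x) (at x within {0..T})"
      by (intro has_vector_derivative_within_subset[OF u]) auto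
  qed
  then have "\<exists>r\<in>{0..T}. \<forall>y\<in>{0..T}. norm (u y) \<le> norm (u r)"
    using st by (intro continuous_attains_sup continuous_intros) (auto simp: T_def)
  \<comment> \<open>The time at which |u| is largest.\<close>
  then obtain r where r: "0 \<le> r" "r \<le> T" and max: "\<And>y. 0 \<le> y \<Longrightarrow> y \<le> T \<Longrightarrow> norm (u y) \<le> norm (u r)"
    by auto
  let ?K = "b * norm (u r) + F"
  have K: "0 \<le> ?K" using b F by auto
  have incr: "norm (u q - u t) \<le> ?K * M" if "0 \<le> q" "q \<le> T" for q
  proof -
    have "norm (u' y) \<le> ?K * (1 + y) powr - \<alpha>" if "0 \<le> y" "y \<le> T" for y
      by (rule order_trans[OF bd[OF that(1)]]) (use max[OF that] b in \<open>auto intro!: mult_right_mono mult_left_mono\<close>)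
    then show ?thesis
      using decay_integral_bound[OF u, of T ?K \<alpha> q t] \<alpha> K that st by (auto simp: M_def T_def)
  qed
  have "norm (u r) \<le> norm (u t) + ?K * M"
    using incr[OF r] norm_triangle_sub[of "u r" "u t"] by linarith
  also have "\<dots> = norm (u t) + (b * M) * norm (u r) + F * M" by (simp add: algebra_simps)
  also have "\<dots> \<le> norm (u t) + 1/2 * norm (u r) + F * M"
    using M by (intro add_mono mult_right_mono) auto
  finally have "norm (u r) \<le> 2 * norm (u t) + 2 * (F * M)" by simp
  then have "b * norm (u r) \<le> b * (2 * norm (u t) + 2 * (F * M))" using b by (intro mult_left_mono)
  also have "\<dots> = 2 * (b * norm (u t)) + 2 * (F * (b * M))" by (simp add: algebra_simps)
  also have "\<dots> \<le> 2 * (b * norm (u t)) + 2 * (F * (1/2))"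
    using M F by (intro add_left_mono mult_left_mono) auto
  finally have "?K \<le> 2 * (b * norm (u t) + F)" using F by simp
  then have "?K * M \<le> 2 * (b * norm (u t) + F) * M" using M by (intro mult_right_mono)
  moreover have "norm (u s - u t) \<le> ?K * M" using st by (intro incr) (auto simp: T_def)
  ultimately show ?thesis by (simp add: M_def)
qed

definition flow_line ::
  "real \<Rightarrow> (real \<Rightarrow> vec3 \<Rightarrow> vec3) \<Rightarrow> (real \<Rightarrow> vec3) \<Rightarrow> (real \<Rightarrow> vec3) \<Rightarrow> bool"
  where "flow_line a E X P \<longleftrightarrow>
    (\<forall>s\<ge>0. (X has_vector_derivative relvel a (P s)) (at s within {0..}) \<and>
           (P has_vector_derivative E s (X s)) (at s within {0..}))"

text \<open>The state at time s with the free transport by the current momentum removed; unlike the position, it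
stays bounded along a flow line.\<close>

definition profile :: "real \<Rightarrow> (real \<Rightarrow> vec3) \<Rightarrow> (real \<Rightarrow> vec3) \<Rightarrow> real \<Rightarrow> phase"
  where "profile a X P s = (X s - s *\<^sub>R relvel a (P s), P s)"

text \<open>The velocity cancels. What remains is the field, multiplied by s and hence one power weaker
in its decay.\<close>

lemma profile_derivative:
  assumes fl: "flow_line a E X P" and a: "0 \<le> a" and s: "0 \<le> s"
  shows "(profile a X P has_vector_derivative
    (- s *\<^sub>R dvel a (P s) (E s (X s)), E s (X s))) (at s within {0..})"
proof -
  have X: "(X has_vector_derivative relvel a (P s)) (at s within {0..})"
    and P: "(P has_vector_derivative E s (X s)) (at s within {0..})"
    using fl s by (auto simp: flow_line_def)
  have "((\<lambda>s. relvel a (P s)) has_vector_derivative dvel a (P s) (E s (X s))) (at s within {0..})"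
    using has_derivative_compose[OF P[unfolded has_vector_derivative_def] has_derivative_relvel[OF a, of "P s" UNIV]]
      linear_cmul[OF has_derivative_linear[OF has_derivative_relvel[OF a, of "P s" UNIV]]]
    by (simp add: has_vector_derivative_def)
  then have "((\<lambda>s. X s - s *\<^sub>R relvel a (P s)) has_vector_derivative
      relvel a (P s) - (s *\<^sub>R dvel a (P s) (E s (X s)) + 1 *\<^sub>R relvel a (P s))) (at s within {0..})"
    by (intro has_vector_derivative_diff X has_vector_derivative_scaleR)
      (auto intro!: derivative_eq_intros)
  then have "((\<lambda>s. X s - s *\<^sub>R relvel a (P s)) has_vector_derivative
      - s *\<^sub>R dvel a (P s) (E s (X s))) (at s within {0..})" by simp
  from has_vector_derivative_Pair[OF this P] show ?thesis
    by (simp add: profile_def[abs_def])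
qed

lemma decay_powr:
  assumes "0 \<le> (s::real)"
  shows "(1 + s) * (1 + s) powr - (\<alpha> + 1) = (1 + s) powr - \<alpha>"
    "(1 + s) * (1 + s) powr - (\<alpha> + 2) = (1 + s) powr - (\<alpha> + 1)"
    "(1 + s) powr - (\<alpha> + 1) \<le> (1 + s) powr - \<alpha>"
  using assms powr_mult_base[of "1 + s" "- (\<alpha> + 1)"] powr_mult_base[of "1 + s" "- (\<alpha> + 2)"]
  by (auto simp: powr_mono algebra_simps)

lemma profile_drift:
  assumes E: "decaying_field \<alpha> b E" and fl: "flow_line a E X P"
    and a: "0 \<le> a" and \<alpha>: "1 < \<alpha>" and st: "0 \<le> s" "0 \<le> t"
  shows "norm (profile a X P s - profile a X P t) \<le> 3 * b / (\<alpha> - 1)"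
proof (rule decay_integral_bound[OF profile_derivative[OF fl a], of "max s t"])
  fix s :: real assume s: "0 \<le> s"
  let ?w = "(1 + s) powr - (\<alpha> + 1)"
  have e: "norm (E s (X s)) \<le> b * ?w" and b: "0 \<le> b" using decaying_fieldD[OF E] s by auto
  have "norm (- s *\<^sub>R dvel a (P s) (E s (X s))) \<le> s * (2 * (b * ?w))"
    using s norm_dvel[OF a, of "P s" "E s (X s)"] e by (auto intro!: mult_left_mono)
  then have "norm (- s *\<^sub>R dvel a (P s) (E s (X s)), E s (X s)) \<le> s * (2 * (b * ?w)) + b * ?w"
    using e norm_Pair_le[of "- s *\<^sub>R dvel a (P s) (E s (X s))" "E s (X s)"] by linarith
  also have "\<dots> \<le> 3 * b * ((1 + s) * ?w)"
    using b s by (simp add: algebra_simps)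
  finally show "norm (- s *\<^sub>R dvel a (P s) (E s (X s)), E s (X s)) \<le> 3 * b * (1 + s) powr - \<alpha>"
    using decay_powr[OF s] by simp
qed (use decaying_fieldD[OF E] \<alpha> st in auto)

text \<open>The positions of two flow lines separate at most like (1 + s) times the distance of their profiles.
The gradient of the field, which decays one power faster than the field, pays for this growth.\<close>

lemma profile_lipschitz:
  assumes E: "decaying_field \<alpha> b E" and fl1: "flow_line a E X1 P1" and fl2: "flow_line a E X2 P2"
    and a: "0 \<le> a" "a \<le> 1" and \<alpha>: "1 < \<alpha>" and b: "12 * b / (\<alpha> - 1) \<le> 1/2" and st: "0 \<le> s" "0 \<le> t"
  shows "norm ((profile a X1 P1 s - profile a X2 P2 s) - (profile a X1 P1 t - profile a X2 P2 t))
     \<le> 24 * b / (\<alpha> - 1) * norm (profile a X1 P1 t - profile a X2 P2 t)"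
proof -
  define u where "u = (\<lambda>s. profile a X1 P1 s - profile a X2 P2 s)"
  define u' where "u' = (\<lambda>s. (- s *\<^sub>R dvel a (P1 s) (E s (X1 s)), E s (X1 s)) - (- s *\<^sub>R dvel a (P2 s) (E s (X2 s)), E s (X2 s)))"
  have b0: "0 \<le> b" using decaying_fieldD[OF E] by auto
  have "norm (u s - u t) \<le> 2 / (\<alpha> - 1) * (12 * b * norm (u t) + 0)"
  proof (rule decay_growth_bound[where u' = u'])
    fix s :: real assume s: "0 \<le> s"
    show "(u has_vector_derivative u' s) (at s within {0..})"
      unfolding u_def u'_def by (intro has_vector_derivative_diff profile_derivative fl1 fl2 a s)
    let ?w = "(1 + s) powr - (\<alpha> + 1)"
    define D where "D = norm (u s)"
    let ?E1 = "E s (X1 s)" and ?E2 = "E s (X2 s)"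
    have e: "norm (E s x) \<le> b * ?w" for x using decaying_fieldD[OF E] s by auto
    have P: "norm (P1 s - P2 s) \<le> D"
      unfolding D_def u_def profile_def using norm_snd_le[of "u s"] by (simp add: norm_Pair)
    have Y: "norm ((X1 s - s *\<^sub>R relvel a (P1 s)) - (X2 s - s *\<^sub>R relvel a (P2 s))) \<le> D"
      unfolding D_def u_def profile_def by (simp add: norm_Pair)
    have "X1 s - X2 s = ((X1 s - s *\<^sub>R relvel a (P1 s)) - (X2 s - s *\<^sub>R relvel a (P2 s)))
        + s *\<^sub>R (relvel a (P1 s) - relvel a (P2 s))" by (simp add: algebra_simps)
    also have "norm \<dots> \<le> D + s * (2 * D)"
      using s Y relvel_lipschitz[OF a(1), of "P1 s" "P2 s"] P
      by (intro order_trans[OF norm_triangle_ineq] add_mono) (auto intro!: mult_left_mono)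
    also have "\<dots> \<le> 2 * D * (1 + s)" by (simp add: D_def algebra_simps)
    finally have X: "norm (X1 s - X2 s) \<le> 2 * D * (1 + s)" .
    have "norm (?E1 - ?E2) \<le> b * (1 + s) powr - (\<alpha> + 2) * norm (X1 s - X2 s)"
      using decaying_fieldD[OF E] s by auto
    also have "\<dots> \<le> b * (1 + s) powr - (\<alpha> + 2) * (2 * D * (1 + s))"
      using X b0 by (intro mult_left_mono) auto
    also have "\<dots> = 2 * b * D * ((1 + s) * (1 + s) powr - (\<alpha> + 2))" by (simp only: mult_ac)
    finally have EE: "norm (?E1 - ?E2) \<le> 2 * b * D * ?w" unfolding decay_powr[OF s] .
    have "dvel a (P1 s) ?E1 - dvel a (P2 s) ?E2 = (dvel a (P1 s) ?E1 - dvel a (P2 s) ?E1) + dvel a (P2 s) (?E1 - ?E2)"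
      using linear_diff[OF has_derivative_linear[OF has_derivative_relvel[OF a(1), of "P2 s" UNIV]], of ?E1 ?E2] by simp
    also have "norm \<dots> \<le> 6 * sqrt a * norm (P1 s - P2 s) * norm ?E1 + 2 * norm (?E1 - ?E2)"
      by (intro order_trans[OF norm_triangle_ineq] add_mono dvel_lipschitz norm_dvel a)
    also have "\<dots> \<le> 6 * 1 * D * (b * ?w) + 2 * (2 * b * D * ?w)"
      using P EE e a b0 by (intro add_mono mult_mono) (auto simp: D_def)
    also have "\<dots> = 10 * b * D * ?w" by simp
    finally have DD: "norm (dvel a (P1 s) ?E1 - dvel a (P2 s) ?E2) \<le> 10 * b * D * ?w" .
    have u'_eq: "u' s = (- (s *\<^sub>R (dvel a (P1 s) ?E1 - dvel a (P2 s) ?E2)), ?E1 - ?E2)"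
      by (simp add: u'_def algebra_simps)
    have "norm (u' s) \<le> s * norm (dvel a (P1 s) ?E1 - dvel a (P2 s) ?E2) + norm (?E1 - ?E2)"
      unfolding u'_eq using s by (intro order_trans[OF norm_Pair_le]) auto
    also have "\<dots> \<le> s * (10 * b * D * ?w) + 2 * b * D * ?w"
      using s by (intro add_mono mult_left_mono DD EE) auto
    also have "\<dots> \<le> 12 * b * D * ((1 + s) * ?w)"
      using s b0 by (simp add: D_def algebra_simps)
    finally show "norm (u' s) \<le> (12 * b * norm (u s) + 0) * (1 + s) powr - \<alpha>"
      unfolding decay_powr[OF s] by (simp add: D_def)
  qed (use b b0 \<alpha> st in auto)
  then show ?thesis by (simp add: u_def)
qed

text \<open>The forcing in the equation for the difference of the profiles has three sources: the fields differ by d,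
the velocities differ by a |p|^3, and their derivatives differ by a |p|^2. The momentum at time s
is within 1 of its value in z, which turns these powers into a power of the weight of z.\<close>

lemma profile_speed_comparison:
  assumes E1: "decaying_field \<alpha> b E1" and E2: "decaying_field \<alpha> b E2"
    and close: "\<And>s x. 0 \<le> s \<Longrightarrow> norm (E1 s x - E2 s x) \<le> d * (1 + s) powr - (\<alpha> + 1)"
    and fl1: "flow_line a E1 X1 P1" and fl2: "flow_line 0 E2 X2 P2"
    and eq: "profile a X1 P1 t = z" "profile 0 X2 P2 t = z"
    and a: "0 \<le> a" and \<alpha>: "1 < \<alpha>" and b: "3 * b / (\<alpha> - 1) \<le> 1/2" and d: "0 \<le> d" and st: "0 \<le> s" "0 \<le> t"
  shows "norm (profile a X1 P1 s - profile 0 X2 P2 s) \<le> 48 / (\<alpha> - 1) * (b * a + d) * jb (snd z) ^ 3"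
proof -
  define J where "J = jb (snd z) ^ 3"
  define u where "u = (\<lambda>s. profile a X1 P1 s - profile 0 X2 P2 s)"
  define u' where "u' = (\<lambda>s. (- s *\<^sub>R dvel a (P1 s) (E1 s (X1 s)), E1 s (X1 s)) - (- s *\<^sub>R dvel 0 (P2 s) (E2 s (X2 s)), E2 s (X2 s)))"
  have b0: "0 \<le> b" using decaying_fieldD[OF E1] by auto
  have b': "b / (\<alpha> - 1) \<ge> 0" using b0 \<alpha> by simp
  have Jge: "1 \<le> J" using jb_ge_1[of "snd z"] by (simp add: J_def one_le_power)
  have F: "0 \<le> 24 * b * a * J + 2 * d" using b0 a Jge d by auto
  have "norm (u s - u t) \<le> 2 / (\<alpha> - 1) * (2 * b * norm (u t) + (24 * b * a * J + 2 * d))"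
  proof (rule decay_growth_bound[where u' = u'])
    fix s :: real assume s: "0 \<le> s"
    show "(u has_vector_derivative u' s) (at s within {0..})"
      unfolding u_def u'_def by (intro has_vector_derivative_diff profile_derivative fl1 fl2 a s order_refl)
    let ?w = "(1 + s) powr - (\<alpha> + 1)"
    define D where "D = norm (u s)"
    let ?E1 = "E1 s (X1 s)" and ?E2 = "E2 s (X2 s)"
    have e: "norm (E1 s x) \<le> b * ?w" for x using decaying_fieldD[OF E1] s by auto
    have P: "norm (P1 s - P2 s) \<le> D"
      unfolding D_def u_def profile_def by (simp add: norm_Pair)
    have Y: "norm ((X1 s - s *\<^sub>R relvel a (P1 s)) - (X2 s - s *\<^sub>R P2 s)) \<le> D"
      unfolding D_def u_def profile_def by (simp add: norm_Pair)
    have "norm (P1 s - snd z) \<le> norm (profile a X1 P1 s - profile a X1 P1 t)"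
      unfolding eq(1)[symmetric] by (simp add: profile_def norm_Pair)
    also have "\<dots> \<le> 3 * b / (\<alpha> - 1)" by (rule profile_drift[OF E1 fl1 a \<alpha> s st(2)])
    also have "\<dots> \<le> 1" using b by simp
    finally have "norm (P1 s) \<le> norm (snd z) + 1" using norm_triangle_sub[of "P1 s" "snd z"] by linarith
    also have "\<dots> \<le> 2 * jb (snd z)" using jb_ge[of "snd z"] by simp
    finally have N: "norm (P1 s) \<le> 2 * jb (snd z)" .
    have N3: "norm (P1 s) ^ 3 \<le> 8 * J"
      using power_mono[OF N, of 3] by (simp add: J_def power_mult_distrib)
    have N2: "(norm (P1 s))\<^sup>2 \<le> 4 * J"
    proof -
      have "(norm (P1 s))\<^sup>2 \<le> 4 * (jb (snd z))\<^sup>2"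
        using power_mono[OF N, of 2] by (simp add: power_mult_distrib)
      also have "(jb (snd z))\<^sup>2 \<le> J" unfolding J_def using jb_ge_1 by (intro power_increasing) auto
      finally show ?thesis by simp
    qed
    have V: "norm (relvel a (P1 s) - P2 s) \<le> a * (8 * J) + D"
    proof -
      have "norm (relvel a (P1 s) - P2 s) \<le> norm (relvel a (P1 s) - P1 s) + norm (P1 s - P2 s)"
        using norm_triangle_ineq[of "relvel a (P1 s) - P1 s" "P1 s - P2 s"] by simp
      also have "\<dots> \<le> a * norm (P1 s) ^ 3 + D" by (intro add_mono norm_relvel_minus a P)
      also have "\<dots> \<le> a * (8 * J) + D" using N3 a by (intro add_mono mult_left_mono) auto
      finally show ?thesis .
    qed
    have "X1 s - X2 s = ((X1 s - s *\<^sub>R relvel a (P1 s)) - (X2 s - s *\<^sub>R P2 s))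
        + s *\<^sub>R (relvel a (P1 s) - P2 s)" by (simp add: algebra_simps)
    also have "norm \<dots> \<le> D + s * (a * (8 * J) + D)"
      using s Y V by (intro order_trans[OF norm_triangle_ineq] add_mono) (auto intro!: mult_left_mono)
    also have "\<dots> \<le> (a * (8 * J) + D) * (1 + s)" using a Jge by (simp add: D_def algebra_simps)
    finally have X: "norm (X1 s - X2 s) \<le> (a * (8 * J) + D) * (1 + s)" .
    have "norm (?E1 - ?E2) \<le> norm (E1 s (X1 s) - E1 s (X2 s)) + norm (E1 s (X2 s) - E2 s (X2 s))"
      using norm_triangle_ineq[of "E1 s (X1 s) - E1 s (X2 s)" "E1 s (X2 s) - E2 s (X2 s)"] by simp
    also have "\<dots> \<le> b * (1 + s) powr - (\<alpha> + 2) * norm (X1 s - X2 s) + d * ?w"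
      using decaying_fieldD[OF E1] s close by (intro add_mono) auto
    also have "\<dots> \<le> b * (1 + s) powr - (\<alpha> + 2) * ((a * (8 * J) + D) * (1 + s)) + d * ?w"
      using X b0 by (intro add_right_mono mult_left_mono) auto
    also have "\<dots> = b * (a * (8 * J) + D) * ((1 + s) * (1 + s) powr - (\<alpha> + 2)) + d * ?w"
      by (simp only: mult_ac)
    also have "\<dots> = (b * D + 8 * b * a * J + d) * ?w"
      unfolding decay_powr[OF s] by (simp add: algebra_simps)
    finally have EE: "norm (?E1 - ?E2) \<le> (b * D + 8 * b * a * J + d) * ?w" .
    have "norm (dvel a (P1 s) ?E1 - ?E2) \<le> norm (dvel a (P1 s) ?E1 - ?E1) + norm (?E1 - ?E2)"
      using norm_triangle_ineq[of "dvel a (P1 s) ?E1 - ?E1" "?E1 - ?E2"] by simp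
    also have "\<dots> \<le> 2 * a * (norm (P1 s))\<^sup>2 * norm ?E1 + (b * D + 8 * b * a * J + d) * ?w"
      by (intro add_mono norm_dvel_minus EE a)
    also have "2 * a * (norm (P1 s))\<^sup>2 * norm ?E1 \<le> 2 * a * (4 * J) * (b * ?w)"
      using a N2 e Jge by (intro mult_mono) auto
    finally have DD: "norm (dvel a (P1 s) ?E1 - ?E2) \<le> (b * D + 16 * b * a * J + d) * ?w"
      by (simp add: algebra_simps)
    have u'_eq: "u' s = (- (s *\<^sub>R (dvel a (P1 s) ?E1 - ?E2)), ?E1 - ?E2)"
      by (simp add: u'_def algebra_simps)
    have "norm (u' s) \<le> s * norm (dvel a (P1 s) ?E1 - ?E2) + norm (?E1 - ?E2)"
      unfolding u'_eq using s by (intro order_trans[OF norm_Pair_le]) auto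
    also have "\<dots> \<le> s * ((b * D + 16 * b * a * J + d) * ?w) + (b * D + 8 * b * a * J + d) * ?w"
      using s by (intro add_mono mult_left_mono DD EE) auto
    also have "\<dots> \<le> (1 + s) * ((b * D + 16 * b * a * J + d) * ?w) + (1 + s) * ((b * D + 8 * b * a * J + d) * ?w)"
    proof -
      have "0 \<le> (b * D + 16 * b * a * J + d) * ?w" "0 \<le> (b * D + 8 * b * a * J + d) * ?w"
        using b0 a Jge d by (auto simp: D_def)
      from mult_right_mono[OF _ this(1), of s "1 + s"] mult_right_mono[OF _ this(2), of 1 "1 + s"]
      show ?thesis using s by simp
    qed
    also have "\<dots> = (2 * b * D + (24 * b * a * J + 2 * d)) * ((1 + s) * ?w)"
      by (simp add: algebra_simps)
    finally show "norm (u' s) \<le> (2 * b * norm (u s) + (24 * b * a * J + 2 * d)) * (1 + s) powr - \<alpha>"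
      unfolding decay_powr[OF s] by (simp add: D_def)
  qed (use b b' b0 \<alpha> st F in auto)
  moreover have "u t = 0" by (simp add: u_def eq)
  ultimately have "norm (u s) \<le> 1 / (\<alpha> - 1) * (48 * (b * a) * J + 4 * d)" by (simp add: algebra_simps)
  also have "\<dots> \<le> 1 / (\<alpha> - 1) * (48 * (b * a) * J + 48 * d * J)"
  proof -
    have "4 * d \<le> 48 * d * J" using mult_left_mono[OF Jge d] d by linarith
    then show ?thesis using \<alpha> by (intro mult_left_mono add_left_mono) auto
  qed
  also have "\<dots> = 48 / (\<alpha> - 1) * (b * a + d) * J" by (simp add: field_simps)
  finally show ?thesis by (simp add: u_def J_def)
qed

section \<open>Mollification\<close>

lemma DERIV_max_0_square: "((\<lambda>u::real. (max 0 u)\<^sup>2) has_real_derivative 2 * max 0 u) (at u)"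
proof -
  consider "u < 0" | "u = 0" | "0 < u" by linarith
  then show ?thesis
  proof cases
    case 1
    have "((\<lambda>u::real. 0) has_real_derivative 2 * max 0 u) (at u)" using 1 by auto
    then show ?thesis
      by (rule has_field_derivative_transform_within_open[where S = "{..<0}"]) (use 1 in auto)
  next
    case 3
    have "((\<lambda>u::real. u\<^sup>2) has_real_derivative 2 * max 0 u) (at u)"
      using 3 by (auto intro!: derivative_eq_intros)
    then show ?thesis
      by (rule has_field_derivative_transform_within_open[where S = "{0<..}"]) (use 3 in auto)
  next
    case 2
    have "((\<lambda>h::real. (max 0 h)\<^sup>2 / h) \<longlongrightarrow> 0) (at 0)"
    proof (rule Lim_null_comparison[where g = "\<lambda>h. \<bar>h\<bar>"])
      show "\<forall>\<^sub>F h::real in at 0. norm ((max 0 h)\<^sup>2 / h) \<le> \<bar>h\<bar>"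
        by (intro always_eventually) (auto simp: max_def power2_eq_square)
      show "((\<lambda>h::real. \<bar>h\<bar>) \<longlongrightarrow> 0) (at 0)" by (rule tendsto_rabs_zero) (rule tendsto_ident_at)
    qed
    then show ?thesis using 2 by (simp add: DERIV_def)
  qed
qed

text \<open>Squaring the truncated parabola makes it continuously differentiable, as a test function has to be.\<close>

definition bump :: "real \<Rightarrow> 'a::real_inner \<Rightarrow> real"
  where "bump e x = (max 0 (1 - (norm x / e)\<^sup>2))\<^sup>2"

definition bump_grad :: "real \<Rightarrow> 'a::real_inner \<Rightarrow> 'a"
  where "bump_grad e x = (- 4 / e\<^sup>2 * max 0 (1 - (norm x / e)\<^sup>2)) *\<^sub>R x"

lemma has_derivative_bump: "(bump e has_derivative (\<lambda>h. h \<bullet> bump_grad e x)) (at x)"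
proof -
  have "((\<lambda>x. 1 - inverse (e\<^sup>2) * (x \<bullet> x)) has_derivative (\<lambda>h. - (inverse (e\<^sup>2) * (2 * (h \<bullet> x))))) (at x)"
    by (auto intro!: derivative_eq_intros simp: inner_commute)
  from has_derivative_compose[OF this DERIV_max_0_square[unfolded has_field_derivative_def]]
  show ?thesis
    by (simp add: bump_def[abs_def] bump_grad_def divide_inverse power_mult_distrib power_inverse
      power2_norm_eq_inner mult_ac)
qed

lemma continuous_on_bump [continuous_intros]:
  "continuous_on S f \<Longrightarrow> continuous_on S (\<lambda>x. bump e (f x))"
  unfolding bump_def divide_inverse by (intro continuous_intros)

lemma continuous_on_bump_grad [continuous_intros]:
  "continuous_on S f \<Longrightarrow> continuous_on S (\<lambda>x. bump_grad e (f x))"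
  unfolding bump_grad_def divide_inverse by (intro continuous_intros)

lemma borel_measurable_bump [measurable]:
  "(bump e :: 'a::euclidean_space \<Rightarrow> real) \<in> borel_measurable borel"
  by (rule borel_measurable_continuous_onI) (intro continuous_intros)

lemma bump_nonneg [simp]: "0 \<le> bump e x"
  by (simp add: bump_def)

lemma bump_le_1: "bump e x \<le> 1"
  unfolding bump_def by (intro power_le_one) auto

lemma bump_eq_0: "0 < e \<Longrightarrow> e \<le> norm x \<Longrightarrow> bump e x = 0"
  using one_le_power[of "norm x / e" 2] by (simp add: bump_def)

lemma bump_grad_eq_0: "0 < e \<Longrightarrow> e \<le> norm x \<Longrightarrow> bump_grad e x = 0"
  using one_le_power[of "norm x / e" 2] by (simp add: bump_grad_def)

lemma bump_minus: "bump e (x - y) = bump e (y - x)"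
  by (simp add: bump_def norm_minus_commute)

lemma bump_ge: "0 < e \<Longrightarrow> norm x \<le> e / 2 \<Longrightarrow> 9 / 16 \<le> bump e x"
proof -
  assume e: "0 < e" "norm x \<le> e / 2"
  have "(norm x / e)\<^sup>2 \<le> (1 / 2)\<^sup>2"
    using e by (intro power_mono) (auto simp: field_simps)
  also have "\<dots> = 1 / 4" by (simp add: power_divide)
  finally have "3 / 4 \<le> max 0 (1 - (norm x / e)\<^sup>2)" by (simp add: le_max_iff_disj)
  then have "(3 / 4)\<^sup>2 \<le> bump e x" unfolding bump_def by (rule power_mono) simp
  then show ?thesis by (simp add: power_divide)
qed

lemma test_function_bump:
  assumes "0 < e"
  shows "test_function UNIV (\<lambda>u. bump e (z - u)) (\<lambda>u. - bump_grad e (z - u))"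
  unfolding test_function_def gderiv_def
proof (intro conjI allI)
  fix u
  have "((\<lambda>u. z - u) has_derivative (\<lambda>h. - h)) (at u)" by (auto intro!: derivative_eq_intros)
  from has_derivative_compose[OF this has_derivative_bump]
  show "((\<lambda>u. bump e (z - u)) has_derivative (\<lambda>h. h \<bullet> - bump_grad e (z - u))) (at u)" by simp
next
  show "continuous_on UNIV (\<lambda>u. - bump_grad e (z - u))" by (intro continuous_intros)
  show "\<exists>K. compact K \<and> K \<subseteq> UNIV \<and> (\<forall>u. u \<notin> K \<longrightarrow> bump e (z - u) = 0)"
    using assms by (intro exI[of _ "cball z e"]) (auto simp: dist_norm not_le intro!: bump_eq_0)
qed

lemma integrable_compact_support:
  fixes f :: "'a::euclidean_space \<Rightarrow> 'b::{banach, second_countable_topology}"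
  assumes "continuous_on UNIV f" "compact K" "\<And>x. x \<notin> K \<Longrightarrow> f x = 0"
  shows "integrable lborel f"
proof -
  have "integrable lborel (\<lambda>x. indicator K x *\<^sub>R f x)"
    using assms by (intro borel_integrable_compact) (auto intro: continuous_on_subset)
  also have "(\<lambda>x. indicator K x *\<^sub>R f x) = f" using assms(3) by (auto simp: indicator_def fun_eq_iff)
  finally show ?thesis .
qed

lemma lborel_distr_reflect: "distr lborel borel (\<lambda>u. z - u) = (lborel :: 'a::euclidean_space measure)"
  using lborel_affine[of "-1" z] by (simp add: density_1)

lemma nn_integral_lborel_reflect:
  fixes H :: "'a::euclidean_space \<Rightarrow> ennreal"
  assumes [measurable]: "H \<in> borel_measurable borel"
  shows "(\<integral>\<^sup>+u. H (z - u) \<partial>lborel) = (\<integral>\<^sup>+u. H u \<partial>lborel)"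
proof -
  have "(\<integral>\<^sup>+u. H u \<partial>lborel) = (\<integral>\<^sup>+u. H u \<partial>distr lborel borel (\<lambda>u. z - u))"
    by (simp add: lborel_distr_reflect)
  also have "\<dots> = (\<integral>\<^sup>+u. H (z - u) \<partial>lborel)" by (rule nn_integral_distr) measurable
  finally show ?thesis by simp
qed

lemma AE_lborel_reflect:
  fixes z :: "'a::euclidean_space"
  assumes "AE u in lborel. Q u"
  shows "AE u in lborel. Q (z - u)"
proof -
  have "AE u in distr lborel borel (\<lambda>u. z - u). Q u"
    using assms by (simp only: lborel_distr_reflect)
  then show ?thesis by (intro AE_distrD[where M' = borel and f = "\<lambda>u. z - u"]) auto
qed

text \<open>The type argument selects the space over which the bump is integrated.\<close>

definition bump_mass :: "'a::euclidean_space itself \<Rightarrow> real \<Rightarrow> real"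
  where "bump_mass _ e = (\<integral>u. bump e (u::'a) \<partial>lborel)"

definition mollify :: "real \<Rightarrow> ('a::euclidean_space \<Rightarrow> real) \<Rightarrow> 'a \<Rightarrow> real"
  where "mollify e f z = (\<integral>u. f u * bump e (z - u) \<partial>lborel) / bump_mass TYPE('a) e"

lemma integrable_bump:
  assumes "0 < e"
  shows "integrable lborel (bump e :: 'a::euclidean_space \<Rightarrow> real)"
  using assms by (intro integrable_compact_support[where K = "cball 0 e"] continuous_intros)
    (auto simp: not_le intro!: bump_eq_0)

lemma nn_integral_bump:
  fixes z :: "'a::euclidean_space"
  assumes "0 < e"
  shows "(\<integral>\<^sup>+u. bump e (z - u) \<partial>lborel) = bump_mass TYPE('a) e"
    and "(\<integral>\<^sup>+u. bump e (u - z) \<partial>lborel) = bump_mass TYPE('a) e"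
proof -
  show "(\<integral>\<^sup>+u. bump e (z - u) \<partial>lborel) = bump_mass TYPE('a) e"
    by (subst nn_integral_lborel_reflect[where H = "\<lambda>u. ennreal (bump e u)"])
      (auto simp: bump_mass_def nn_integral_eq_integral integrable_bump[OF assms])
  then show "(\<integral>\<^sup>+u. bump e (u - z) \<partial>lborel) = bump_mass TYPE('a) e"
    by (simp add: bump_minus)
qed

lemma bump_mass_ge:
  assumes e: "0 < e"
  shows "9 / 16 * (unit_ball_vol DIM('a) * (e / 2) ^ DIM('a)) \<le> bump_mass TYPE('a::euclidean_space) e"
proof -
  have "ennreal (9 / 16 * (unit_ball_vol DIM('a) * (e / 2) ^ DIM('a)))
      = ennreal (9 / 16) * emeasure lborel (cball (0::'a) (e / 2))"
    using e by (subst emeasure_cball) (auto simp only: intro!: ennreal_mult, auto)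
  also have "\<dots> = (\<integral>\<^sup>+u. ennreal (9 / 16) * indicator (cball (0::'a) (e / 2)) u \<partial>lborel)"
    by (rule nn_integral_cmult_indicator[symmetric]) simp
  also have "\<dots> \<le> (\<integral>\<^sup>+u. bump e (u - (0::'a)) \<partial>lborel)"
    using bump_ge[OF e] by (intro nn_integral_mono) (auto simp: indicator_def)
  also have "\<dots> = bump_mass TYPE('a) e" by (rule nn_integral_bump[OF e])
  finally show ?thesis
    by (subst (asm) ennreal_le_iff) (simp_all add: bump_mass_def)
qed

lemma bump_mass_pos:
  assumes "0 < e" shows "0 < bump_mass TYPE('a::euclidean_space) e"
proof -
  have "0 < 9 / 16 * (unit_ball_vol DIM('a) * (e / 2) ^ DIM('a))" using assms by simp
  then show ?thesis using bump_mass_ge[OF assms, where 'a = 'a] by linarith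
qed

lemma integrable_mult_bump:
  fixes f :: "'a::euclidean_space \<Rightarrow> real"
  assumes "continuous_on UNIV f" "0 < e"
  shows "integrable lborel (\<lambda>u. f u * bump e (z - u))"
  using assms by (intro integrable_compact_support[where K = "cball z e"] continuous_intros)
    (auto simp: dist_norm not_le intro!: bump_eq_0)

lemma mollify_tendsto:
  fixes f :: "'a::euclidean_space \<Rightarrow> real"
  assumes f: "continuous_on UNIV f"
  shows "(\<lambda>n. mollify (1 / real (Suc n)) f z) \<longlonglongrightarrow> f z"
proof (rule LIMSEQ_I)
  fix r :: real assume r: "0 < r"
  have "isCont f z" using f by (simp add: continuous_on_eq_continuous_at)
  then obtain d where d: "0 < d" and near: "\<And>u. dist u z < d \<Longrightarrow> \<bar>f u - f z\<bar> < r / 2"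
    using r by (auto simp: continuous_at_eps_delta dist_real_def dest: spec[of _ "r / 2"])
  obtain N where N: "1 / real (Suc N) < d" using nat_approx_posE[OF d] by (auto simp: inverse_eq_divide)
  show "\<exists>no. \<forall>n\<ge>no. norm (mollify (1 / real (Suc n)) f z - f z) < r"
  proof (intro exI allI impI)
    fix n assume n: "N \<le> n"
    define e where "e = 1 / real (Suc n)"
    have e: "0 < e" by (simp add: e_def)
    have "e \<le> 1 / real (Suc N)" using n by (auto simp: e_def intro!: divide_left_mono)
    with N have ed: "e < d" by simp
    let ?m = "bump_mass TYPE('a) e"
    have m: "0 < ?m" using e by (rule bump_mass_pos)
    have ib: "integrable lborel (\<lambda>u. bump e (z - u))"
      using integrable_mult_bump[OF _ e, of "\<lambda>_. 1" z] by simp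
    have mass: "(\<integral>u. bump e (z - u) \<partial>lborel) = ?m"
      using nn_integral_bump(1)[OF e, of z] m
      by (subst (asm) nn_integral_eq_integral) (auto simp: ib less_imp_le)
    have "\<bar>(\<integral>u. f u * bump e (z - u) \<partial>lborel) - ?m * f z\<bar>
        = \<bar>\<integral>u. (f u - f z) * bump e (z - u) \<partial>lborel\<bar>"
      unfolding mass[symmetric]
      by (simp add: left_diff_distrib integrable_mult_bump[OF f e] ib mult.commute[of "f z"])
    also have "\<dots> \<le> (\<integral>u. \<bar>(f u - f z) * bump e (z - u)\<bar> \<partial>lborel)"
      by (rule integral_abs_bound)
    also have "\<dots> \<le> (\<integral>u. r / 2 * bump e (z - u) \<partial>lborel)"
    proof (rule integral_mono)
      show "integrable lborel (\<lambda>u. \<bar>(f u - f z) * bump e (z - u)\<bar>)"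
        by (intro integrable_abs integrable_mult_bump[OF _ e] continuous_intros f)
      fix u show "\<bar>(f u - f z) * bump e (z - u)\<bar> \<le> r / 2 * bump e (z - u)"
      proof (cases "norm (z - u) < e")
        case True
        then have "\<bar>f u - f z\<bar> \<le> r / 2"
          using near[of u] ed by (auto simp: dist_norm norm_minus_commute)
        then show ?thesis
          unfolding abs_mult abs_of_nonneg[OF bump_nonneg] by (intro mult_right_mono) auto
      qed (use bump_eq_0[OF e, of "z - u"] in auto)
    qed (use ib in auto)
    also have "\<dots> = r / 2 * ?m" using mass by simp
    finally have "\<bar>(\<integral>u. f u * bump e (z - u) \<partial>lborel) - ?m * f z\<bar> / ?m \<le> r / 2"
      using m by (simp add: field_simps)
    moreover have "mollify e f z - f z = ((\<integral>u. f u * bump e (z - u) \<partial>lborel) - ?m * f z) / ?m"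
      using m by (simp add: mollify_def field_simps)
    then have "\<bar>mollify e f z - f z\<bar> = \<bar>(\<integral>u. f u * bump e (z - u) \<partial>lborel) - ?m * f z\<bar> / ?m"
      using m by (simp only: abs_divide)
    ultimately have "norm (mollify e f z - f z) < r" using r unfolding real_norm_def by linarith
    then show "norm (mollify (1 / real (Suc n)) f z - f z) < r" unfolding e_def .
  qed
qed

text \<open>The increment of the bump is the integral of its gradient along the segment from a to b. After
exchanging the integrals, the weak gradient moves the derivative from the bump to f.\<close>

lemma mollified_increment:
  fixes f :: "'a::euclidean_space \<Rightarrow> real"
  assumes f: "continuous_on UNIV f" and g: "has_weak_gradient UNIV f g" and e: "0 < e"
  shows "(\<integral>u. f u * bump e (b - u) \<partial>lborel) - (\<integral>u. f u * bump e (a - u) \<partial>lborel)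
    = (\<integral>\<theta>. indicator {0..1} \<theta> *\<^sub>R
        ((LINT u|lebesgue. bump e (a + \<theta> *\<^sub>R (b - a) - u) *\<^sub>R g u) \<bullet> (b - a)) \<partial>lborel)"
proof -
  define h where "h = b - a"
  define k where "k = (\<lambda>(\<theta>, u). f u * (h \<bullet> bump_grad e (a + \<theta> *\<^sub>R h - u)))"
  have [measurable]: "f \<in> borel_measurable borel" using f by (rule borel_measurable_continuous_onI)
  have [measurable]: "(bump_grad e :: 'a \<Rightarrow> 'a) \<in> borel_measurable borel"
    by (rule borel_measurable_continuous_onI) (intro continuous_intros)
  have line: "bump e (b - u) - bump e (a - u) = (\<integral>\<theta>. indicator {0..1} \<theta> *\<^sub>R (h \<bullet> bump_grad e (a + \<theta> *\<^sub>R h - u)) \<partial>lborel)" for u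
  proof -
    have "(\<integral>\<theta>. indicator {0..1} \<theta> *\<^sub>R (h \<bullet> bump_grad e (a + \<theta> *\<^sub>R h - u)) \<partial>lborel)
        = bump e (a + 1 *\<^sub>R h - u) - bump e (a + 0 *\<^sub>R h - u)"
    proof (rule integral_FTC_Icc)
      fix \<theta> :: real
      have "((\<lambda>\<theta>. a + \<theta> *\<^sub>R h - u) has_vector_derivative h) (at \<theta> within {0..1})"
        by (auto intro!: derivative_eq_intros)
      from has_derivative_compose[OF this[unfolded has_vector_derivative_def] has_derivative_bump]
      show "((\<lambda>\<theta>. bump e (a + \<theta> *\<^sub>R h - u)) has_vector_derivative h \<bullet> bump_grad e (a + \<theta> *\<^sub>R h - u)) (at \<theta> within {0..1})"
        by (simp add: has_vector_derivative_def)
    qed (auto intro!: continuous_intros)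
    then show ?thesis by (simp add: h_def)
  qed
  let ?K = "{0..1::real} \<times> cball a (norm h + e)"
  have supp: "bump_grad e (a + \<theta> *\<^sub>R h - u) = 0" if "\<theta> \<in> {0..1}" "u \<notin> cball a (norm h + e)" for \<theta> u
  proof (rule bump_grad_eq_0[OF e])
    have "norm (a - u) \<le> norm (a + \<theta> *\<^sub>R h - u) + norm (\<theta> *\<^sub>R h)"
      using norm_triangle_ineq4[of "a + \<theta> *\<^sub>R h - u" "\<theta> *\<^sub>R h"] by simp
    moreover have "norm (\<theta> *\<^sub>R h) \<le> norm h" using that by (auto intro: mult_left_le_one_le)
    ultimately show "e \<le> norm (a + \<theta> *\<^sub>R h - u)" using that by (auto simp: dist_norm)
  qed
  have "integrable lborel (\<lambda>x. indicator ?K x *\<^sub>R k x)"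
    unfolding k_def split_beta
    by (intro borel_integrable_compact compact_Times compact_Icc compact_cball continuous_intros
      continuous_on_compose2[OF f]) auto
  also have "(\<lambda>x. indicator ?K x *\<^sub>R k x) = (\<lambda>(\<theta>, u). indicator {0..1} \<theta> *\<^sub>R k (\<theta>, u))"
    using supp by (auto simp: fun_eq_iff indicator_def k_def)
  finally have int: "integrable (lborel \<Otimes>\<^sub>M lborel) (\<lambda>(\<theta>, u). indicator {0..1} \<theta> *\<^sub>R k (\<theta>, u))"
    by (simp add: lborel_prod)
  have "(\<integral>u. f u * bump e (b - u) \<partial>lborel) - (\<integral>u. f u * bump e (a - u) \<partial>lborel)
      = (\<integral>u. f u * (bump e (b - u) - bump e (a - u)) \<partial>lborel)"
    by (simp add: right_diff_distrib integrable_mult_bump[OF f e])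
  also have "\<dots> = (\<integral>u. (\<integral>\<theta>. indicator {0..1} \<theta> *\<^sub>R k (\<theta>, u) \<partial>lborel) \<partial>lborel)"
    unfolding line k_def by (simp add: mult.left_commute)
  also have "\<dots> = (\<integral>\<theta>. (\<integral>u. indicator {0..1} \<theta> *\<^sub>R k (\<theta>, u) \<partial>lborel) \<partial>lborel)"
    by (rule lborel_pair.Fubini_integral[OF int])
  also have "\<dots> = (\<integral>\<theta>. indicator {0..1} \<theta> *\<^sub>R ((LINT u|lebesgue. bump e (a + \<theta> *\<^sub>R h - u) *\<^sub>R g u) \<bullet> h) \<partial>lborel)"
  proof (intro Bochner_Integration.integral_cong refl)
    fix \<theta> :: real
    let ?z = "a + \<theta> *\<^sub>R h"
    have i: "integrable lborel (\<lambda>u. f u *\<^sub>R bump_grad e (?z - u))"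
      using f e by (intro integrable_compact_support[where K = "cball ?z e"] continuous_intros)
        (auto simp: dist_norm not_le intro!: bump_grad_eq_0)
    have "(LINT u|lebesgue. f u *\<^sub>R - bump_grad e (?z - u)) = - (LINT u|lebesgue. bump e (?z - u) *\<^sub>R g u)"
      using g test_function_bump[OF e, of ?z] unfolding has_weak_gradient_def by blast
    then have "(LINT u|lebesgue. bump e (?z - u) *\<^sub>R g u) = (LINT u|lebesgue. f u *\<^sub>R bump_grad e (?z - u))"
      by simp
    also have "\<dots> = (LINT u|lborel. f u *\<^sub>R bump_grad e (?z - u))"
      by (rule integral_completion) measurable
    finally have "(LINT u|lebesgue. bump e (?z - u) *\<^sub>R g u) \<bullet> h = (LINT u|lborel. (f u *\<^sub>R bump_grad e (?z - u)) \<bullet> h)"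
      using i by (simp only: integral_inner_left)
    then show "(\<integral>u. indicator {0..1} \<theta> *\<^sub>R k (\<theta>, u) \<partial>lborel)
        = indicator {0..1} \<theta> *\<^sub>R ((LINT u|lebesgue. bump e (?z - u) *\<^sub>R g u) \<bullet> h)"
      by (simp add: k_def inner_commute)
  qed
  finally show ?thesis by (simp add: h_def)
qed

lemma mollified_increment_bound:
  fixes f :: "'a::euclidean_space \<Rightarrow> real" and G :: "'a \<Rightarrow> ennreal"
  assumes f: "continuous_on UNIV f" and g: "has_weak_gradient UNIV f g" and e: "0 < e"
    and [measurable]: "G \<in> borel_measurable borel"
    and G: "AE u in lebesgue. ennreal (norm (g u)) \<le> G u"
  shows "ennreal (bump_mass TYPE('a) e * \<bar>mollify e f b - mollify e f a\<bar>) \<le>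
    ennreal (norm (b - a)) *
      (\<integral>\<^sup>+\<theta>. indicator {0..1} \<theta> * (\<integral>\<^sup>+u. ennreal (bump e (a + \<theta> *\<^sub>R (b - a) - u)) * G u \<partial>lborel) \<partial>lborel)"
proof -
  let ?A = "\<lambda>\<theta>. LINT u|lebesgue. bump e (a + \<theta> *\<^sub>R (b - a) - u) *\<^sub>R g u"
  let ?I = "\<lambda>\<theta>. \<integral>\<^sup>+u. ennreal (bump e (a + \<theta> *\<^sub>R (b - a) - u)) * G u \<partial>lborel"
  have m: "0 < bump_mass TYPE('a) e" by (rule bump_mass_pos[OF e])
  have inner: "ennreal (norm (?A \<theta>)) \<le> ?I \<theta>" for \<theta>
  proof -
    have "ennreal (norm (?A \<theta>)) \<le> (\<integral>\<^sup>+u. norm (bump e (a + \<theta> *\<^sub>R (b - a) - u) *\<^sub>R g u) \<partial>lebesgue)"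
      using integral_norm_bound_ennreal not_integrable_integral_eq
      by (cases "integrable lebesgue (\<lambda>u. bump e (a + \<theta> *\<^sub>R (b - a) - u) *\<^sub>R g u)") fastforce+
    also have "\<dots> \<le> (\<integral>\<^sup>+u. ennreal (bump e (a + \<theta> *\<^sub>R (b - a) - u)) * G u \<partial>lebesgue)"
      using G by (intro nn_integral_mono_AE, eventually_elim) (auto simp: ennreal_mult intro!: mult_left_mono)
    finally show ?thesis by (simp add: nn_integral_completion)
  qed
  have "bump_mass TYPE('a) e * \<bar>mollify e f b - mollify e f a\<bar>
      = \<bar>bump_mass TYPE('a) e * (mollify e f b - mollify e f a)\<bar>"
    using m by (simp add: abs_mult)
  also have "bump_mass TYPE('a) e * (mollify e f b - mollify e f a)
      = (\<integral>\<theta>. indicator {0..1} \<theta> *\<^sub>R (?A \<theta> \<bullet> (b - a)) \<partial>lborel)"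
    unfolding mollified_increment[OF f g e, symmetric] mollify_def using m by (simp add: field_simps)
  finally have "ennreal (bump_mass TYPE('a) e * \<bar>mollify e f b - mollify e f a\<bar>)
      = ennreal (norm (\<integral>\<theta>. indicator {0..1} \<theta> *\<^sub>R (?A \<theta> \<bullet> (b - a)) \<partial>lborel))" by simp
  also have "\<dots> \<le> (\<integral>\<^sup>+\<theta>. norm (indicator {0..1} \<theta> *\<^sub>R (?A \<theta> \<bullet> (b - a))) \<partial>lborel)"
    by (cases "integrable lborel (\<lambda>\<theta>. indicator {0..1} \<theta> *\<^sub>R (?A \<theta> \<bullet> (b - a)))")
      (auto simp: not_integrable_integral_eq integral_norm_bound_ennreal simp del: real_norm_def)
  also have "\<dots> \<le> (\<integral>\<^sup>+\<theta>. ennreal (norm (b - a)) * (indicator {0..1} \<theta> * ?I \<theta>) \<partial>lborel)"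
  proof (intro nn_integral_mono)
    fix \<theta> :: real
    have "ennreal (norm (?A \<theta> \<bullet> (b - a))) \<le> ennreal (norm (?A \<theta>)) * ennreal (norm (b - a))"
      by (simp add: ennreal_mult[symmetric] Cauchy_Schwarz_ineq2 ennreal_leI)
    also have "\<dots> \<le> ?I \<theta> * ennreal (norm (b - a))" by (intro mult_right_mono inner) simp
    finally show "ennreal (norm (indicator {0..1} \<theta> *\<^sub>R (?A \<theta> \<bullet> (b - a)))) \<le> ennreal (norm (b - a)) * (indicator {0..1} \<theta> * ?I \<theta>)"
      by (auto simp: indicator_def mult.commute)
  qed
  also have "\<dots> = ennreal (norm (b - a)) * (\<integral>\<^sup>+\<theta>. indicator {0..1} \<theta> * ?I \<theta> \<partial>lborel)"
    by (rule nn_integral_cmult) measurable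
  finally show ?thesis .
qed


text \<open>The bound on g is known only almost everywhere and may fail on the whole segment, so it is
used on a neighbourhood of the segment, through mollifications of f.\<close>

lemma weak_gradient_lipschitz:
  fixes f :: "'a::euclidean_space \<Rightarrow> real"
  assumes f: "continuous_on UNIV f" and g: "has_weak_gradient UNIV f g"
    and [measurable]: "K \<in> borel_measurable borel"
    and K: "AE u in lebesgue. norm (g u) \<le> K u"
    and r: "0 < r" and B: "0 \<le> B"
    and near: "\<And>\<theta> w. 0 \<le> \<theta> \<Longrightarrow> \<theta> \<le> 1 \<Longrightarrow> norm w \<le> r \<Longrightarrow> K (a + \<theta> *\<^sub>R (b - a) - w) \<le> B"
  shows "\<bar>f b - f a\<bar> \<le> B * norm (b - a)"
proof -
  have moll: "\<bar>mollify e f b - mollify e f a\<bar> \<le> B * norm (b - a)" if e: "0 < e" "e \<le> r" for e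
  proof -
    let ?m = "bump_mass TYPE('a) e"
    have m: "0 < ?m" by (rule bump_mass_pos[OF e(1)])
    have "ennreal (?m * \<bar>mollify e f b - mollify e f a\<bar>) \<le> ennreal (norm (b - a)) *
      (\<integral>\<^sup>+\<theta>. indicator {0..1} \<theta> * (\<integral>\<^sup>+u. ennreal (bump e (a + \<theta> *\<^sub>R (b - a) - u)) * ennreal (K u) \<partial>lborel) \<partial>lborel)"
      using K by (intro mollified_increment_bound[OF f g e(1)]) (auto elim!: eventually_mono intro: ennreal_leI)
    also have "\<dots> \<le> ennreal (norm (b - a)) * (\<integral>\<^sup>+\<theta>. ennreal (?m * B) * indicator {0..1::real} \<theta> \<partial>lborel)"
    proof (intro mult_left_mono nn_integral_mono)
      fix \<theta> :: real
      have "(\<integral>\<^sup>+u. ennreal (bump e (a + \<theta> *\<^sub>R (b - a) - u)) * ennreal (K u) \<partial>lborel) \<le> ennreal (?m * B)"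
        if \<theta>: "\<theta> \<in> {0..1}"
      proof -
        have "(\<integral>\<^sup>+u. ennreal (bump e (a + \<theta> *\<^sub>R (b - a) - u)) * ennreal (K u) \<partial>lborel)
            \<le> (\<integral>\<^sup>+u. ennreal (bump e (a + \<theta> *\<^sub>R (b - a) - u)) * ennreal B \<partial>lborel)"
        proof (intro nn_integral_mono)
          fix u
          show "ennreal (bump e (a + \<theta> *\<^sub>R (b - a) - u)) * ennreal (K u) \<le> ennreal (bump e (a + \<theta> *\<^sub>R (b - a) - u)) * ennreal B"
          proof (cases "norm (a + \<theta> *\<^sub>R (b - a) - u) \<le> e")
            case True
            then show ?thesis
              using near[of \<theta> "a + \<theta> *\<^sub>R (b - a) - u"] \<theta> e by (intro mult_left_mono ennreal_leI) auto
          qed (simp add: bump_eq_0[OF e(1)])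
        qed
        also have "\<dots> = ennreal (?m * B)"
          by (simp add: nn_integral_multc nn_integral_bump[OF e(1)] ennreal_mult'' B)
        finally show ?thesis .
      qed
      then show "indicator {0..1} \<theta> * (\<integral>\<^sup>+u. ennreal (bump e (a + \<theta> *\<^sub>R (b - a) - u)) * ennreal (K u) \<partial>lborel)
          \<le> ennreal (?m * B) * indicator {0..1} \<theta>"
        by (auto simp: indicator_def)
    qed auto
    also have "\<dots> = ennreal (?m * (B * norm (b - a)))"
      using m B by (subst nn_integral_cmult_indicator) (auto simp: ennreal_mult[symmetric] mult_ac)
    finally have "?m * \<bar>mollify e f b - mollify e f a\<bar> \<le> ?m * (B * norm (b - a))"
      using m B by (subst (asm) ennreal_le_iff) auto
    then show ?thesis using m by simp
  qed
  have "(\<lambda>n. \<bar>mollify (1 / real (Suc n)) f b - mollify (1 / real (Suc n)) f a\<bar>) \<longlonglongrightarrow> \<bar>f b - f a\<bar>"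
    by (intro tendsto_intros mollify_tendsto f)
  moreover have "\<forall>\<^sub>F n in sequentially. \<bar>mollify (1 / real (Suc n)) f b - mollify (1 / real (Suc n)) f a\<bar> \<le> B * norm (b - a)"
  proof -
    have "\<forall>\<^sub>F n in sequentially. 1 / real (Suc n) < r"
      using LIMSEQ_inverse_real_of_nat r by (auto simp: inverse_eq_divide dest: order_tendstoD)
    then show ?thesis by eventually_elim (intro moll, auto)
  qed
  ultimately show ?thesis by (rule tendsto_upperbound) simp
qed

text \<open>Two points that S maps into the same ball of radius e are within 4 e of each other, so the integrand is
supported in a ball of radius 4 e. This replaces a change of variables for S, which need not be
differentiable.\<close>

lemma nn_integral_bump_expansive:
  fixes S :: "'a::euclidean_space \<Rightarrow> 'a"
  assumes e: "0 < e" and exp: "\<And>z z'. norm (z - z') \<le> 2 * norm (S z - S z')"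
  shows "(\<integral>\<^sup>+z. bump e (S z - u) \<partial>lborel) \<le> ennreal (unit_ball_vol DIM('a) * (4 * e) ^ DIM('a))"
proof (cases "\<exists>z0. norm (S z0 - u) < e")
  case True
  then obtain z0 where z0: "norm (S z0 - u) < e" by blast
  have "(\<integral>\<^sup>+z. bump e (S z - u) \<partial>lborel) \<le> (\<integral>\<^sup>+z. indicator (cball z0 (4 * e)) z \<partial>lborel)"
  proof (intro nn_integral_mono)
    fix z
    show "ennreal (bump e (S z - u)) \<le> indicator (cball z0 (4 * e)) z"
    proof (cases "norm (S z - u) < e")
      case True
      have "norm (S z0 - S z) \<le> norm (S z0 - u) + norm (S z - u)"
        using norm_triangle_ineq4[of "S z0 - u" "S z - u"] by simp
      with True z0 exp[of z0 z] have "z \<in> cball z0 (4 * e)" by (simp add: dist_norm)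
      then show ?thesis using bump_le_1[of e "S z - u"] by simp
    qed (simp add: bump_eq_0[OF e])
  qed
  also have "\<dots> = ennreal (unit_ball_vol DIM('a) * (4 * e) ^ DIM('a))"
    using e by (simp add: emeasure_cball)
  finally show ?thesis .
next
  case False
  then have "bump e (S z - u) = 0" for z by (intro bump_eq_0[OF e]) (auto simp: not_less)
  then show ?thesis by simp
qed

text \<open>The mollified increments of f along the segments from S1 z to S2 z are bounded by averages of the
gradient around the interpolated points. Integrating in z first, with the point u at which the
gradient is evaluated held fixed, leaves only the integral of a bump composed with an
expansive map. The weight m may be moved from z to u because the two are close. The constant
(16 / 9) 8 ^ n compares the volume of a ball of radius 4 e with the mass of the bump, which is at
least 9 / 16 on the ball of radius e / 2.\<close>

lemma L1_distance_of_compositions: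
  fixes f :: "'a::euclidean_space \<Rightarrow> real" and m :: "'a \<Rightarrow> real"
  assumes f: "continuous_on UNIV f" and g: "has_weak_gradient UNIV f g"
    and S1: "continuous_on UNIV S1" and S2: "continuous_on UNIV S2"
    and [measurable]: "G \<in> borel_measurable borel" "m \<in> borel_measurable borel"
    and G: "AE u in lebesgue. ennreal (norm (g u)) \<le> G u"
    and exp: "\<And>\<theta> z z'. 0 \<le> \<theta> \<Longrightarrow> \<theta> \<le> 1 \<Longrightarrow>
      norm (z - z') \<le> 2 * norm ((S1 z + \<theta> *\<^sub>R (S2 z - S1 z)) - (S1 z' + \<theta> *\<^sub>R (S2 z' - S1 z')))"
    and close: "\<And>z. norm (S2 z - S1 z) \<le> \<kappa> * m z"
    and m: "\<And>\<theta> z u. 0 \<le> \<theta> \<Longrightarrow> \<theta> \<le> 1 \<Longrightarrow> norm (S1 z + \<theta> *\<^sub>R (S2 z - S1 z) - u) \<le> 1 \<Longrightarrow> m z \<le> A * m u"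
    and \<kappa>: "0 \<le> \<kappa>" and A: "0 \<le> A"
  shows "(\<integral>\<^sup>+z. \<bar>f (S2 z) - f (S1 z)\<bar> \<partial>lborel)
    \<le> ennreal (16 / 9 * 8 ^ DIM('a) * \<kappa> * A) * (\<integral>\<^sup>+u. ennreal (m u) * G u \<partial>lborel)"
proof -
  define V where "V = unit_ball_vol DIM('a)"
  have V: "0 < V" by (simp add: V_def)
  let ?C = "16 / 9 * 8 ^ DIM('a) * \<kappa> * A"
  let ?I = "\<integral>\<^sup>+u. ennreal (m u) * G u \<partial>lborel"
  have [measurable]: "S1 \<in> borel_measurable borel" "S2 \<in> borel_measurable borel" "f \<in> borel_measurable borel"
    using S1 S2 f by (auto intro: borel_measurable_continuous_onI)
  have [measurable]: "mollify e f \<in> borel_measurable borel" for e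
    unfolding mollify_def by measurable
  have moll: "(\<integral>\<^sup>+z. \<bar>mollify e f (S2 z) - mollify e f (S1 z)\<bar> \<partial>lborel) \<le> ennreal ?C * ?I" if e: "0 < e" "e \<le> 1" for e
  proof -
    let ?M = "bump_mass TYPE('a) e"
    have M: "0 < ?M" by (rule bump_mass_pos[OF e(1)])
    define S where "S = (\<lambda>\<theta> z. S1 z + \<theta> *\<^sub>R (S2 z - S1 z))"
    have [measurable]: "(\<lambda>(\<theta>, z). S \<theta> z) \<in> borel_measurable (borel \<Otimes>\<^sub>M borel)"
      unfolding S_def by measurable
    let ?b = "\<lambda>\<theta> z u. ennreal (bump e (S \<theta> z - u))"
    let ?D = "\<integral>\<^sup>+z. \<bar>mollify e f (S2 z) - mollify e f (S1 z)\<bar> \<partial>lborel"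
    let ?T = "\<lambda>\<theta> z. \<integral>\<^sup>+u. ?b \<theta> z u * (ennreal (m u) * G u) \<partial>lborel"
    have pt: "ennreal (?M * \<bar>mollify e f (S2 z) - mollify e f (S1 z)\<bar>)
        \<le> ennreal (\<kappa> * A) * (\<integral>\<^sup>+\<theta>. indicator {0..1} \<theta> * ?T \<theta> z \<partial>lborel)" for z
    proof -
      have "ennreal (?M * \<bar>mollify e f (S2 z) - mollify e f (S1 z)\<bar>) \<le> ennreal (norm (S2 z - S1 z)) *
          (\<integral>\<^sup>+\<theta>. indicator {0..1} \<theta> * (\<integral>\<^sup>+u. ?b \<theta> z u * G u \<partial>lborel) \<partial>lborel)"
        unfolding S_def by (rule mollified_increment_bound[OF f g e(1) _ G]) measurable
      also have "\<dots> = (\<integral>\<^sup>+\<theta>. indicator {0..1} \<theta> * (\<integral>\<^sup>+u. ennreal (norm (S2 z - S1 z)) * (?b \<theta> z u * G u) \<partial>lborel) \<partial>lborel)"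
        by (simp add: nn_integral_cmult[symmetric] mult_ac)
      also have "\<dots> \<le> (\<integral>\<^sup>+\<theta>. indicator {0..1} \<theta> * (\<integral>\<^sup>+u. ennreal (\<kappa> * A) * (?b \<theta> z u * (ennreal (m u) * G u)) \<partial>lborel) \<partial>lborel)"
      proof (intro nn_integral_mono)
        fix \<theta> :: real
        have "(\<integral>\<^sup>+u. ennreal (norm (S2 z - S1 z)) * (?b \<theta> z u * G u) \<partial>lborel)
           \<le> (\<integral>\<^sup>+u. ennreal (\<kappa> * A) * (?b \<theta> z u * (ennreal (m u) * G u)) \<partial>lborel)" if \<theta>: "\<theta> \<in> {0..1}"
        proof (intro nn_integral_mono)
          fix u
          show "ennreal (norm (S2 z - S1 z)) * (?b \<theta> z u * G u) \<le> ennreal (\<kappa> * A) * (?b \<theta> z u * (ennreal (m u) * G u))"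
          proof (cases "norm (S \<theta> z - u) \<le> e")
            case True
            have "norm (S2 z - S1 z) \<le> \<kappa> * (A * m u)"
              using close[of z] m[of \<theta> z u] True \<theta> e \<kappa> by (force simp: S_def intro: order_trans mult_left_mono)
            then have "ennreal (norm (S2 z - S1 z)) \<le> ennreal (\<kappa> * A) * ennreal (m u)"
              using \<kappa> A by (simp add: ennreal_mult'[symmetric] ennreal_leI mult.assoc)
            then have "ennreal (norm (S2 z - S1 z)) * (?b \<theta> z u * G u) \<le> ennreal (\<kappa> * A) * ennreal (m u) * (?b \<theta> z u * G u)"
              by (rule mult_right_mono) simp
            then show ?thesis by (simp add: mult_ac)
          qed (simp add: bump_eq_0[OF e(1)])
        qed
        then show "indicator {0..1} \<theta> * (\<integral>\<^sup>+u. ennreal (norm (S2 z - S1 z)) * (?b \<theta> z u * G u) \<partial>lborel)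
           \<le> indicator {0..1} \<theta> * (\<integral>\<^sup>+u. ennreal (\<kappa> * A) * (?b \<theta> z u * (ennreal (m u) * G u)) \<partial>lborel)"
          by (auto simp: indicator_def)
      qed
      also have "\<dots> = ennreal (\<kappa> * A) * (\<integral>\<^sup>+\<theta>. indicator {0..1} \<theta> * ?T \<theta> z \<partial>lborel)"
      proof -
        have "indicator {0..1} \<theta> * (\<integral>\<^sup>+u. ennreal (\<kappa> * A) * (?b \<theta> z u * (ennreal (m u) * G u)) \<partial>lborel)
            = ennreal (\<kappa> * A) * (indicator {0..1} \<theta> * ?T \<theta> z)" for \<theta> :: real
          by (subst nn_integral_cmult, measurable) (rule mult.left_commute)
        then show ?thesis by (simp only:) (rule nn_integral_cmult, measurable)
      qed
      finally show ?thesis .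
    qed
    have "ennreal ?M * ?D
        = (\<integral>\<^sup>+z. ennreal (?M * \<bar>mollify e f (S2 z) - mollify e f (S1 z)\<bar>) \<partial>lborel)"
      using M by (simp add: nn_integral_cmult[symmetric] ennreal_mult)
    also have "\<dots> \<le> (\<integral>\<^sup>+z. ennreal (\<kappa> * A) * (\<integral>\<^sup>+\<theta>. indicator {0..1} \<theta> * ?T \<theta> z \<partial>lborel) \<partial>lborel)"
      by (intro nn_integral_mono pt)
    also have "\<dots> = ennreal (\<kappa> * A) * (\<integral>\<^sup>+z. (\<integral>\<^sup>+\<theta>. indicator {0..1} \<theta> * ?T \<theta> z \<partial>lborel) \<partial>lborel)"
      by (rule nn_integral_cmult) measurable
    also have "(\<integral>\<^sup>+z. (\<integral>\<^sup>+\<theta>. indicator {0..1} \<theta> * ?T \<theta> z \<partial>lborel) \<partial>lborel)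
        = (\<integral>\<^sup>+\<theta>. (\<integral>\<^sup>+z. indicator {0..1} \<theta> * ?T \<theta> z \<partial>lborel) \<partial>lborel)"
      by (rule lborel_pair.Fubini') measurable
    also have "\<dots> = (\<integral>\<^sup>+\<theta>. indicator {0..1} \<theta> * (\<integral>\<^sup>+z. ?T \<theta> z \<partial>lborel) \<partial>lborel)"
      by (intro nn_integral_cong nn_integral_cmult) measurable
    also have "\<dots> \<le> (\<integral>\<^sup>+\<theta>. ennreal (V * (4 * e) ^ DIM('a)) * ?I * indicator {0..1::real} \<theta> \<partial>lborel)"
    proof (intro nn_integral_mono)
      fix \<theta> :: real
      have "(\<integral>\<^sup>+z. ?T \<theta> z \<partial>lborel) \<le> ennreal (V * (4 * e) ^ DIM('a)) * ?I"
        if \<theta>: "\<theta> \<in> {0..1}"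
      proof -
        have [measurable]: "S \<theta> \<in> borel_measurable borel" unfolding S_def by measurable
        have "(\<integral>\<^sup>+z. ?T \<theta> z \<partial>lborel)
            = (\<integral>\<^sup>+u. (\<integral>\<^sup>+z. ?b \<theta> z u * (ennreal (m u) * G u) \<partial>lborel) \<partial>lborel)"
          by (rule lborel_pair.Fubini') measurable
        also have "\<dots> = (\<integral>\<^sup>+u. (\<integral>\<^sup>+z. ?b \<theta> z u \<partial>lborel) * (ennreal (m u) * G u) \<partial>lborel)"
          by (intro nn_integral_cong nn_integral_multc) measurable
        also have "\<dots> \<le> (\<integral>\<^sup>+u. ennreal (V * (4 * e) ^ DIM('a)) * (ennreal (m u) * G u) \<partial>lborel)"
          unfolding V_def using exp[of \<theta>] \<theta>
          by (intro nn_integral_mono mult_right_mono nn_integral_bump_expansive e) (auto simp: S_def)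
        also have "\<dots> = ennreal (V * (4 * e) ^ DIM('a)) * ?I" by (rule nn_integral_cmult) measurable
        finally show ?thesis .
      qed
      then show "indicator {0..1} \<theta> * (\<integral>\<^sup>+z. ?T \<theta> z \<partial>lborel)
          \<le> ennreal (V * (4 * e) ^ DIM('a)) * ?I * indicator {0..1} \<theta>"
        by (auto simp: indicator_def)
    qed
    also have "\<dots> = ennreal (V * (4 * e) ^ DIM('a)) * ?I"
      by (subst nn_integral_cmult_indicator) auto
    finally have main: "ennreal ?M * ?D
        \<le> ennreal (\<kappa> * A) * (ennreal (V * (4 * e) ^ DIM('a)) * ?I)" by (simp add: mult_left_mono)
    have "4 * e = 8 * (e / 2)" by simp
    then have "V * (4 * e) ^ DIM('a) = 16 / 9 * 8 ^ DIM('a) * (9 / 16 * (V * (e / 2) ^ DIM('a)))"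
      by (simp only: power_mult_distrib) simp
    also have "\<dots> \<le> 16 / 9 * 8 ^ DIM('a) * ?M"
      using bump_mass_ge[OF e(1), where 'a = 'a] by (intro mult_left_mono) (auto simp: V_def)
    finally have "ennreal (V * (4 * e) ^ DIM('a)) \<le> ennreal (16 / 9 * 8 ^ DIM('a)) * ennreal ?M"
      using M by (simp add: ennreal_mult[symmetric] ennreal_leI)
    then have "ennreal (\<kappa> * A) * (ennreal (V * (4 * e) ^ DIM('a)) * ?I)
        \<le> ennreal (\<kappa> * A) * ((ennreal (16 / 9 * 8 ^ DIM('a)) * ennreal ?M) * ?I)"
      by (intro mult_left_mono mult_right_mono) auto
    with main have "ennreal ?M * ?D
        \<le> ennreal (\<kappa> * A) * ((ennreal (16 / 9 * 8 ^ DIM('a)) * ennreal ?M) * ?I)" by (rule order_trans)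
    also have "\<dots> = ennreal ?M * ((ennreal (16 / 9 * 8 ^ DIM('a)) * ennreal (\<kappa> * A)) * ?I)"
      by (simp only: mult_ac)
    also have "ennreal (16 / 9 * 8 ^ DIM('a)) * ennreal (\<kappa> * A) = ennreal ?C"
      using \<kappa> A by (subst ennreal_mult[symmetric]) (auto simp: mult.assoc)
    finally show ?thesis
      using M by (subst (asm) ennreal_mult_le_mult_iff) auto
  qed
  let ?m = "\<lambda>n z. \<bar>mollify (1 / real (Suc n)) f (S2 z) - mollify (1 / real (Suc n)) f (S1 z)\<bar>"
  have "(\<integral>\<^sup>+z. \<bar>f (S2 z) - f (S1 z)\<bar> \<partial>lborel)
      = (\<integral>\<^sup>+z. liminf (\<lambda>n. ennreal (?m n z)) \<partial>lborel)"
  proof (intro nn_integral_cong)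
    fix z
    have "(\<lambda>n. ennreal (?m n z))
        \<longlonglongrightarrow> ennreal \<bar>f (S2 z) - f (S1 z)\<bar>"
      by (intro tendsto_ennrealI tendsto_intros mollify_tendsto f)
    then show "ennreal \<bar>f (S2 z) - f (S1 z)\<bar>
        = liminf (\<lambda>n. ennreal (?m n z))"
      by (intro lim_imp_Liminf[symmetric]) auto
  qed
  also have "\<dots> \<le> liminf (\<lambda>n. \<integral>\<^sup>+z. ennreal (?m n z) \<partial>lborel)"
    by (rule nn_integral_liminf) measurable
  also have "\<dots> \<le> liminf (\<lambda>n. ennreal ?C * ?I)"
    by (intro Liminf_mono always_eventually allI moll) auto
  also have "\<dots> = ennreal ?C * ?I" by (simp add: Liminf_const)
  finally show ?thesis .
qed

section \<open>The velocity as a variable of integration\<close>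

text \<open>The matrix is (1 - c p p^T) / \<gamma> with c = a / \<gamma>^2, and 1 - c |p|^2 = 1 / \<gamma>^2.\<close>

lemma det_dvel:
  assumes a: "0 \<le> a"
  shows "det (matrix (dvel a (p::vec3))) = inverse (lorentz a p) ^ 5"
proof -
  define g where "g = lorentz a p"
  have g: "0 < g" "g\<^sup>2 = 1 + a * (p \<bullet> p)"
    using lorentz_pos[OF a, of p] lorentz_sq[OF a, of p] by (auto simp: g_def power2_norm_eq_inner)
  define i where "i = inverse g"
  define c where "c = a / g\<^sup>2"
  have pp: "p \<bullet> p = p$1 * p$1 + p$2 * p$2 + p$3 * p$3"
    by (simp add: inner_vec_def sum_3)
  have ent: "matrix (dvel a p) $ m $ n = i * ((if m = n then 1 else 0) - c * p$m * p$n)" for m n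
  proof -
    have "p \<bullet> axis n 1 = p $ n" by (simp add: inner_axis)
    then show ?thesis
      by (auto simp: matrix_def dvel_def g_def[symmetric] i_def c_def axis_def divide_inverse algebra_simps)
  qed
  have "det (matrix (dvel a p)) = i ^ 3 * (1 - c * (p \<bullet> p))"
    unfolding det_3 ent pp by (simp add: power3_eq_cube algebra_simps)
  also have "1 - c * (p \<bullet> p) = i\<^sup>2"
  proof -
    have "g\<^sup>2 * c = a" using g(1) by (simp add: c_def)
    then have "g\<^sup>2 * (1 - c * (p \<bullet> p)) = g\<^sup>2 - a * (p \<bullet> p)"
      by (simp add: right_diff_distrib mult.assoc[symmetric])
    then have "g\<^sup>2 * (1 - c * (p \<bullet> p)) = 1" using g(2) by simp
    moreover have "i\<^sup>2 * (g\<^sup>2 * (1 - c * (p \<bullet> p))) = 1 - c * (p \<bullet> p)"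
      using g(1) by (simp add: i_def power_inverse mult.assoc[symmetric])
    ultimately show ?thesis by simp
  qed
  also have "i ^ 3 * i\<^sup>2 = i ^ 5" by (simp add: power_add[symmetric])
  finally show ?thesis by (simp add: i_def g_def)
qed

lemma norm_relvel_sq:
  assumes a: "0 \<le> a"
  shows "a * (norm (relvel a p))\<^sup>2 = 1 - inverse ((lorentz a p)\<^sup>2)"
proof -
  have g: "0 < lorentz a p" by (rule lorentz_pos[OF a])
  have "a * (norm (relvel a p))\<^sup>2 = (a * (norm p)\<^sup>2) * inverse ((lorentz a p)\<^sup>2)"
    using g by (simp add: relvel_lorentz power_mult_distrib power_inverse mult_ac)
  also have "a * (norm p)\<^sup>2 = (lorentz a p)\<^sup>2 - 1" by (simp add: lorentz_sq[OF a])
  finally show ?thesis using g by (simp add: left_diff_distrib)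
qed

lemma inj_relvel:
  assumes a: "0 \<le> a"
  shows "inj (relvel a)"
proof (rule injI)
  fix p q :: 'a assume eq: "relvel a p = relvel a q"
  then have "inverse ((lorentz a p)\<^sup>2) = inverse ((lorentz a q)\<^sup>2)"
    using norm_relvel_sq[OF a, of p] norm_relvel_sq[OF a, of q] by simp
  then have "lorentz a p = lorentz a q"
    using lorentz_pos[OF a, of p] lorentz_pos[OF a, of q] by (simp add: power2_eq_iff_nonneg)
  with eq show "p = q" using lorentz_pos[OF a, of q] by (simp add: relvel_lorentz)
qed

lemma range_relvel:
  assumes a: "0 \<le> a"
  shows "range (relvel a) = {q :: 'a::real_inner. a * (norm q)\<^sup>2 < 1}"
proof (intro subset_antisym subsetI)
  fix q :: 'a assume "q \<in> range (relvel a)"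
  then obtain p where "q = relvel a p" by auto
  then show "q \<in> {q. a * (norm q)\<^sup>2 < 1}"
    using norm_relvel_sq[OF a, of p] lorentz_pos[OF a, of p] by simp
next
  fix q :: 'a assume "q \<in> {q. a * (norm q)\<^sup>2 < 1}"
  then have q: "0 < 1 - a * (norm q)\<^sup>2" by simp
  define s where "s = sqrt (1 - a * (norm q)\<^sup>2)"
  have s: "0 < s" "s\<^sup>2 = 1 - a * (norm q)\<^sup>2" using q by (auto simp: s_def)
  have "1 + a * (norm (q /\<^sub>R s))\<^sup>2 = (inverse s)\<^sup>2"
    using s by (simp add: power_mult_distrib power_inverse field_simps)
  then have "lorentz a (q /\<^sub>R s) = inverse s" using s by (simp add: lorentz_def)
  then have "relvel a (q /\<^sub>R s) = q" using s by (simp add: relvel_lorentz)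
  then show "q \<in> range (relvel a)" by (metis rangeI)
qed

lemma borel_measurable_relvel [measurable]:
  "(relvel a :: 'a::euclidean_space \<Rightarrow> 'a) \<in> borel_measurable borel"
  unfolding relvel_def[abs_def] by measurable

lemma borel_measurable_lorentz [measurable]:
  "(lorentz a :: 'a::euclidean_space \<Rightarrow> real) \<in> borel_measurable borel"
  unfolding lorentz_def[abs_def] by measurable

text \<open>The unqualified name of this operation is taken by the particle density.\<close>

abbreviation weighted :: "'a measure \<Rightarrow> ('a \<Rightarrow> ennreal) \<Rightarrow> 'a measure"
  where "weighted \<equiv> Nonnegative_Lebesgue_Integration.density"

text \<open>The substitution q = v(p) as an identity between measures, which covers both kinds of integrals. It suffices
to compare the measures on Borel sets, where it is the formula for the volume of a differentiable image.
For a > 0 the velocities fill only the ball of radius 1 / sqrt a.\<close>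

lemma distr_relvel:
  assumes a: "0 \<le> a"
  shows "distr (weighted lborel (\<lambda>p. ennreal (inverse (lorentz a p) ^ 5))) borel (relvel a)
    = weighted lborel (indicator {q::vec3. a * (norm q)\<^sup>2 < 1})"
proof (cases "a = 0")
  case True
  then show ?thesis by (simp add: lorentz_def relvel_def[abs_def] density_1 distr_id2)
next
  case False
  with a have a0: "0 < a" by simp
  let ?B = "{q::vec3. a * (norm q)\<^sup>2 < 1}"
  let ?w = "\<lambda>p::vec3. inverse (lorentz a p) ^ 5"
  have [measurable]: "?B \<in> sets borel" by measurable
  have "?B \<subseteq> cball 0 (inverse (sqrt a))"
  proof
    fix q :: vec3 assume "q \<in> ?B"
    then have "(sqrt a * norm q)\<^sup>2 < 1\<^sup>2" using a by (simp add: power_mult_distrib)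
    then have "sqrt a * norm q < 1" by (rule power2_less_imp_less) simp
    then show "q \<in> cball 0 (inverse (sqrt a))" using a0 by (simp add: field_simps)
  qed
  then have "bounded ?B" using bounded_subset bounded_cball by blast
  then have BL: "?B \<in> lmeasurable" by (intro bounded_set_imp_lmeasurable) auto
  show ?thesis
  proof (rule measure_eqI)
    fix A :: "vec3 set" assume "A \<in> sets (distr (weighted lborel (\<lambda>p. ennreal (?w p))) borel (relvel a))"
    then have [measurable]: "A \<in> sets borel" by simp
    define S where "S = relvel a -` A"
    have [measurable]: "S \<in> sets borel" unfolding S_def using measurable_sets[OF borel_measurable_relvel, of A] by simp
    have img: "relvel a ` S = A \<inter> ?B"
      unfolding S_def range_relvel[OF a, symmetric] by auto
    have L: "A \<inter> ?B \<in> lmeasurable" using fmeasurable_Int_fmeasurable[OF BL, of A] by (simp add: Int_commute)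
    have "((\<lambda>p. \<bar>det (matrix (dvel a p))\<bar>) has_integral measure lebesgue (A \<inter> ?B)) S"
      using has_measure_differentiable_image[of S "relvel a" "dvel a" "measure lebesgue (A \<inter> ?B)"]
        has_derivative_relvel[OF a] inj_on_subset[OF inj_relvel[OF a]] L img by auto
    then have "(?w has_integral measure lebesgue (A \<inter> ?B)) S"
    proof -
      have "\<bar>?w p\<bar> = ?w p" for p using lorentz_pos[OF a, of p] by simp
      then show ?thesis using \<open>(_ has_integral _) S\<close> by (simp only: det_dvel[OF a])
    qed
    then have "(\<integral>\<^sup>+p. ennreal (indicator S p * ?w p) \<partial>lborel) = ennreal (measure lebesgue (A \<inter> ?B))"
      by (intro nn_integral_has_integral_lebesgue) (auto intro!: less_imp_le[OF lorentz_pos[OF a]])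
    also have "\<dots> = emeasure lebesgue (A \<inter> ?B)" using L by (simp add: emeasure_eq_measure2)
    also have "\<dots> = emeasure lborel (A \<inter> ?B)" by simp
    finally have *: "(\<integral>\<^sup>+p. ennreal (indicator S p * ?w p) \<partial>lborel) = emeasure lborel (A \<inter> ?B)" .
    have "emeasure (distr (weighted lborel (\<lambda>p. ennreal (?w p))) borel (relvel a)) A
        = (\<integral>\<^sup>+p. ennreal (?w p) * indicator S p \<partial>lborel)"
      by (simp add: emeasure_distr emeasure_density flip: S_def)
    also have "\<dots> = emeasure lborel (A \<inter> ?B)"
      unfolding *[symmetric] by (intro nn_integral_cong) (auto simp: indicator_def)
    also have "\<dots> = emeasure (weighted lborel (indicator ?B)) A"
      by (simp add: emeasure_density nn_integral_set_ennreal[symmetric]) 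
        (simp add: indicator_inter_arith[symmetric] Int_commute)
    finally show "emeasure (distr (weighted lborel (\<lambda>p. ennreal (?w p))) borel (relvel a)) A
        = emeasure (weighted lborel (indicator ?B)) A" .
  qed simp
qed

lemma nn_integral_relvel:
  fixes H :: "vec3 \<Rightarrow> ennreal"
  assumes a: "0 \<le> a" and [measurable]: "H \<in> borel_measurable borel"
  shows "(\<integral>\<^sup>+p. ennreal (inverse (lorentz a p) ^ 5) * H (relvel a p) \<partial>lborel)
    = (\<integral>\<^sup>+q. indicator {q. a * (norm q)\<^sup>2 < 1} q * H q \<partial>lborel)"
proof -
  have "(\<integral>\<^sup>+p. ennreal (inverse (lorentz a p) ^ 5) * H (relvel a p) \<partial>lborel)
      = (\<integral>\<^sup>+q. H q \<partial>distr (weighted lborel (\<lambda>p. ennreal (inverse (lorentz a p) ^ 5))) borel (relvel a))"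
    by (simp add: nn_integral_distr nn_integral_density)
  also have "\<dots> = (\<integral>\<^sup>+q. indicator {q. a * (norm q)\<^sup>2 < 1} q * H q \<partial>lborel)"
    unfolding distr_relvel[OF a] by (simp add: nn_integral_density)
  finally show ?thesis .
qed

lemma integral_relvel:
  fixes H :: "vec3 \<Rightarrow> real"
  assumes a: "0 \<le> a" and [measurable]: "H \<in> borel_measurable borel"
  shows "(\<integral>p. inverse (lorentz a p) ^ 5 * H (relvel a p) \<partial>lborel)
    = (\<integral>q. indicator {q. a * (norm q)\<^sup>2 < 1} q * H q \<partial>lborel)"
    and "integrable lborel (\<lambda>p. inverse (lorentz a p) ^ 5 * H (relvel a p)) \<longleftrightarrow>
      integrable lborel (\<lambda>q. indicator {q. a * (norm q)\<^sup>2 < 1} q * H q)"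
proof -
  let ?D = "weighted lborel (\<lambda>p::vec3. ennreal (inverse (lorentz a p) ^ 5))"
  have ind: "(\<lambda>q::vec3. indicator {q. a * (norm q)\<^sup>2 < 1} q :: ennreal) = (\<lambda>q. ennreal (indicator {q. a * (norm q)\<^sup>2 < 1} q))"
    by (auto simp: indicator_def fun_eq_iff)
  have w: "AE p in lborel. 0 \<le> inverse (lorentz a (p::vec3)) ^ 5"
    by (auto intro!: AE_I2 less_imp_le[OF lorentz_pos[OF a]])
  have "(\<integral>p. inverse (lorentz a p) ^ 5 * H (relvel a p) \<partial>lborel) = (\<integral>q. H q \<partial>distr ?D borel (relvel a))"
    using w by (simp add: integral_distr integral_density)
  also have "\<dots> = (\<integral>q. indicator {q. a * (norm q)\<^sup>2 < 1} q * H q \<partial>lborel)"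
    unfolding distr_relvel[OF a] ind by (subst integral_density) auto
  finally show "(\<integral>p. inverse (lorentz a p) ^ 5 * H (relvel a p) \<partial>lborel)
    = (\<integral>q. indicator {q. a * (norm q)\<^sup>2 < 1} q * H q \<partial>lborel)" .
  have "integrable lborel (\<lambda>p. inverse (lorentz a p) ^ 5 * H (relvel a p)) \<longleftrightarrow> integrable ?D (\<lambda>p. H (relvel a p))"
    using w by (subst integrable_density) auto
  also have "\<dots> \<longleftrightarrow> integrable (distr ?D borel (relvel a)) H"
    by (rule integrable_distr_eq[symmetric]) auto
  also have "\<dots> \<longleftrightarrow> integrable lborel (\<lambda>q. indicator {q. a * (norm q)\<^sup>2 < 1} q * H q)"
    unfolding distr_relvel[OF a] ind by (subst integrable_density) auto
  finally show "integrable lborel (\<lambda>p. inverse (lorentz a p) ^ 5 * H (relvel a p)) \<longleftrightarrow>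
      integrable lborel (\<lambda>q. indicator {q. a * (norm q)\<^sup>2 < 1} q * H q)" .
qed

section \<open>Radial decay\<close>

lemma measurable_cball [measurable]:
  "Measurable.pred borel (\<lambda>x. x \<in> cball (c::'a::euclidean_space) r)"
  by (auto simp: pred_def)

text \<open>Between the radii r and 2 r, the function is bounded by its decay at radius r and the volume by that
of the larger ball.\<close>

lemma nn_integral_shell:
  fixes H :: "vec3 \<Rightarrow> ennreal"
  assumes [measurable]: "H \<in> borel_measurable borel"
    and H: "AE x in lborel. R \<le> norm x \<longrightarrow> H x \<le> ennreal (C * norm x powr - m)"
    and r: "0 < r" "R \<le> r" and C: "0 \<le> C" and m: "0 \<le> m"
  shows "(\<integral>\<^sup>+x. H x * indicator (cball 0 (2 * r)) x \<partial>lborel)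
    \<le> (\<integral>\<^sup>+x. H x * indicator (cball 0 r) x \<partial>lborel) + ennreal (8 * C * unit_ball_vol 3 * r powr (3 - m))"
proof -
  have "(\<integral>\<^sup>+x. H x * indicator (cball 0 (2 * r)) x \<partial>lborel)
      \<le> (\<integral>\<^sup>+x. H x * indicator (cball 0 r) x + ennreal (C * r powr - m) * indicator (cball 0 (2 * r)) x \<partial>lborel)"
  proof (intro nn_integral_mono_AE)
    show "AE x in lborel. H x * indicator (cball 0 (2 * r)) x
        \<le> H x * indicator (cball 0 r) x + ennreal (C * r powr - m) * indicator (cball 0 (2 * r)) x"
      using H
    proof eventually_elim
      case (elim x)
      show ?case
      proof (cases "norm x \<le> r")
        case False
        then have "H x \<le> ennreal (C * norm x powr - m)" using elim r by simp
        also have "\<dots> \<le> ennreal (C * r powr - m)"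
          using False r C m by (intro ennreal_leI mult_left_mono powr_mono2') auto
        finally show ?thesis using False by (auto simp: indicator_def)
      qed (simp add: indicator_def)
    qed
  qed
  also have "\<dots> = (\<integral>\<^sup>+x. H x * indicator (cball 0 r) x \<partial>lborel)
      + ennreal (C * r powr - m) * emeasure lborel (cball (0::vec3) (2 * r))"
    by (subst nn_integral_add, measurable) (subst nn_integral_cmult_indicator, simp_all)
  also have "ennreal (C * r powr - m) * emeasure lborel (cball (0::vec3) (2 * r))
      = ennreal (8 * C * unit_ball_vol 3 * r powr (3 - m))"
  proof -
    have "r powr 3 = r ^ 3" using r powr_realpow[of r 3] by simp
    then have "r powr (3 - m) = r ^ 3 * r powr - m"
      using r powr_add[of r 3 "- m"] by simp
    then have "C * r powr - m * (unit_ball_vol 3 * (2 * r) ^ 3) = 8 * C * unit_ball_vol 3 * r powr (3 - m)"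
      by (simp add: power_mult_distrib)
    then show ?thesis
      using r C by (subst emeasure_cball) (auto simp: ennreal_mult[symmetric])
  qed
  finally show ?thesis .
qed

text \<open>The dyadic shells contribute a geometric series with ratio 2 powr (3 - m) > 1, which is dominated by its
last term. The constant A is chosen so that the bound reproduces itself when the radius is doubled.\<close>

lemma nn_integral_cball_growth:
  fixes H :: "vec3 \<Rightarrow> ennreal"
  assumes [measurable]: "H \<in> borel_measurable borel"
    and H: "AE x in lborel. R \<le> norm x \<longrightarrow> H x \<le> ennreal (C * norm x powr - m)"
    and R: "0 < R" and C: "0 \<le> C" and m: "0 \<le> m" "m < 3"
    and fin: "(\<integral>\<^sup>+x. H x * indicator (cball 0 R) x \<partial>lborel) < \<infinity>"
  shows "\<exists>A\<ge>0. \<forall>r\<ge>R. (\<integral>\<^sup>+x. H x * indicator (cball 0 r) x \<partial>lborel) \<le> ennreal (A * r powr (3 - m))"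
proof -
  define M where "M = (\<lambda>r. \<integral>\<^sup>+x. H x * indicator (cball 0 r) x \<partial>lborel)"
  define D where "D = 8 * C * unit_ball_vol 3"
  define g where "g = 3 - m"
  have D: "0 \<le> D" using C by (simp add: D_def)
  have g: "0 < g" using m by (simp add: g_def)
  have step: "M (2 * r) \<le> M r + ennreal (D * r powr g)" if "R \<le> r" for r
    unfolding M_def D_def g_def using R that by (intro nn_integral_shell[OF assms(1) H _ that C m(1)]) auto
  have "M (2 * R) \<le> M R + ennreal (D * R powr g)" by (rule step) simp
  also have "\<dots> < \<infinity>" using fin by (simp add: M_def)
  finally have "M (2 * R) < \<infinity>" .
  then obtain B where B: "0 \<le> B" "M (2 * R) = ennreal B" by (cases "M (2 * R)") auto
  define q where "q = 2 powr g"
  have q: "1 < q" unfolding q_def using g by (simp add: gr_one_powr)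
  \<comment> \<open>The first summand starts the induction on [R, 2 R], the second one makes A q \<ge> A + D.\<close>
  define A where "A = B / R powr g + D / (q - 1)"
  have A: "0 \<le> A" using B D q R by (simp add: A_def)
  have A1: "B \<le> A * R powr g" using D q R by (simp add: A_def field_simps)
  have A2: "A + D \<le> A * q"
  proof -
    have "D = D / (q - 1) * (q - 1)" using q by simp
    also have "\<dots> \<le> A * (q - 1)" using B R q by (intro mult_right_mono) (auto simp: A_def)
    finally show ?thesis by (simp add: algebra_simps)
  qed
  have ind: "R \<le> r \<Longrightarrow> r \<le> 2 ^ Suc n * R \<Longrightarrow> M r \<le> ennreal (A * r powr g)" for n r
  proof (induction n arbitrary: r)
    case 0
    then have "M r \<le> M (2 * R)"
      unfolding M_def by (intro nn_integral_mono) (auto simp: indicator_def)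
    also have "\<dots> \<le> ennreal (A * R powr g)" using A1 by (simp add: B ennreal_leI)
    also have "\<dots> \<le> ennreal (A * r powr g)"
      using 0 R g A by (intro ennreal_leI mult_left_mono powr_mono2) auto
    finally show ?case .
  next
    case (Suc n)
    show ?case
    proof (cases "r \<le> 2 * R")
      case True
      then have "M r \<le> M (2 * R)"
        unfolding M_def by (intro nn_integral_mono) (auto simp: indicator_def)
      also have "\<dots> \<le> ennreal (A * R powr g)" using A1 by (simp add: B ennreal_leI)
      also have "\<dots> \<le> ennreal (A * r powr g)"
        using Suc.prems R g A by (intro ennreal_leI mult_left_mono powr_mono2) auto
      finally show ?thesis .
    next
      case False
      let ?h = "r / 2"
      have h: "R \<le> ?h" "?h \<le> 2 ^ Suc n * R" using False Suc.prems by auto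
      have "M (2 * ?h) \<le> M ?h + ennreal (D * ?h powr g)" by (rule step[OF h(1)])
      also have "\<dots> \<le> ennreal (A * ?h powr g) + ennreal (D * ?h powr g)"
        by (intro add_right_mono Suc.IH h)
      also have "\<dots> = ennreal ((A + D) * ?h powr g)"
        using A D by (simp add: distrib_right)
      also have "\<dots> \<le> ennreal ((A * q) * ?h powr g)" using A2 by (intro ennreal_leI mult_right_mono) auto
      also have "(A * q) * ?h powr g = A * r powr g"
        using h R powr_mult[of 2 ?h g] by (simp add: q_def)
      finally show ?thesis by simp
    qed
  qed
  have "M r \<le> ennreal (A * r powr g)" if "R \<le> r" for r
  proof -
    obtain n :: nat where "r / R < 2 ^ n" using real_arch_pow[of 2 "r / R"] by auto
    then have "r \<le> 2 ^ Suc n * R" using R that by (simp add: field_simps)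
    then show ?thesis using ind that by blast
  qed
  then show ?thesis using A unfolding M_def g_def by blast
qed

text \<open>Here the geometric series of the dyadic shells has ratio 2 powr (3 - k) < 1.\<close>

lemma nn_integral_jb_finite:
  assumes k: "3 < k"
  shows "(\<integral>\<^sup>+x. ennreal (jb (x::vec3) powr - k) \<partial>lborel) < \<infinity>"
proof -
  let ?H = "\<lambda>x::vec3. ennreal (jb x powr - k)"
  define D where "D = 8 * 1 * unit_ball_vol 3"
  define q where "q = (2::real) powr (3 - k)"
  have D: "0 \<le> D" by (simp add: D_def)
  have q: "0 < q" "q < 1" using k powr_less_mono[of "3 - k" 0 2] by (auto simp: q_def)
  define M where "M = (\<lambda>n::nat. \<integral>\<^sup>+x. ?H x * indicator (cball 0 (2 ^ n)) x \<partial>lborel)"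
  have bd: "?H x \<le> ennreal (1 * norm x powr - k)" if "1 \<le> norm x" for x
    using that norm_le_jb[of x] k by (intro ennreal_leI) (auto intro!: powr_mono2')
  have step: "M (Suc n) \<le> M n + ennreal (D * q ^ n)" for n
  proof -
    have "(2 ^ n) powr (3 - k) = q ^ n"
      by (simp add: q_def powr_realpow[symmetric] powr_powr mult.commute)
    moreover have "M (Suc n) \<le> M n + ennreal (8 * 1 * unit_ball_vol 3 * (2 ^ n) powr (3 - k))"
      unfolding M_def power_Suc using k
      by (intro nn_integral_shell[where R = 1] AE_I2 impI bd) auto
    ultimately show ?thesis by (simp add: D_def)
  qed
  have M0: "M 0 \<le> ennreal (unit_ball_vol 3)"
  proof -
    have "M 0 \<le> (\<integral>\<^sup>+x. indicator (cball 0 1) x \<partial>(lborel :: vec3 measure))"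
      unfolding M_def using k powr_mono2'[of "- k" 1 "jb _", OF _ _ jb_ge_1]
      by (intro nn_integral_mono) (auto simp: indicator_def)
    also have "\<dots> = ennreal (unit_ball_vol 3)" by (simp add: emeasure_cball)
    finally show ?thesis .
  qed
  have "M n \<le> ennreal (unit_ball_vol 3 + (\<Sum>j<n. D * q ^ j))" for n
  proof (induction n)
    case (Suc n)
    have "M (Suc n) \<le> ennreal (unit_ball_vol 3 + (\<Sum>j<n. D * q ^ j)) + ennreal (D * q ^ n)"
      by (rule order_trans[OF step add_right_mono[OF Suc]])
    also have "\<dots> = ennreal (unit_ball_vol 3 + (\<Sum>j<Suc n. D * q ^ j))"
      using D q by (subst ennreal_plus[symmetric]) (auto intro!: add_nonneg_nonneg sum_nonneg simp: add.assoc)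
    finally show ?case .
  qed (use M0 in simp)
  moreover have "(\<Sum>j<n. D * q ^ j) \<le> D * (1 / (1 - q))" for n
  proof -
    have "(\<Sum>j<n. q ^ j) \<le> (\<Sum>j. q ^ j)" using q by (intro sum_le_suminf summable_geometric) auto
    also have "\<dots> = 1 / (1 - q)" using q by (intro suminf_geometric) auto
    finally show ?thesis using D by (simp only: sum_distrib_left[symmetric] mult_left_mono)
  qed
  ultimately have M: "M n \<le> ennreal (unit_ball_vol 3 + D * (1 / (1 - q)))" for n
    by (meson add_left_mono ennreal_leI order_trans)
  have "(\<integral>\<^sup>+x. ?H x \<partial>lborel) = (\<integral>\<^sup>+x. (SUP n. ?H x * indicator (cball 0 (2 ^ n)) x) \<partial>lborel)"
  proof (intro nn_integral_cong antisym SUP_least)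
    fix x :: vec3
    obtain n :: nat where "norm x < 2 ^ n" using real_arch_pow[of 2 "norm x"] by auto
    then show "?H x \<le> (SUP n. ?H x * indicator (cball 0 (2 ^ n)) x)"
      by (intro SUP_upper2[of n]) auto
  qed (auto simp: indicator_def)
  also have "\<dots> = (SUP n. M n)"
    unfolding M_def
  proof (rule nn_integral_monotone_convergence_SUP)
    show "incseq (\<lambda>n x. ?H x * indicator (cball 0 (2 ^ n)) x)"
    proof (intro incseq_SucI le_funI)
      fix n :: nat and x :: vec3
      have "cball 0 (2 ^ n) \<subseteq> cball (0::vec3) (2 ^ Suc n)" by (rule subset_cball) simp
      then show "?H x * indicator (cball 0 (2 ^ n)) x \<le> ?H x * indicator (cball 0 (2 ^ Suc n)) x"
        by (cases "x \<in> cball 0 (2 ^ n)") (auto simp del: mem_cball power_Suc)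
    qed
  qed measurable
  also have "\<dots> \<le> ennreal (unit_ball_vol 3 + D * (1 / (1 - q)))" by (intro SUP_least M)
  finally show ?thesis by (rule le_less_trans) simp
qed


section \<open>Dispersion\<close>

lemma nn_integral_lborel_scale:
  fixes H :: "vec3 \<Rightarrow> ennreal"
  assumes [measurable]: "H \<in> borel_measurable borel" and t: "0 < t"
  shows "(\<integral>\<^sup>+q. H (x - t *\<^sub>R q) \<partial>lborel) = ennreal (t powr - 3) * (\<integral>\<^sup>+z. H z \<partial>lborel)"
proof -
  have "(\<integral>\<^sup>+z. H z \<partial>lborel)
      = (\<integral>\<^sup>+z. H z \<partial>weighted (distr lborel borel (\<lambda>q. x + (- t) *\<^sub>R q)) (\<lambda>_. \<bar>- t\<bar> ^ DIM(vec3)))"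
    using lborel_affine[of "- t" x] t by simp
  also have "\<dots> = ennreal (t ^ 3) * (\<integral>\<^sup>+q. H (x - t *\<^sub>R q) \<partial>lborel)"
    using t by (simp add: nn_integral_density nn_integral_distr nn_integral_cmult ennreal_power)
  finally have "ennreal (t powr - 3) * (\<integral>\<^sup>+z. H z \<partial>lborel)
      = (ennreal (t powr - 3) * ennreal (t ^ 3)) * (\<integral>\<^sup>+q. H (x - t *\<^sub>R q) \<partial>lborel)"
    by (simp only: mult.assoc)
  also have "ennreal (t powr - 3) * ennreal (t ^ 3) = 1"
  proof -
    have "t powr - 3 * t ^ 3 = t powr - 3 * t powr 3" using t powr_realpow[of t 3] by simp
    also have "\<dots> = 1" unfolding powr_add[symmetric] using t by simp
    finally have eq: "t powr - 3 * t ^ 3 = 1" .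
    have "ennreal (t powr - 3) * ennreal (t ^ 3) = ennreal (t powr - 3 * t ^ 3)"
      using t by (intro ennreal_mult[symmetric]) auto
    then show ?thesis by (simp only: eq ennreal_1)
  qed
  finally show ?thesis by simp
qed

text \<open>The density at time t of freely moving particles that start with the phase space density
<x> powr - k <p> powr - 6. It dominates all differences of densities below.\<close>

definition dispersed :: "real \<Rightarrow> real \<Rightarrow> real \<Rightarrow> vec3 \<Rightarrow> ennreal"
  where "dispersed k a t x =
    (\<integral>\<^sup>+p. ennreal (jb (x - t *\<^sub>R relvel a p) powr - k * jb p powr - 6) \<partial>lborel)"

lemma borel_measurable_dispersed [measurable]: "dispersed k a t \<in> borel_measurable borel"
  unfolding dispersed_def[abs_def] by measurable

lemma jb_powr_le_1: "0 \<le> k \<Longrightarrow> jb x powr - k \<le> 1"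
  using powr_mono2'[of "- k" 1 "jb x"] jb_ge_1[of x] by simp

lemma lorentz_le_jb: "a \<le> 1 \<Longrightarrow> lorentz a p \<le> jb p"
  unfolding lorentz_def jb_def using mult_right_mono[of a 1 "(norm p)\<^sup>2"] by simp

text \<open>For t \<le> 1 the weight in p is integrable by itself. For t \<ge> 1 it is at most the Jacobian of the velocity,
because \<gamma> is at most <p>, and substituting the velocity makes the scaling factor t powr - 3 appear.\<close>

lemma dispersed_le:
  assumes k: "3 < k"
  shows "\<exists>C\<ge>0. \<forall>a t x. 0 \<le> a \<longrightarrow> a \<le> 1 \<longrightarrow> 0 \<le> t \<longrightarrow> dispersed k a t x \<le> ennreal (C * (1 + t) powr - 3)"
proof -
  obtain J6 where J6: "0 \<le> J6" "(\<integral>\<^sup>+p. ennreal (jb (p::vec3) powr - 6) \<partial>lborel) = ennreal J6"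
    using nn_integral_jb_finite[of 6] by (cases "\<integral>\<^sup>+p. ennreal (jb (p::vec3) powr - 6) \<partial>lborel") auto
  obtain Jk where Jk: "0 \<le> Jk" "(\<integral>\<^sup>+p. ennreal (jb (p::vec3) powr - k) \<partial>lborel) = ennreal Jk"
    using nn_integral_jb_finite[OF k] by (cases "\<integral>\<^sup>+p. ennreal (jb (p::vec3) powr - k) \<partial>lborel") auto
  have "dispersed k a t x \<le> ennreal (8 * (J6 + Jk) * (1 + t) powr - 3)" if a: "0 \<le> a" "a \<le> 1" and t: "0 \<le> t" for a t x
  proof (cases "t \<le> 1")
    case True
    have "dispersed k a t x \<le> (\<integral>\<^sup>+p. ennreal (jb (p::vec3) powr - 6) \<partial>lborel)"
      unfolding dispersed_def using k
      by (intro nn_integral_mono ennreal_leI) (auto intro!: mult_left_le_one_le jb_powr_le_1)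
    also have "\<dots> = ennreal J6" by (rule J6(2))
    also have "J6 = 8 * J6 * 2 powr - 3" by (simp add: powr_minus)
    also have "ennreal (8 * J6 * 2 powr - 3) \<le> ennreal (8 * (J6 + Jk) * 2 powr - 3)"
      using Jk by (intro ennreal_leI mult_right_mono) auto
    also have "\<dots> \<le> ennreal (8 * (J6 + Jk) * (1 + t) powr - 3)"
      using True t J6 Jk by (intro ennreal_leI mult_mono powr_mono2') auto
    finally show ?thesis .
  next
    case False
    then have t1: "1 < t" by simp
    have w: "jb p powr - 6 \<le> inverse (lorentz a p) ^ 5" for p :: vec3
    proof -
      have "jb p powr - 6 \<le> jb p powr - 5" using jb_ge_1[of p] by (intro powr_mono) auto
      also have "\<dots> \<le> lorentz a p powr - 5"
        using lorentz_pos[OF a(1), of p] lorentz_le_jb[OF a(2), of p] by (intro powr_mono2') auto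
      also have "\<dots> = inverse (lorentz a p) ^ 5"
        using lorentz_pos[OF a(1), of p] powr_realpow[of "lorentz a p" 5] by (simp add: powr_minus power_inverse)
      finally show ?thesis .
    qed
    have "dispersed k a t x \<le> (\<integral>\<^sup>+p. ennreal (inverse (lorentz a p) ^ 5) * ennreal (jb (x - t *\<^sub>R relvel a p) powr - k) \<partial>lborel)"
      unfolding dispersed_def
    proof (intro nn_integral_mono)
      fix p :: vec3
      let ?j = "jb (x - t *\<^sub>R relvel a p) powr - k"
      have "ennreal (?j * jb p powr - 6) \<le> ennreal (inverse (lorentz a p) ^ 5 * ?j)"
        using mult_right_mono[OF w[of p], of ?j] by (intro ennreal_leI) (simp add: mult.commute)
      also have "\<dots> = ennreal (inverse (lorentz a p) ^ 5) * ennreal ?j"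
        using less_imp_le[OF lorentz_pos[OF a(1), of p]] by (intro ennreal_mult) auto
      finally show "ennreal (?j * jb p powr - 6) \<le> ennreal (inverse (lorentz a p) ^ 5) * ennreal ?j" .
    qed
    also have "\<dots> = (\<integral>\<^sup>+q. indicator {q. a * (norm q)\<^sup>2 < 1} q * ennreal (jb (x - t *\<^sub>R q) powr - k) \<partial>lborel)"
      by (rule nn_integral_relvel[OF a(1), where H = "\<lambda>q. ennreal (jb (x - t *\<^sub>R q) powr - k)"]) measurable
    also have "\<dots> \<le> (\<integral>\<^sup>+q. ennreal (jb (x - t *\<^sub>R q) powr - k) \<partial>lborel)"
      by (intro nn_integral_mono) (auto simp: indicator_def)
    also have "\<dots> = ennreal (t powr - 3) * ennreal Jk"
      unfolding Jk(2)[symmetric] using t1 by (intro nn_integral_lborel_scale[where H = "\<lambda>z. ennreal (jb z powr - k)"]) auto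
    also have "\<dots> = ennreal (Jk * t powr - 3)" using Jk by (simp add: ennreal_mult[symmetric] mult.commute)
    also have "\<dots> \<le> ennreal (8 * (J6 + Jk) * (1 + t) powr - 3)"
    proof (rule ennreal_leI)
      have "t powr - 3 \<le> ((1 + t) / 2) powr - 3" using t1 by (intro powr_mono2') auto
      also have "\<dots> = 8 * (1 + t) powr - 3" using t1 by (simp add: powr_divide powr_minus field_simps)
      finally have "Jk * t powr - 3 \<le> Jk * (8 * (1 + t) powr - 3)" using Jk by (intro mult_left_mono)
      also have "\<dots> \<le> 8 * (J6 + Jk) * (1 + t) powr - 3" using J6 by (simp add: algebra_simps)
      finally show "Jk * t powr - 3 \<le> 8 * (J6 + Jk) * (1 + t) powr - 3" .
    qed
    finally show ?thesis .
  qed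
  then show ?thesis using J6 Jk by (intro exI[of _ "8 * (J6 + Jk)"]) auto
qed

lemma nn_integral_dispersed:
  assumes k: "3 < k"
  shows "\<exists>C\<ge>0. \<forall>a t. (\<integral>\<^sup>+x. dispersed k a t x \<partial>lborel) \<le> ennreal C"
proof -
  obtain J6 where J6: "0 \<le> J6" "(\<integral>\<^sup>+p. ennreal (jb (p::vec3) powr - 6) \<partial>lborel) = ennreal J6"
    using nn_integral_jb_finite[of 6] by (cases "\<integral>\<^sup>+p. ennreal (jb (p::vec3) powr - 6) \<partial>lborel") auto
  obtain Jk where Jk: "0 \<le> Jk" "(\<integral>\<^sup>+p. ennreal (jb (p::vec3) powr - k) \<partial>lborel) = ennreal Jk"
    using nn_integral_jb_finite[OF k] by (cases "\<integral>\<^sup>+p. ennreal (jb (p::vec3) powr - k) \<partial>lborel") auto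
  have "(\<integral>\<^sup>+x. dispersed k a t x \<partial>lborel) \<le> ennreal (Jk * J6)" for a t
  proof -
    have "(\<integral>\<^sup>+x. dispersed k a t x \<partial>lborel)
        = (\<integral>\<^sup>+p. (\<integral>\<^sup>+(x::vec3). ennreal (jb (x - t *\<^sub>R relvel a p) powr - k * jb p powr - 6) \<partial>lborel) \<partial>lborel)"
      unfolding dispersed_def by (rule lborel_pair.Fubini') measurable
    also have "\<dots> = (\<integral>\<^sup>+p. ennreal Jk * ennreal (jb p powr - 6) \<partial>(lborel :: vec3 measure))"
    proof (intro nn_integral_cong)
      fix p :: vec3
      have "(\<integral>\<^sup>+x. ennreal (jb (x - t *\<^sub>R relvel a p) powr - k) \<partial>lborel) = ennreal Jk"
        unfolding Jk(2)[symmetric]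
        using nn_integral_lborel_reflect[of "\<lambda>z. ennreal (jb z powr - k)" "t *\<^sub>R relvel a p"]
        by (simp add: jb_def norm_minus_commute)
      then show "(\<integral>\<^sup>+x. ennreal (jb (x - t *\<^sub>R relvel a p) powr - k * jb p powr - 6) \<partial>lborel) = ennreal Jk * ennreal (jb p powr - 6)"
        by (simp add: ennreal_mult nn_integral_multc)
    qed
    also have "\<dots> = ennreal (Jk * J6)"
      using Jk J6 by (simp add: nn_integral_cmult ennreal_mult)
    finally show ?thesis by simp
  qed
  then show ?thesis using J6 Jk by (intro exI[of _ "Jk * J6"]) auto
qed

section \<open>Convolution with the force kernel\<close>

lemma has_weak_gradient_measurable:
  assumes "has_weak_gradient UNIV u (g :: 'a::euclidean_space \<Rightarrow> 'a)"
  shows "g \<in> borel_measurable lebesgue"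
proof (rule borel_measurable_LIMSEQ_metric)
  fix n :: nat
  show "(\<lambda>x. indicator (cball 0 (real n)) x *\<^sub>R g x) \<in> borel_measurable lebesgue"
  proof (rule borel_measurable_integrable)
    show "integrable lebesgue (\<lambda>x. indicator (cball 0 (real n)) x *\<^sub>R g x)"
      using assms unfolding has_weak_gradient_def set_integrable_def by auto
  qed
next
  fix x :: 'a
  obtain N :: nat where "norm x < real N" using reals_Archimedean2 by blast
  then have "\<forall>\<^sub>F n in sequentially. indicator (cball 0 (real n)) x *\<^sub>R g x = g x"
    by (intro eventually_sequentiallyI[of N]) (auto simp: indicator_def)
  then show "(\<lambda>n. indicator (cball 0 (real n)) x *\<^sub>R g x) \<longlonglongrightarrow> g x"
    by (rule tendsto_eventually)
qed

lemma norm_borel_version: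
  assumes "(g :: 'a::euclidean_space \<Rightarrow> 'b::euclidean_space) \<in> borel_measurable lebesgue"
  shows "\<exists>G\<in>borel_measurable borel. AE x in lborel. ennreal (norm (g x)) = G x"
  using completion_ex_borel_measurable[of "\<lambda>x. ennreal (norm (g x))" lborel] assms by auto

text \<open>The kernel is merely integrable near 0 and decays like |x| powr - (\<alpha> + 1). Splitting at the radius
R (1 + t), the inner part pairs the supremum of H with the mass of the kernel, which grows like
(1 + t) powr (2 - \<alpha>) since \<alpha> < 2; the outer part pairs the mass of H with the supremum of the kernel.
The two contributions have the same size.\<close>

lemma force_kernel_convolution:
  assumes \<alpha>: "1 < \<alpha>" "\<alpha> < 2" and w: "admissible_potential \<alpha> w dw"
  shows "\<exists>C\<ge>0. \<forall>t x S h H. 0 \<le> t \<longrightarrow> 0 \<le> S \<longrightarrow> H \<in> borel_measurable borel \<longrightarrow>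
    (\<forall>y. ennreal \<bar>h y\<bar> \<le> H y) \<longrightarrow> (\<forall>y. H y \<le> ennreal (S * (1 + t) powr - 3)) \<longrightarrow>
    (\<integral>\<^sup>+y. H y \<partial>lborel) \<le> ennreal S \<longrightarrow>
    norm (LINT y|lebesgue. h y *\<^sub>R dw (x - y)) \<le> C * S * (1 + t) powr - (\<alpha> + 1)"
proof -
  obtain C R where C: "0 < C" and R: "0 < R"
    and dec: "AE x in lebesgue. R \<le> norm x \<longrightarrow> norm (dw x) \<le> C * norm x powr - (\<alpha> + 1)"
    and wg: "has_weak_gradient UNIV w dw"
    using w unfolding admissible_potential_def by auto
  obtain D where [measurable]: "D \<in> borel_measurable borel" and D: "AE x in lborel. ennreal (norm (dw x)) = D x"
    using norm_borel_version[OF has_weak_gradient_measurable[OF wg]] by blast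
  have decD: "AE x in lborel. R \<le> norm x \<longrightarrow> D x \<le> ennreal (C * norm x powr - (\<alpha> + 1))"
    using dec[unfolded AE_completion_iff] D by eventually_elim (metis ennreal_leI)
  have fin: "(\<integral>\<^sup>+x. D x * indicator (cball 0 R) x \<partial>lborel) < \<infinity>"
  proof -
    have "set_integrable lebesgue (cball 0 R) dw"
      using wg unfolding has_weak_gradient_def by auto
    then have "(\<integral>\<^sup>+x. norm (indicator (cball 0 R) x *\<^sub>R dw x) \<partial>lebesgue) < \<infinity>"
      unfolding set_integrable_def integrable_iff_bounded by auto
    also have "(\<integral>\<^sup>+x. norm (indicator (cball 0 R) x *\<^sub>R dw x) \<partial>lebesgue)
       = (\<integral>\<^sup>+x. norm (indicator (cball 0 R) x *\<^sub>R dw x) \<partial>lborel)" by (rule nn_integral_completion)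
    also have "\<dots> = (\<integral>\<^sup>+x. D x * indicator (cball 0 R) x \<partial>lborel)"
      using D by (intro nn_integral_cong_AE, eventually_elim) (auto simp: indicator_def)
    finally show ?thesis .
  qed
  obtain A where A: "0 \<le> A"
    and near: "\<And>r. R \<le> r \<Longrightarrow> (\<integral>\<^sup>+x. D x * indicator (cball 0 r) x \<partial>lborel) \<le> ennreal (A * r powr (3 - (\<alpha> + 1)))"
    using nn_integral_cball_growth[OF _ decD R _ _ _ fin] C \<alpha> by force
  define K where "K = A * R powr (2 - \<alpha>) + C * R powr - (\<alpha> + 1)"
  have "norm (LINT y|lebesgue. h y *\<^sub>R dw (x - y)) \<le> K * S * (1 + t) powr - (\<alpha> + 1)"
    if t: "0 \<le> t" and S: "0 \<le> S" and [measurable]: "H \<in> borel_measurable borel"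
      and h: "\<And>y. ennreal \<bar>h y\<bar> \<le> H y" and sup: "\<And>y. H y \<le> ennreal (S * (1 + t) powr - 3)"
      and int: "(\<integral>\<^sup>+y. H y \<partial>lborel) \<le> ennreal S" for t x S h H
  proof -
    define r where "r = R * (1 + t)"
    have r: "R \<le> r" "0 < r" using R t by (auto simp: r_def mult_le_cancel_left1)
    have "ennreal (norm (LINT y|lebesgue. h y *\<^sub>R dw (x - y))) \<le> (\<integral>\<^sup>+y. norm (h y *\<^sub>R dw (x - y)) \<partial>lebesgue)"
      using integral_norm_bound_ennreal not_integrable_integral_eq
      by (cases "integrable lebesgue (\<lambda>y. h y *\<^sub>R dw (x - y))") fastforce+
    also have "\<dots> = (\<integral>\<^sup>+y. norm (h y *\<^sub>R dw (x - y)) \<partial>lborel)" by (rule nn_integral_completion)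
    also have "\<dots> \<le> (\<integral>\<^sup>+y. ennreal (S * (1 + t) powr - 3) * (D (x - y) * indicator (cball 0 r) (x - y))
        + ennreal (C * r powr - (\<alpha> + 1)) * H y \<partial>lborel)"
    proof (intro nn_integral_mono_AE)
      show "AE y in lborel. ennreal (norm (h y *\<^sub>R dw (x - y)))
        \<le> ennreal (S * (1 + t) powr - 3) * (D (x - y) * indicator (cball 0 r) (x - y)) + ennreal (C * r powr - (\<alpha> + 1)) * H y"
        using AE_lborel_reflect[OF D, of x] AE_lborel_reflect[OF decD, of x]
      proof eventually_elim
        case (elim y)
        have "ennreal (norm (h y *\<^sub>R dw (x - y))) = ennreal \<bar>h y\<bar> * D (x - y)"
          using elim(1) by (simp add: ennreal_mult)
        also have "\<dots> \<le> H y * D (x - y)" by (intro mult_right_mono h) simp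
        also have "\<dots> \<le> ennreal (S * (1 + t) powr - 3) * (D (x - y) * indicator (cball 0 r) (x - y)) + ennreal (C * r powr - (\<alpha> + 1)) * H y"
        proof (cases "norm (x - y) \<le> r")
          case True
          have "H y * D (x - y) \<le> ennreal (S * (1 + t) powr - 3) * D (x - y)" by (intro mult_right_mono sup) simp
          then show ?thesis using True by (simp add: add_increasing2)
        next
          case False
          have "D (x - y) \<le> ennreal (C * norm (x - y) powr - (\<alpha> + 1))" using elim(2) False r by simp
          also have "\<dots> \<le> ennreal (C * r powr - (\<alpha> + 1))"
            using False r C \<alpha> by (intro ennreal_leI mult_left_mono powr_mono2') auto
          finally have "D (x - y) * H y \<le> ennreal (C * r powr - (\<alpha> + 1)) * H y" by (rule mult_right_mono) simp
          then show ?thesis using False by (simp add: mult.commute)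
        qed
        finally show ?case .
      qed
    qed
    also have "\<dots> = ennreal (S * (1 + t) powr - 3) * (\<integral>\<^sup>+y. D (x - y) * indicator (cball 0 r) (x - y) \<partial>lborel)
        + ennreal (C * r powr - (\<alpha> + 1)) * (\<integral>\<^sup>+y. H y \<partial>lborel)"
      by (subst nn_integral_add, measurable) (simp add: nn_integral_cmult)
    also have "(\<integral>\<^sup>+y. D (x - y) * indicator (cball 0 r) (x - y) \<partial>lborel) = (\<integral>\<^sup>+z. D z * indicator (cball 0 r) z \<partial>lborel)"
      by (rule nn_integral_lborel_reflect[where H = "\<lambda>z. D z * indicator (cball 0 r) z"]) measurable
    also have "ennreal (S * (1 + t) powr - 3) * (\<integral>\<^sup>+z. D z * indicator (cball 0 r) z \<partial>lborel)
        + ennreal (C * r powr - (\<alpha> + 1)) * (\<integral>\<^sup>+y. H y \<partial>lborel)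
      \<le> ennreal (S * (1 + t) powr - 3) * ennreal (A * r powr (3 - (\<alpha> + 1))) + ennreal (C * r powr - (\<alpha> + 1)) * ennreal S"
      by (intro add_mono mult_left_mono near r int) auto
    also have "\<dots> = ennreal (S * (1 + t) powr - 3 * (A * r powr (3 - (\<alpha> + 1))) + C * r powr - (\<alpha> + 1) * S)"
      using S A C by (simp add: ennreal_mult[symmetric])
    also have "S * (1 + t) powr - 3 * (A * r powr (3 - (\<alpha> + 1))) + C * r powr - (\<alpha> + 1) * S
        = K * S * (1 + t) powr - (\<alpha> + 1)"
    proof -
      have "r powr m = R powr m * (1 + t) powr m" for m
        using R t by (simp add: r_def powr_mult)
      moreover have "(1 + t) powr - 3 * (1 + t) powr (3 - (\<alpha> + 1)) = (1 + t) powr - (\<alpha> + 1)"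
        by (simp add: powr_add[symmetric] algebra_simps)
      ultimately show ?thesis by (simp add: K_def algebra_simps)
    qed
    finally show ?thesis
      using S A C by (subst (asm) ennreal_le_iff) (auto simp: K_def)
  qed
  moreover have "0 \<le> K" using A C by (simp add: K_def)
  ultimately show ?thesis by blast
qed

section \<open>Comparison of densities\<close>

lemma one_minus_lorentz_power: 
  assumes a: "0 \<le> a"
  shows "0 \<le> 1 - inverse (lorentz a p) ^ 5" "1 - inverse (lorentz a p) ^ 5 \<le> 5 * (a * (norm p)\<^sup>2)"
proof -
  define x where "x = inverse (lorentz a p)"
  have x: "0 \<le> x" "x \<le> 1" "1 - x \<le> a * (norm p)\<^sup>2"
    using inverse_lorentz_le_1[OF a, of p] lorentz_pos[OF a, of p] one_minus_inverse_lorentz[OF a, of p]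
    by (auto simp: x_def)
  show "0 \<le> 1 - x ^ 5" using x by (simp add: power_le_one)
  have "1 + real 5 * (x - 1) \<le> (1 + (x - 1)) ^ 5" using x by (intro Bernoulli_inequality) simp
  then show "1 - x ^ 5 \<le> 5 * (a * (norm p)\<^sup>2)" using x(3) by simp
qed

lemma jb_powr_half:
  assumes "1 / 2 \<le> l" "0 \<le> m"
  shows "jb (l *\<^sub>R p) powr - m \<le> 2 powr m * jb p powr - m"
proof -
  have "jb (l *\<^sub>R p) powr - m \<le> (jb p / 2) powr - m"
    using jb_half[OF assms(1), of p] assms(2) by (intro powr_mono2') auto
  also have "\<dots> = 2 powr m * jb p powr - m"
    by (simp add: powr_divide less_imp_le powr_minus field_simps)
  finally show ?thesis .
qed

lemma jb_powr_shift:
  assumes "norm (x - y) \<le> 1" "0 \<le> m"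
  shows "jb x powr - m \<le> 2 powr m * jb y powr - m"
proof -
  have "jb x powr - m \<le> (jb y / 2) powr - m"
    using jb_shift[OF assms(1)] assms(2) by (intro powr_mono2') auto
  also have "\<dots> = 2 powr m * jb y powr - m"
    by (simp add: powr_divide less_imp_le powr_minus field_simps)
  finally show ?thesis .
qed

lemma jb_powr_absorb:
  "jb p powr - 8 * (norm p)\<^sup>2 \<le> jb p powr - 6"
  "jb p powr - 9 * norm p ^ 3 \<le> jb p powr - 6"
  "jb p powr - 9 * jb p ^ 3 = jb p powr - 6"
proof -
  have j: "0 < jb p" by simp
  have "jb p powr - 8 * (norm p)\<^sup>2 \<le> jb p powr - 8 * (jb p)\<^sup>2"
    by (intro mult_left_mono power_mono norm_le_jb) auto
  also have "\<dots> = jb p powr - 8 * jb p powr 2" using powr_realpow[OF j, of 2] by simp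
  also have "\<dots> = jb p powr - 6" unfolding powr_add[symmetric] by simp
  finally show "jb p powr - 8 * (norm p)\<^sup>2 \<le> jb p powr - 6" .
  have "jb p powr - 9 * jb p ^ 3 = jb p powr - 9 * jb p powr 3" using powr_realpow[OF j, of 3] by simp
  also have "\<dots> = jb p powr - 6" unfolding powr_add[symmetric] by simp
  finally show eq: "jb p powr - 9 * jb p ^ 3 = jb p powr - 6" .
  show "jb p powr - 9 * norm p ^ 3 \<le> jb p powr - 6"
    unfolding eq[symmetric] by (intro mult_left_mono power_mono norm_le_jb) auto
qed

lemma jb_powr_tail:
  assumes "1 \<le> m * (norm p)\<^sup>2"
  shows "jb p powr - 8 \<le> m * jb p powr - 6"
proof -
  have m: "0 \<le> m"
    using assms by (smt (verit) mult_nonneg_nonneg mult_nonpos_nonneg zero_le_power2)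
  have "jb p powr - 8 * 1 \<le> jb p powr - 8 * (m * (norm p)\<^sup>2)"
    using assms by (intro mult_left_mono) auto
  also have "\<dots> = m * (jb p powr - 8 * (norm p)\<^sup>2)" by (simp only: mult_ac)
  also have "\<dots> \<le> m * jb p powr - 6" using m by (intro mult_left_mono jb_powr_absorb)
  finally show ?thesis by simp
qed

text \<open>The facts about two densities at time t that decide how far their forces are apart. Both are
read in profile coordinates, F with the velocity for a and F' with the Newtonian one. The last condition
controls F' between p and a shorter vector on the same ray: the velocity v(p) is such a vector
with l \<ge> 1 / 2 as long as a |p|^2 \<le> 1.\<close>

definition comparable_profiles ::
  "real \<Rightarrow> real \<Rightarrow> real \<Rightarrow> real \<Rightarrow> real \<Rightarrow> (vec3 \<Rightarrow> vec3 \<Rightarrow> real) \<Rightarrow> (vec3 \<Rightarrow> vec3 \<Rightarrow> real) \<Rightarrow> bool"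
  where "comparable_profiles k a t N \<kappa> F F' \<longleftrightarrow>
    (\<forall>y p. \<bar>F (y + t *\<^sub>R relvel a p) p\<bar> \<le> N * jb y powr - k * jb p powr - 8) \<and>
    (\<forall>y p. \<bar>F' (y + t *\<^sub>R p) p\<bar> \<le> N * jb y powr - k * jb p powr - 8) \<and>
    (\<forall>y p. \<bar>F (y + t *\<^sub>R relvel a p) p - F' (y + t *\<^sub>R p) p\<bar> \<le> N * \<kappa> * jb y powr - k * jb p powr - 6) \<and>
    (\<forall>y p l. 1 / 2 \<le> l \<longrightarrow> l \<le> 1 \<longrightarrow>
      \<bar>F' (y + t *\<^sub>R p) p - F' (y + t *\<^sub>R l *\<^sub>R p) (l *\<^sub>R p)\<bar>
        \<le> N * jb y powr - k * jb p powr - 9 * norm (p - l *\<^sub>R p))"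

text \<open>On the set a |p|^2 \<le> 1, which the velocity maps onto a |q|^2 \<le> 1 / 2, three differences add up: that of the
profiles, the change of momentum from p to v(p), and that of the Jacobian from 1. Outside this set
the factor a is obtained from two of the powers of p in the decay of the profile itself.\<close>

lemma density_integrand_bound:
  assumes a: "0 \<le> a" and N: "0 \<le> N" and \<kappa>: "0 \<le> \<kappa>"
    and cp: "comparable_profiles k a t N \<kappa> F F'"
  defines "G1 \<equiv> \<lambda>y p. F (y + t *\<^sub>R relvel a p) p" and "G2 \<equiv> \<lambda>y p. F' (y + t *\<^sub>R p) p"
  shows "\<bar>G1 y p - inverse (lorentz a p) ^ 5 *
      (indicator {q. a * (norm q)\<^sup>2 \<le> 1 / 2} (relvel a p) * G2 y (relvel a p))\<bar>
    \<le> 1300 * N * (\<kappa> + a) * (jb y powr - k * jb p powr - 6)"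
proof -
  have G1: "\<bar>G1 y p\<bar> \<le> N * jb y powr - k * jb p powr - 8"
    and G2: "\<bar>G2 y p\<bar> \<le> N * jb y powr - k * jb p powr - 8"
    and close: "\<bar>G1 y p - G2 y p\<bar> \<le> N * \<kappa> * jb y powr - k * jb p powr - 6"
    and lip: "1 / 2 \<le> l \<Longrightarrow> l \<le> 1 \<Longrightarrow>
      \<bar>G2 y p - G2 y (l *\<^sub>R p)\<bar> \<le> N * jb y powr - k * jb p powr - 9 * norm (p - l *\<^sub>R p)" for y p l
    using cp unfolding comparable_profiles_def G1_def G2_def by blast+
  let ?J = "jb y powr - k"
  define W where "W = N * (?J * jb p powr - 6)"
  have W: "0 \<le> W" using N by (simp add: W_def)
  have g: "1 \<le> lorentz a p" by (rule lorentz_ge_1[OF a])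
  have "\<bar>G1 y p - inverse (lorentz a p) ^ 5 *
      (indicator {q. a * (norm q)\<^sup>2 \<le> 1 / 2} (relvel a p) * G2 y (relvel a p))\<bar>
    \<le> (\<kappa> + 1281 * a) * W"
  proof (cases "a * (norm p)\<^sup>2 \<le> 1")
    case True
    define l where "l = inverse (lorentz a p)"
    have "(lorentz a p)\<^sup>2 \<le> 2" using True by (simp add: lorentz_sq[OF a])
    then have "lorentz a p \<le> 2" using g by (smt (verit) power2_eq_square mult_le_cancel_left1)
    then have l: "1 / 2 \<le> l" "l \<le> 1" using g by (auto simp: l_def field_simps)
    have v: "relvel a p = l *\<^sub>R p" by (simp add: relvel_lorentz l_def)
    have "1 / 2 \<le> inverse ((lorentz a p)\<^sup>2)" using \<open>(lorentz a p)\<^sup>2 \<le> 2\<close> g by (simp add: field_simps)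
    then have "relvel a p \<in> {q. a * (norm q)\<^sup>2 \<le> 1 / 2}" by (simp add: norm_relvel_sq[OF a])
    then have "\<bar>G1 y p - inverse (lorentz a p) ^ 5 *
      (indicator {q. a * (norm q)\<^sup>2 \<le> 1 / 2} (relvel a p) * G2 y (relvel a p))\<bar>
      = \<bar>(G1 y p - G2 y p) + (G2 y p - G2 y (l *\<^sub>R p)) + (1 - l ^ 5) * G2 y (l *\<^sub>R p)\<bar>"
      by (simp add: v l_def[symmetric] algebra_simps)
    also have "\<dots> \<le> \<bar>G1 y p - G2 y p\<bar> + \<bar>G2 y p - G2 y (l *\<^sub>R p)\<bar> + (1 - l ^ 5) * \<bar>G2 y (l *\<^sub>R p)\<bar>"
      using one_minus_lorentz_power(1)[OF a, of p] unfolding l_def[symmetric]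
      by (intro order_trans[OF abs_triangle_ineq] add_mono abs_triangle_ineq) (simp add: abs_mult)
    also have "\<bar>G1 y p - G2 y p\<bar> \<le> \<kappa> * W" using close[of y p] by (simp add: W_def mult_ac)
    also have "\<bar>G2 y p - G2 y (l *\<^sub>R p)\<bar> \<le> a * W"
    proof -
      have "norm (p - l *\<^sub>R p) \<le> a * norm p ^ 3"
        using norm_relvel_minus[OF a, of p] by (simp add: v norm_minus_commute)
      then have "\<bar>G2 y p - G2 y (l *\<^sub>R p)\<bar> \<le> N * ?J * jb p powr - 9 * (a * norm p ^ 3)"
        using N by (intro order_trans[OF lip[OF l]] mult_left_mono) auto
      also have "\<dots> = (a * N * ?J) * (jb p powr - 9 * norm p ^ 3)" by (simp only: mult_ac)
      also have "\<dots> \<le> (a * N * ?J) * jb p powr - 6"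
        using a N by (intro mult_left_mono jb_powr_absorb) auto
      finally show ?thesis by (simp add: W_def mult_ac)
    qed
    also have "(1 - l ^ 5) * \<bar>G2 y (l *\<^sub>R p)\<bar> \<le> 1280 * a * W"
    proof -
      have p8: "(2::real) powr 8 = 256" by simp
      have "(1 - l ^ 5) * \<bar>G2 y (l *\<^sub>R p)\<bar> \<le> (5 * (a * (norm p)\<^sup>2)) * (N * ?J * jb (l *\<^sub>R p) powr - 8)"
        using one_minus_lorentz_power[OF a, of p] a unfolding l_def[symmetric] by (intro mult_mono G2) auto
      also have "\<dots> \<le> (5 * (a * (norm p)\<^sup>2)) * (N * ?J * (2 powr 8 * jb p powr - 8))"
        using a N l by (intro mult_left_mono jb_powr_half) auto
      also have "\<dots> = (1280 * a * N * ?J) * (jb p powr - 8 * (norm p)\<^sup>2)" unfolding p8 by simp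
      also have "\<dots> \<le> (1280 * a * N * ?J) * jb p powr - 6"
        using a N by (intro mult_left_mono jb_powr_absorb) auto
      finally show ?thesis by (simp add: W_def mult_ac)
    qed
    finally show ?thesis by (simp add: algebra_simps)
  next
    case False
    have "(lorentz a p)\<^sup>2 > 2" using False by (simp add: lorentz_sq[OF a])
    then have "inverse ((lorentz a p)\<^sup>2) < 1 / 2" using g by (simp add: field_simps)
    then have "relvel a p \<notin> {q. a * (norm q)\<^sup>2 \<le> 1 / 2}" by (simp add: norm_relvel_sq[OF a])
    then have "\<bar>G1 y p - inverse (lorentz a p) ^ 5 *
      (indicator {q. a * (norm q)\<^sup>2 \<le> 1 / 2} (relvel a p) * G2 y (relvel a p))\<bar> = \<bar>G1 y p\<bar>" by simp
    also have "\<dots> \<le> N * ?J * jb p powr - 8" by (rule G1)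
    also have "\<dots> \<le> N * ?J * (a * jb p powr - 6)"
      using False N by (intro mult_left_mono jb_powr_tail) auto
    also have "\<dots> = a * W" by (simp add: W_def mult_ac)
    also have "\<dots> \<le> (\<kappa> + 1281 * a) * W" using a \<kappa> W by (intro mult_right_mono) auto
    finally show ?thesis .
  qed
  also have "\<dots> \<le> (1300 * (\<kappa> + a)) * W" using a \<kappa> W by (intro mult_right_mono) auto
  finally show ?thesis by (simp add: W_def mult_ac)
qed

text \<open>In the second density the momenta with a |q|^2 \<le> 1 / 2 are replaced by velocities q = v(p). The remaining
large momenta contribute a term of order a by the decay of the profile.\<close>

lemma density_difference:
  fixes F1 F2 :: "vec3 \<Rightarrow> vec3 \<Rightarrow> real"
  assumes a: "0 \<le> a" and N: "0 \<le> N" and \<kappa>: "0 \<le> \<kappa>"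
    and c1: "continuous_on UNIV (F1 x)" and c2: "continuous_on UNIV (F2 x)"
    and i1: "integrable lebesgue (F1 x)" and i2: "integrable lebesgue (F2 x)"
    and cp: "comparable_profiles k a t N \<kappa> F1 F2"
  shows "ennreal \<bar>(LINT p|lebesgue. F1 x p) - (LINT p|lebesgue. F2 x p)\<bar>
    \<le> ennreal (1300 * N * (\<kappa> + a)) * (dispersed k a t x + dispersed k 0 t x)"
proof -
  define K where "K = 1300 * N * (\<kappa> + a)"
  have K: "0 \<le> K" using a N \<kappa> by (simp add: K_def)
  have [measurable]: "F1 x \<in> borel_measurable borel" "F2 x \<in> borel_measurable borel"
    using c1 c2 by (auto intro: borel_measurable_continuous_onI)
  have j1: "integrable lborel (F1 x)" using i1 by (simp add: integrable_completion)
  have j2: "integrable lborel (F2 x)" using i2 by (simp add: integrable_completion)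
  let ?B = "{q::vec3. a * (norm q)\<^sup>2 \<le> 1 / 2}"
  let ?U = "{q::vec3. a * (norm q)\<^sup>2 < 1}"
  let ?T = "\<lambda>p. inverse (lorentz a p) ^ 5 * (indicator ?B (relvel a p) * F2 x (relvel a p))"
  have BU: "indicator ?U q * (indicator ?B q * F2 x q) = indicator ?B q * F2 x q" for q
    by (auto simp: indicator_def)
  have jB: "integrable lborel (\<lambda>q. indicator ?B q * F2 x q)"
    using integrable_mult_indicator[OF _ j2, of ?B] by simp
  have jC: "integrable lborel (\<lambda>q. indicator (- ?B) q * F2 x q)"
    using integrable_mult_indicator[OF _ j2, of "- ?B"] by simp
  have cv: "(\<integral>p. ?T p \<partial>lborel) = (\<integral>q. indicator ?B q * F2 x q \<partial>lborel)" "integrable lborel ?T"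
    using integral_relvel[OF a, of "\<lambda>q. indicator ?B q * F2 x q"] jB unfolding BU by auto
  have "(\<integral>q. F2 x q \<partial>lborel) = (\<integral>q. indicator ?B q * F2 x q + indicator (- ?B) q * F2 x q \<partial>lborel)"
    by (intro Bochner_Integration.integral_cong) (auto simp: indicator_def)
  also have "\<dots> = (\<integral>p. ?T p \<partial>lborel) + (\<integral>q. indicator (- ?B) q * F2 x q \<partial>lborel)"
    unfolding cv(1) by (rule Bochner_Integration.integral_add[OF jB jC])
  finally have I2: "(\<integral>q. F2 x q \<partial>lborel) = (\<integral>p. ?T p \<partial>lborel) + (\<integral>q. indicator (- ?B) q * F2 x q \<partial>lborel)" .
  have "(LINT p|lebesgue. F1 x p) - (LINT p|lebesgue. F2 x p)
      = (\<integral>p. F1 x p - ?T p \<partial>lborel) - (\<integral>q. indicator (- ?B) q * F2 x q \<partial>lborel)"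
    unfolding Bochner_Integration.integral_diff[OF j1 cv(2)] by (simp add: integral_completion I2)
  then have "ennreal \<bar>(LINT p|lebesgue. F1 x p) - (LINT p|lebesgue. F2 x p)\<bar>
      \<le> ennreal \<bar>\<integral>p. F1 x p - ?T p \<partial>lborel\<bar> + ennreal \<bar>\<integral>q. indicator (- ?B) q * F2 x q \<partial>lborel\<bar>"
    by (simp add: ennreal_plus[symmetric] ennreal_leI del: ennreal_plus)
  also have "\<dots> \<le> (\<integral>\<^sup>+p. ennreal \<bar>F1 x p - ?T p\<bar> \<partial>lborel) + (\<integral>\<^sup>+q. ennreal \<bar>indicator (- ?B) q * F2 x q\<bar> \<partial>lborel)"
    using integral_norm_bound_ennreal[OF Bochner_Integration.integrable_diff[OF j1 cv(2)]]
      integral_norm_bound_ennreal[OF jC] by (intro add_mono) auto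
  also have "(\<integral>\<^sup>+p. ennreal \<bar>F1 x p - ?T p\<bar> \<partial>lborel) \<le> (\<integral>\<^sup>+p. ennreal K * ennreal (jb (x - t *\<^sub>R relvel a p) powr - k * jb p powr - 6) \<partial>lborel)"
  proof (intro nn_integral_mono)
    fix p
    have "\<bar>F1 x p - ?T p\<bar> \<le> K * (jb (x - t *\<^sub>R relvel a p) powr - k * jb p powr - 6)"
      using density_integrand_bound[OF a N \<kappa> cp, of "x - t *\<^sub>R relvel a p" p] by (simp add: K_def)
    then show "ennreal \<bar>F1 x p - ?T p\<bar> \<le> ennreal K * ennreal (jb (x - t *\<^sub>R relvel a p) powr - k * jb p powr - 6)"
      using K by (simp add: ennreal_mult[symmetric] ennreal_leI)
  qed
  also have "\<dots> = ennreal K * dispersed k a t x"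
    unfolding dispersed_def by (rule nn_integral_cmult) measurable
  also have "(\<integral>\<^sup>+q. ennreal \<bar>indicator (- ?B) q * F2 x q\<bar> \<partial>lborel)
      \<le> (\<integral>\<^sup>+q. ennreal K * ennreal (jb (x - t *\<^sub>R relvel 0 q) powr - k * jb q powr - 6) \<partial>lborel)"
  proof (intro nn_integral_mono)
    fix q
    have "\<bar>indicator (- ?B) q * F2 x q\<bar> \<le> K * (jb (x - t *\<^sub>R q) powr - k * jb q powr - 6)"
    proof (cases "q \<in> ?B")
      case False
      have "\<bar>F2 x q\<bar> \<le> N * jb (x - t *\<^sub>R q) powr - k * jb q powr - 8" using cp unfolding comparable_profiles_def by (metis diff_add_cancel)
      also have "\<dots> \<le> N * jb (x - t *\<^sub>R q) powr - k * ((2 * a) * jb q powr - 6)"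
        using False N by (intro mult_left_mono jb_powr_tail) auto
      also have "\<dots> = (2 * N * a) * (jb (x - t *\<^sub>R q) powr - k * jb q powr - 6)" by (simp only: mult_ac)
      also have "\<dots> \<le> K * (jb (x - t *\<^sub>R q) powr - k * jb q powr - 6)"
        using N a \<kappa> by (intro mult_right_mono) (auto simp: K_def algebra_simps)
      finally show ?thesis using False by simp
    qed (use K in simp)
    then show "ennreal \<bar>indicator (- ?B) q * F2 x q\<bar> \<le> ennreal K * ennreal (jb (x - t *\<^sub>R relvel 0 q) powr - k * jb q powr - 6)"
      using K by (simp add: ennreal_mult[symmetric] ennreal_leI)
  qed
  also have "\<dots> = ennreal K * dispersed k 0 t x"
    unfolding dispersed_def by (rule nn_integral_cmult) measurable
  finally show ?thesis by (simp add: K_def distrib_left add_mono)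
qed

section \<open>Profile maps\<close>

text \<open>Z takes the profile at time t to the initial state of the flow line through it.\<close>

definition profile_map :: "real \<Rightarrow> (real \<Rightarrow> vec3 \<Rightarrow> vec3) \<Rightarrow> real \<Rightarrow> (phase \<Rightarrow> phase) \<Rightarrow> bool"
  where "profile_map a E t Z \<longleftrightarrow>
    (\<forall>z. \<exists>X P. flow_line a E X P \<and> profile a X P t = z \<and> profile a X P 0 = Z z)"

lemma profile_map_near:
  assumes "decaying_field \<alpha> b E" "profile_map a E t Z" "0 \<le> a" "1 < \<alpha>" "0 \<le> t" "b / (\<alpha> - 1) \<le> 1 / 96"
  shows "norm (Z z - z) \<le> 1 / 32"
proof -
  obtain X P where "flow_line a E X P" "profile a X P t = z" "profile a X P 0 = Z z"
    using assms(2) unfolding profile_map_def by blast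
  then have "norm (Z z - z) \<le> 3 * b / (\<alpha> - 1)"
    using profile_drift[OF assms(1), of a X P 0 t] assms by auto
  then show ?thesis using assms(6) unfolding times_divide_eq_right[symmetric] by linarith
qed

lemma profile_map_lipschitz:
  assumes E: "decaying_field \<alpha> b E" and Z: "profile_map a E t Z" and a: "0 \<le> a" "a \<le> 1" and \<alpha>: "1 < \<alpha>" and t: "0 \<le> t" and b: "b / (\<alpha> - 1) \<le> 1 / 96"
  shows "norm ((Z z - Z z') - (z - z')) \<le> 1 / 4 * norm (z - z')"
proof -
  obtain X P where 1: "flow_line a E X P" "profile a X P t = z" "profile a X P 0 = Z z"
    using Z unfolding profile_map_def by blast
  obtain X' P' where 2: "flow_line a E X' P'" "profile a X' P' t = z'" "profile a X' P' 0 = Z z'"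
    using Z unfolding profile_map_def by blast
  have "norm ((Z z - Z z') - (z - z')) \<le> 24 * b / (\<alpha> - 1) * norm (z - z')"
    using profile_lipschitz[OF E 1(1) 2(1) a \<alpha> _ order_refl t] 1 2 b by auto
  also have "\<dots> \<le> 1 / 4 * norm (z - z')"
  proof (intro mult_right_mono)
    have "24 * b / (\<alpha> - 1) = 24 * (b / (\<alpha> - 1))" by simp
    then show "24 * b / (\<alpha> - 1) \<le> 1 / 4" using b by linarith
  qed simp
  finally show ?thesis .
qed

lemma profile_map_close:
  assumes E1: "decaying_field \<alpha> b E1" and E2: "decaying_field \<alpha> b E2"
    and close: "\<And>s x. 0 \<le> s \<Longrightarrow> norm (E1 s x - E2 s x) \<le> d * (1 + s) powr - (\<alpha> + 1)"
    and Z1: "profile_map a E1 t Z1" and Z2: "profile_map 0 E2 t Z2"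
    and a: "0 \<le> a" and \<alpha>: "1 < \<alpha>" and t: "0 \<le> t" and b: "b / (\<alpha> - 1) \<le> 1 / 96" and d: "0 \<le> d"
  shows "norm (Z1 z - Z2 z) \<le> 48 / (\<alpha> - 1) * (b * a + d) * jb (snd z) ^ 3"
proof -
  obtain X P where 1: "flow_line a E1 X P" "profile a X P t = z" "profile a X P 0 = Z1 z"
    using Z1 unfolding profile_map_def by blast
  obtain X' P' where 2: "flow_line 0 E2 X' P'" "profile 0 X' P' t = z" "profile 0 X' P' 0 = Z2 z"
    using Z2 unfolding profile_map_def by blast
  show ?thesis
    using profile_speed_comparison[OF E1 E2 close 1(1) 2(1) 1(2) 2(2) a \<alpha> _ d order_refl t] b 1(3) 2(3) by simp
qed

section \<open>Initial data\<close>

lemma data_size_bounds: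
  fixes f0 :: "phase \<Rightarrow> real"
  assumes size: "data_size k f0 df0 < ennreal \<eta>" and f0: "continuous_on UNIV f0"
  shows "\<bar>f0 (x, p)\<bar> \<le> \<eta> * jb x powr - k * jb p powr - 8"
    and "AE z in lebesgue. norm (df0 z) \<le> \<eta> * jb (fst z) powr - k * jb (snd z) powr - 9"
    and "0 < \<eta>"
proof -
  show \<eta>: "0 < \<eta>" using size by (metis ennreal_neg linorder_not_less not_less_zero)
  have 1: "Linf_norm (\<lambda>(x, p). jb x powr k * jb p ^ 8 * f0 (x, p)) \<le> ennreal \<eta>"
    and 2: "Linf_norm (\<lambda>(x, p). (jb x powr k * jb p ^ 9) *\<^sub>R df0 (x, p)) \<le> ennreal \<eta>"
    using less_imp_le[OF size] unfolding data_size_def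
    by (auto elim: order_trans[rotated] intro: add_increasing add_increasing2)
  have inv: "u \<le> \<eta> * jb x powr - k * jb p powr - real m" if "jb x powr k * jb p ^ m * u \<le> \<eta>"
    for u m and x p :: vec3
  proof -
    have j: "0 < jb p" "0 < jb x" by auto
    have "u = (jb x powr k * jb p ^ m * u) * (jb x powr - k * jb p powr - real m)"
      using j by (simp add: powr_minus powr_realpow field_simps)
    also have "\<dots> \<le> \<eta> * (jb x powr - k * jb p powr - real m)" by (intro mult_right_mono that) auto
    finally show ?thesis by (simp add: mult.assoc)
  qed
  have "AE z in lebesgue. norm (case z of (x, p) \<Rightarrow> jb x powr k * jb p ^ 8 * f0 (x, p)) \<le> \<eta>"
    using 1 \<eta> by (intro AE_norm_le_Linf_norm) auto
  then have "norm (case (x, p) of (x, p) \<Rightarrow> jb x powr k * jb p ^ 8 * f0 (x, p)) \<le> \<eta>"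
  proof (rule AE_le_continuous_imp_le)
    show "continuous_on UNIV (\<lambda>z. norm (case z of (x, p) \<Rightarrow> jb x powr k * jb p ^ 8 * f0 (x, p)))"
      unfolding split_beta
      by (intro continuous_intros continuous_on_compose2[OF f0]) (auto intro: less_imp_neq[symmetric])
  qed simp
  then have "jb x powr k * jb p ^ 8 * \<bar>f0 (x, p)\<bar> \<le> \<eta>" by (simp add: abs_mult)
  from inv[OF this] show "\<bar>f0 (x, p)\<bar> \<le> \<eta> * jb x powr - k * jb p powr - 8" by simp
  have "AE z in lebesgue. norm (case z of (x, p) \<Rightarrow> (jb x powr k * jb p ^ 9) *\<^sub>R df0 (x, p)) \<le> \<eta>"
    using 2 \<eta> by (intro AE_norm_le_Linf_norm) auto
  then show "AE z in lebesgue. norm (df0 z) \<le> \<eta> * jb (fst z) powr - k * jb (snd z) powr - 9"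
  proof eventually_elim
    case (elim z)
    then have "jb (fst z) powr k * jb (snd z) ^ 9 * norm (df0 z) \<le> \<eta>" by (simp add: split_beta abs_mult power_abs)
    from inv[OF this] show ?case by simp
  qed
qed

text \<open>All points at which f0 or its gradient is evaluated are within distance 1 of some (y, m p) with
1 / 2 \<le> m \<le> 1. Moving a weight of order n by such a distance costs the factor 2 ^ n, and so does passing from m p to p. This
produces the exponents of 2.\<close>

lemma composition_bounds:
  fixes f0 :: "phase \<Rightarrow> real"
  assumes f0: "continuous_on UNIV f0" and df0: "has_weak_gradient UNIV f0 df0"
    and size: "data_size k f0 df0 < ennreal \<eta>" and k: "0 \<le> k"
    and Z1: "\<And>z. norm (Z1 z - z) \<le> 1 / 32" and Z2: "\<And>z. norm (Z2 z - z) \<le> 1 / 32"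
  shows "\<bar>f0 (Z1 (y, p))\<bar> \<le> 2 powr (k + 19) * \<eta> * jb y powr - k * jb p powr - 8"
    and "\<bar>f0 (Z1 (y, p)) - f0 (Z2 (y, p))\<bar>
      \<le> 2 powr (k + 19) * \<eta> * jb y powr - k * jb p powr - 9 * norm (Z1 (y, p) - Z2 (y, p))"
    and "1 / 2 \<le> l \<Longrightarrow> l \<le> 1 \<Longrightarrow> (\<And>z z'. norm (Z2 z - Z2 z') \<le> 2 * norm (z - z')) \<Longrightarrow>
      \<bar>f0 (Z2 (y, p)) - f0 (Z2 (y, l *\<^sub>R p))\<bar>
      \<le> 2 powr (k + 19) * \<eta> * jb y powr - k * jb p powr - 9 * norm (p - l *\<^sub>R p)"
proof -
  note D = data_size_bounds[OF size f0]
  have \<eta>: "0 < \<eta>" by (rule D(3))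
  have split: "norm (fst u - y) \<le> 1 \<and> norm (snd u - q) \<le> 1" if "norm (u - (y, q)) \<le> 1" for u :: phase and q :: vec3
    using that norm_fst_le[of "fst u - y" "snd u - q"] norm_snd_le[of "snd u - q" "fst u - y"]
    by (cases u) auto
  have weight: "\<eta> * jb (fst u) powr - k * jb (snd u) powr - m
      \<le> 2 powr (k + m) * \<eta> * jb y powr - k * jb q powr - m" if "norm (u - (y, q)) \<le> 1" "0 \<le> m" for u :: phase and q :: vec3 and m
  proof -
    have "\<eta> * jb (fst u) powr - k * jb (snd u) powr - m
        \<le> \<eta> * (2 powr k * jb y powr - k) * (2 powr m * jb q powr - m)"
      using split[OF that(1)] \<eta> that k by (intro mult_mono jb_powr_shift) auto
    then show ?thesis by (simp add: powr_add mult_ac)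
  qed
  define K where "K = (\<lambda>z::phase. \<eta> * jb (fst z) powr - k * jb (snd z) powr - 9)"
  have [measurable]: "K \<in> borel_measurable borel"
    unfolding K_def
    by (intro borel_measurable_continuous_onI continuous_intros) (auto intro: less_imp_neq[symmetric])
  have AE: "AE z in lebesgue. norm (df0 z) \<le> K z" unfolding K_def by (rule D(2))
  have "\<bar>f0 (Z1 (y, p))\<bar> \<le> \<eta> * jb (fst (Z1 (y, p))) powr - k * jb (snd (Z1 (y, p))) powr - 8"
    using D(1)[of "fst (Z1 (y, p))" "snd (Z1 (y, p))"] by simp
  also have "\<dots> \<le> 2 powr (k + 8) * \<eta> * jb y powr - k * jb p powr - 8"
    using Z1[of "(y, p)"] by (intro weight) auto
  also have "\<dots> \<le> 2 powr (k + 19) * \<eta> * jb y powr - k * jb p powr - 8"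
    using \<eta> by (intro mult_right_mono powr_mono) auto
  finally show "\<bar>f0 (Z1 (y, p))\<bar> \<le> 2 powr (k + 19) * \<eta> * jb y powr - k * jb p powr - 8" .
  have segment: "\<bar>f0 u1 - f0 u2\<bar> \<le> 2 powr (k + 18) * \<eta> * jb y powr - k * jb p powr - 9 * norm (u1 - u2)"
    if l: "1 / 2 \<le> l" "l \<le> 1" and u1: "norm (u1 - (y, p)) \<le> 1 / 32" and u2: "norm (u2 - (y, l *\<^sub>R p)) \<le> 1 / 32"
    for l u1 u2
  proof (rule weak_gradient_lipschitz[OF f0 df0 _ AE, where r = "1/32"])
    fix \<theta> :: real and v :: phase assume \<theta>: "0 \<le> \<theta>" "\<theta> \<le> 1" and v: "norm v \<le> 1/32"
    let ?u = "u2 + \<theta> *\<^sub>R (u1 - u2) - v"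
    define m where "m = (1 - \<theta>) * l + \<theta>"
    have "m = l + \<theta> * (1 - l)" by (simp add: m_def algebra_simps)
    moreover have "0 \<le> \<theta> * (1 - l)" using \<theta> l by simp
    ultimately have m: "1 / 2 \<le> m" using l by linarith
    have "?u - (y, m *\<^sub>R p) = (1 - \<theta>) *\<^sub>R (u2 - (y, l *\<^sub>R p)) + \<theta> *\<^sub>R (u1 - (y, p)) - v"
      by (simp add: m_def algebra_simps)
    also have "norm \<dots> \<le> norm ((1 - \<theta>) *\<^sub>R (u2 - (y, l *\<^sub>R p))) + norm (\<theta> *\<^sub>R (u1 - (y, p))) + norm v"
      by (intro order_trans[OF norm_triangle_ineq4] add_mono norm_triangle_ineq) simp
    also have "\<dots> \<le> 1 * (1 / 32) + 1 * (1 / 32) + 1 / 32"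
      unfolding norm_scaleR using \<theta> v u1 u2 by (intro add_mono mult_mono) auto
    finally have "norm (?u - (y, m *\<^sub>R p)) \<le> 1" by simp
    then have "K ?u \<le> 2 powr (k + 9) * \<eta> * jb y powr - k * jb (m *\<^sub>R p) powr - 9"
      unfolding K_def by (rule weight) simp
    also have "\<dots> \<le> 2 powr (k + 9) * \<eta> * jb y powr - k * (2 powr 9 * jb p powr - 9)"
      using \<eta> by (intro mult_left_mono jb_powr_half m) auto
    also have "\<dots> = 2 powr (k + 18) * \<eta> * jb y powr - k * jb p powr - 9"
      by (simp add: powr_add)
    finally show "K ?u \<le> 2 powr (k + 18) * \<eta> * jb y powr - k * jb p powr - 9" .
  qed (use \<eta> in auto)
  have "\<bar>f0 (Z1 (y, p)) - f0 (Z2 (y, p))\<bar>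
      \<le> 2 powr (k + 18) * \<eta> * jb y powr - k * jb p powr - 9 * norm (Z1 (y, p) - Z2 (y, p))"
    using Z1[of "(y, p)"] Z2[of "(y, p)"] by (intro segment[of 1]) auto
  also have "\<dots> \<le> 2 powr (k + 19) * \<eta> * jb y powr - k * jb p powr - 9 * norm (Z1 (y, p) - Z2 (y, p))"
    using \<eta> by (intro mult_right_mono powr_mono) auto
  finally show "\<bar>f0 (Z1 (y, p)) - f0 (Z2 (y, p))\<bar>
      \<le> 2 powr (k + 19) * \<eta> * jb y powr - k * jb p powr - 9 * norm (Z1 (y, p) - Z2 (y, p))" .
  assume l: "1 / 2 \<le> l" "l \<le> 1" and lip: "\<And>z z'. norm (Z2 z - Z2 z') \<le> 2 * norm (z - z')"
  have "\<bar>f0 (Z2 (y, p)) - f0 (Z2 (y, l *\<^sub>R p))\<bar>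
      \<le> (2 powr (k + 18) * \<eta> * jb y powr - k * jb p powr - 9) * norm (Z2 (y, p) - Z2 (y, l *\<^sub>R p))"
    by (intro segment[OF l] Z2)
  also have "\<dots> \<le> (2 powr (k + 18) * \<eta> * jb y powr - k * jb p powr - 9) * (2 * norm (p - l *\<^sub>R p))"
    using lip[of "(y, p)" "(y, l *\<^sub>R p)"] \<eta> by (intro mult_left_mono) (auto simp: norm_Pair)
  also have "\<dots> = 2 powr (k + 19) * \<eta> * jb y powr - k * jb p powr - 9 * norm (p - l *\<^sub>R p)"
    by (simp add: powr_add)
  finally show "\<bar>f0 (Z2 (y, p)) - f0 (Z2 (y, l *\<^sub>R p))\<bar>
      \<le> 2 powr (k + 19) * \<eta> * jb y powr - k * jb p powr - 9 * norm (p - l *\<^sub>R p)" .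
qed

section \<open>Comparison of the two systems\<close>

definition regular_density :: "(vec3 \<Rightarrow> vec3) \<Rightarrow> (real \<Rightarrow> vec3 \<Rightarrow> vec3 \<Rightarrow> real) \<Rightarrow> real \<Rightarrow> bool"
  where "regular_density dw f t \<longleftrightarrow>
    (\<forall>x. continuous_on UNIV (f t x) \<and> integrable lebesgue (f t x) \<and>
      integrable lebesgue (\<lambda>y. density f t y *\<^sub>R dw (x - y)))"

text \<open>K is an admissible constant in the estimate of the difference of the forces, uniformly in the densities
and in a.\<close>

definition force_comparison :: "real \<Rightarrow> real \<Rightarrow> (vec3 \<Rightarrow> vec3) \<Rightarrow> real \<Rightarrow> real \<Rightarrow> bool"
  where "force_comparison \<alpha> \<beta> dw k K \<longleftrightarrow>
    (\<forall>a t N \<kappa> f1 f2. 0 \<le> a \<longrightarrow> a \<le> 1 \<longrightarrow> 0 \<le> t \<longrightarrow> 0 \<le> N \<longrightarrow> 0 \<le> \<kappa> \<longrightarrow>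
      regular_density dw f1 t \<longrightarrow> regular_density dw f2 t \<longrightarrow>
      comparable_profiles k a t N \<kappa> (f1 t) (f2 t) \<longrightarrow>
      (\<forall>x. norm (force \<beta> dw f1 t x - force \<beta> dw f2 t x) \<le> K * N * (\<kappa> + a) * (1 + t) powr - (\<alpha> + 1)))"

lemma force_difference_bound:
  assumes \<alpha>: "1 < \<alpha>" "\<alpha> < 2" and k: "3 < k" and w: "admissible_potential \<alpha> w dw"
    and \<beta>: "\<bar>\<beta>\<bar> \<le> 1"
  shows "\<exists>K\<ge>0. force_comparison \<alpha> \<beta> dw k K"
proof -
  obtain C1 where C1: "0 \<le> C1" "\<And>a t x. 0 \<le> a \<Longrightarrow> a \<le> 1 \<Longrightarrow> 0 \<le> t \<Longrightarrow> dispersed k a t x \<le> ennreal (C1 * (1 + t) powr - 3)"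
    using dispersed_le[OF k] by blast
  obtain C2 where C2: "0 \<le> C2" "\<And>a t. (\<integral>\<^sup>+x. dispersed k a t x \<partial>lborel) \<le> ennreal C2"
    using nn_integral_dispersed[OF k] by blast
  obtain C3 where C3: "0 \<le> C3" "\<And>t x S h H. 0 \<le> t \<Longrightarrow> 0 \<le> S \<Longrightarrow> H \<in> borel_measurable borel \<Longrightarrow>
    (\<forall>y. ennreal \<bar>h y\<bar> \<le> H y) \<Longrightarrow> (\<forall>y. H y \<le> ennreal (S * (1 + t) powr - 3)) \<Longrightarrow>
    (\<integral>\<^sup>+y. H y \<partial>lborel) \<le> ennreal S \<Longrightarrow>
    norm (LINT y|lebesgue. h y *\<^sub>R dw (x - y)) \<le> C3 * S * (1 + t) powr - (\<alpha> + 1)"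
    using force_kernel_convolution[OF \<alpha> w] by blast
  define K where "K = C3 * 2600 * (C1 + C2)"
  have "norm (force \<beta> dw f1 t x - force \<beta> dw f2 t x) \<le> K * N * (\<kappa> + a) * (1 + t) powr - (\<alpha> + 1)"
    if a: "0 \<le> a" "a \<le> 1" and t: "0 \<le> t" and N: "0 \<le> N" and \<kappa>: "0 \<le> \<kappa>"
      and f1: "regular_density dw f1 t" and f2: "regular_density dw f2 t"
      and cp: "comparable_profiles k a t N \<kappa> (f1 t) (f2 t)"
    for a t N \<kappa> x and f1 f2 :: "real \<Rightarrow> vec3 \<Rightarrow> vec3 \<Rightarrow> real"
  proof -
    define h where "h = (\<lambda>y. density f1 t y - density f2 t y)"
    define Q where "Q = 1300 * N * (\<kappa> + a)"
    define H where "H = (\<lambda>y. ennreal Q * (dispersed k a t y + dispersed k 0 t y))"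
    define S where "S = Q * (2 * (C1 + C2))"
    have Q: "0 \<le> Q" using N \<kappa> a by (simp add: Q_def)
    have S: "0 \<le> S" using Q C1 C2 by (simp add: S_def)
    have "norm (LINT y|lebesgue. h y *\<^sub>R dw (x - y)) \<le> C3 * S * (1 + t) powr - (\<alpha> + 1)"
    proof (rule C3(2)[OF t S])
      show "H \<in> borel_measurable borel" unfolding H_def by measurable
      show "\<forall>y. ennreal \<bar>h y\<bar> \<le> H y"
        unfolding h_def H_def density_def Q_def
        using f1 f2 unfolding regular_density_def by (intro allI density_difference a N \<kappa> cp) auto
      show "\<forall>y. H y \<le> ennreal (S * (1 + t) powr - 3)"
      proof
        fix y
        have "H y \<le> ennreal Q * (ennreal (C1 * (1 + t) powr - 3) + ennreal (C1 * (1 + t) powr - 3))"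
          unfolding H_def using a t by (intro mult_left_mono add_mono C1) auto
        also have "\<dots> = ennreal (Q * (C1 * (1 + t) powr - 3 + C1 * (1 + t) powr - 3))"
        proof -
          have X: "0 \<le> C1 * (1 + t) powr - 3" using C1 by simp
          show ?thesis
            by (simp only: ennreal_plus[OF X X, symmetric] ennreal_mult[OF Q add_nonneg_nonneg[OF X X], symmetric])
        qed
        also have "\<dots> \<le> ennreal (S * (1 + t) powr - 3)"
          using Q C1 C2 by (intro ennreal_leI) (simp add: S_def algebra_simps)
        finally show "H y \<le> ennreal (S * (1 + t) powr - 3)" .
      qed
      have "(\<integral>\<^sup>+y. H y \<partial>lborel) = ennreal Q * ((\<integral>\<^sup>+y. dispersed k a t y \<partial>lborel) + (\<integral>\<^sup>+y. dispersed k 0 t y \<partial>lborel))"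
        unfolding H_def by (simp add: nn_integral_cmult nn_integral_add)
      also have "\<dots> \<le> ennreal Q * (ennreal C2 + ennreal C2)"
        by (intro mult_left_mono add_mono C2) auto
      also have "\<dots> = ennreal (Q * (C2 + C2))"
        by (simp only: ennreal_plus[OF C2(1) C2(1), symmetric] ennreal_mult[OF Q add_nonneg_nonneg[OF C2(1) C2(1)], symmetric])
      also have "\<dots> \<le> ennreal S"
        using Q C1 by (intro ennreal_leI) (simp add: S_def algebra_simps)
      finally show "(\<integral>\<^sup>+y. H y \<partial>lborel) \<le> ennreal S" .
    qed
    moreover have "force \<beta> dw f1 t x - force \<beta> dw f2 t x = \<beta> *\<^sub>R (LINT y|lebesgue. h y *\<^sub>R dw (x - y))"
      unfolding force_def h_def scaleR_left_diff_distrib scaleR_diff_right[symmetric]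
      using f1 f2 unfolding regular_density_def by (subst Bochner_Integration.integral_diff) auto
    ultimately have "norm (force \<beta> dw f1 t x - force \<beta> dw f2 t x) \<le> 1 * (C3 * S * (1 + t) powr - (\<alpha> + 1))"
      using \<beta> by (simp only: norm_scaleR) (intro mult_mono, auto)
    also have "\<dots> = K * N * (\<kappa> + a) * (1 + t) powr - (\<alpha> + 1)" by (simp add: K_def S_def Q_def)
    finally show ?thesis .
  qed
  moreover have "0 \<le> K" using C1 C2 C3 by (simp add: K_def)
  ultimately show ?thesis unfolding force_comparison_def by (intro exI[of _ K]) blast
qed

text \<open>The step is applied to the smallest admissible d, which is finite by the a priori bound B, and half of it is
absorbed.\<close>

lemma uniform_bootstrap:
  fixes u :: "real \<Rightarrow> 'b \<Rightarrow> real" and w :: "real \<Rightarrow> real"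
  assumes w: "\<And>t. 0 \<le> t \<Longrightarrow> 0 < w t"
    and B: "0 \<le> B" "\<And>t x. 0 \<le> t \<Longrightarrow> u t x \<le> B * w t"
    and u: "\<And>t x. 0 \<le> t \<Longrightarrow> 0 \<le> u t x"
    and step: "\<And>d. 0 \<le> d \<Longrightarrow> (\<And>t x. 0 \<le> t \<Longrightarrow> u t x \<le> d * w t) \<Longrightarrow> (\<And>t x. 0 \<le> t \<Longrightarrow> u t x \<le> (q * d + r) * w t)"
    and q: "q \<le> 1 / 2" and r: "0 \<le> r" and t: "0 \<le> t"
  shows "u t x \<le> 2 * r * w t"
proof -
  define d where "d = (SUP z\<in>{0..} \<times> UNIV. u (fst z) (snd z) / w (fst z))"
  have bdd: "bdd_above ((\<lambda>z. u (fst z) (snd z) / w (fst z)) ` ({0..} \<times> UNIV))"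
  proof (rule bdd_aboveI2[of _ _ B])
    fix z :: "real \<times> 'b" assume "z \<in> {0..} \<times> UNIV"
    then have "0 \<le> fst z" by auto
    then show "u (fst z) (snd z) / w (fst z) \<le> B"
      using B(2)[of "fst z" "snd z"] w[of "fst z"] by (simp add: divide_le_eq)
  qed
  have le: "u t x \<le> d * w t" if "0 \<le> t" for t x
  proof -
    have "u t x / w t \<le> d"
      unfolding d_def using cSUP_upper[OF _ bdd, of "(t, x)"] that by simp
    then show ?thesis using w[OF that] by (simp add: divide_le_eq)
  qed
  have d0: "0 \<le> d"
  proof -
    have "0 \<le> u 0 x / w 0" using u[of 0 x] w[of 0] by simp
    also have "\<dots> \<le> d" unfolding d_def using cSUP_upper[OF _ bdd, of "(0, x)"] by simp
    finally show ?thesis .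
  qed
  have "d \<le> q * d + r"
    unfolding d_def
  proof (rule cSUP_least)
    fix z :: "real \<times> 'b" assume "z \<in> {0..} \<times> UNIV"
    then have z: "0 \<le> fst z" by auto
    show "u (fst z) (snd z) / w (fst z) \<le> q * (SUP z\<in>{0..} \<times> UNIV. u (fst z) (snd z) / w (fst z)) + r"
      unfolding d_def[symmetric] using step[OF d0 le z, of "snd z"] w[OF z] by (simp add: divide_le_eq)
  qed auto
  also have "\<dots> \<le> 1 / 2 * d + r" using q d0 by (intro add_right_mono mult_right_mono)
  finally have "d \<le> 2 * r" by simp
  then show ?thesis using le[OF t, of x] w[OF t] by (smt (verit) mult_right_mono)
qed

lemma characteristics_flow_line:
  assumes "characteristics c E X P" "0 \<le> t"
  shows "flow_line (inv_sq c) E (\<lambda>s. X s t x p) (\<lambda>s. P s t x p)"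
    and "X t t x p = x" "P t t x p = p"
  using assms unfolding characteristics_def flow_line_def vel_relvel by auto

text \<open>The profile at time t has position y exactly when the characteristic starts from y + t v(p) at time t; at
time 0 profile and state agree.\<close>

lemma backward_profile_map:
  assumes "characteristics c E X P" "0 \<le> t"
  shows "profile_map (inv_sq c) E t
    (\<lambda>z. (X 0 t (fst z + t *\<^sub>R relvel (inv_sq c) (snd z)) (snd z), P 0 t (fst z + t *\<^sub>R relvel (inv_sq c) (snd z)) (snd z)))"
  unfolding profile_map_def
proof
  fix z :: phase
  let ?x = "fst z + t *\<^sub>R relvel (inv_sq c) (snd z)"
  have "flow_line (inv_sq c) E (\<lambda>s. X s t ?x (snd z)) (\<lambda>s. P s t ?x (snd z))"
    by (rule characteristics_flow_line[OF assms])
  moreover have "profile (inv_sq c) (\<lambda>s. X s t ?x (snd z)) (\<lambda>s. P s t ?x (snd z)) t = z"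
    using characteristics_flow_line(2,3)[OF assms] by (simp add: profile_def)
  ultimately show "\<exists>X' P'. flow_line (inv_sq c) E X' P' \<and> profile (inv_sq c) X' P' t = z \<and>
      profile (inv_sq c) X' P' 0 = (X 0 t ?x (snd z), P 0 t ?x (snd z))"
    by (intro exI conjI) (auto simp: profile_def)
qed

lemma inv_sq_bounds: "1 \<le> c \<Longrightarrow> 0 \<le> inv_sq c \<and> inv_sq c \<le> 1"
  by (cases c) (auto simp: inv_sq_ereal divide_le_eq_1 one_le_power)

lemma profile_map_bilipschitz:
  assumes Z: "\<And>z z'. norm ((Z z - Z z') - (z - z')) \<le> 1 / 4 * norm (z - z')"
  shows "norm (Z z - Z z') \<le> 2 * norm (z - z')" "continuous_on UNIV Z"
proof -
  show le: "norm (Z z - Z z') \<le> 2 * norm (z - z')" for z z'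
    using Z[of z z'] norm_triangle_sub[of "Z z - Z z'" "z - z'"] norm_ge_zero[of "z - z'"] by linarith
  show "continuous_on UNIV Z"
    by (rule lipschitz_on_continuous_on[of 2]) (auto simp: lipschitz_on_def dist_norm le)
qed

text \<open>Interpolating between the two maps gives maps that differ from the identity by at most 1 / 4 in the Lipschitz sense,
and the factor 64 = 4 ^ 3 moves the weight from z to the point where the gradient is evaluated, in two steps of
length at most 1.\<close>

lemma L1_distance_of_profiles:
  fixes f0 :: "phase \<Rightarrow> real"
  assumes f0: "continuous_on UNIV f0" and df0: "has_weak_gradient UNIV f0 df0"
    and near: "\<And>z. norm (Z1 z - z) \<le> 1 / 32" "\<And>z. norm (Z2 z - z) \<le> 1 / 32"
    and lip: "\<And>z z'. norm ((Z1 z - Z1 z') - (z - z')) \<le> 1 / 4 * norm (z - z')"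
      "\<And>z z'. norm ((Z2 z - Z2 z') - (z - z')) \<le> 1 / 4 * norm (z - z')"
    and close: "\<And>z. norm (Z1 z - Z2 z) \<le> \<kappa> * jb (snd z) ^ 3" and \<kappa>: "0 \<le> \<kappa>"
  shows "(\<integral>\<^sup>+z. ennreal \<bar>f0 (Z1 z) - f0 (Z2 z)\<bar> \<partial>lborel)
    \<le> ennreal (16 / 9 * 8 ^ DIM(phase) * \<kappa> * 64) * L1_norm (\<lambda>(x, p). jb p ^ 3 *\<^sub>R df0 (x, p))"
proof -
  obtain G where [measurable]: "G \<in> borel_measurable borel" and G: "AE z in lborel. ennreal (norm (df0 z)) = G z"
    using norm_borel_version[OF has_weak_gradient_measurable[OF df0]] by blast
  have "(\<integral>\<^sup>+z. ennreal \<bar>f0 (Z1 z) - f0 (Z2 z)\<bar> \<partial>lborel)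
    \<le> ennreal (16 / 9 * 8 ^ DIM(phase) * \<kappa> * 64) * (\<integral>\<^sup>+z. ennreal (jb (snd z) ^ 3) * G z \<partial>lborel)"
  proof (rule L1_distance_of_compositions[OF f0 df0])
    show "continuous_on UNIV Z1" "continuous_on UNIV Z2"
      using lip by (auto intro: profile_map_bilipschitz(2))
    show "AE u in lebesgue. ennreal (norm (df0 u)) \<le> G u"
      unfolding AE_completion_iff using G by eventually_elim simp
    show "(\<lambda>z::phase. jb (snd z) ^ 3) \<in> borel_measurable borel"
      by (intro borel_measurable_continuous_onI continuous_intros)
    fix \<theta> :: real and z z' :: phase assume \<theta>: "0 \<le> \<theta>" "\<theta> \<le> 1"
    define S where "S = (\<lambda>z. Z2 z + \<theta> *\<^sub>R (Z1 z - Z2 z))"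
    have "(S z - S z') - (z - z') = (1 - \<theta>) *\<^sub>R ((Z2 z - Z2 z') - (z - z')) + \<theta> *\<^sub>R ((Z1 z - Z1 z') - (z - z'))"
      by (simp add: S_def algebra_simps)
    also have "norm \<dots> \<le> (1 - \<theta>) * (1 / 4 * norm (z - z')) + \<theta> * (1 / 4 * norm (z - z'))"
      using \<theta> mult_left_mono[OF lip(1)[of z z'], of \<theta>] mult_left_mono[OF lip(2)[of z z'], of "1 - \<theta>"]
      by (intro order_trans[OF norm_triangle_ineq] add_mono) (simp_all only: norm_scaleR, auto)
    also have "\<dots> = 1 / 4 * norm (z - z')" unfolding distrib_right[symmetric] by simp
    finally have "norm ((S z - S z') - (z - z')) \<le> 1 / 4 * norm (z - z')" .
    then have "norm (z - z') \<le> 2 * norm (S z - S z')"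
      using norm_triangle_sub[of "z - z'" "S z - S z'"] norm_minus_commute[of "z - z'" "S z - S z'"]
        norm_ge_zero[of "S z - S z'"] by linarith
    then show "norm (z - z') \<le> 2 * norm (Z2 z + \<theta> *\<^sub>R (Z1 z - Z2 z) - (Z2 z' + \<theta> *\<^sub>R (Z1 z' - Z2 z')))"
      by (simp only: S_def)
    have snd_le: "norm (snd v) \<le> norm v" for v :: phase
      using norm_snd_le[of "snd v" "fst v"] by simp
    fix u :: phase assume u: "norm (Z2 z + \<theta> *\<^sub>R (Z1 z - Z2 z) - u) \<le> 1"
    have "S z - z = (1 - \<theta>) *\<^sub>R (Z2 z - z) + \<theta> *\<^sub>R (Z1 z - z)"
      by (simp add: S_def algebra_simps)
    also have "norm \<dots> \<le> 1 * (1 / 32) + 1 * (1 / 32)"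
      using \<theta> near[of z]
      by (intro order_trans[OF norm_triangle_ineq] add_mono; unfold norm_scaleR; intro mult_mono) auto
    finally have "norm (S z - z) \<le> 1" by simp
    then have "norm (snd (S z) - snd z) \<le> 1"
      using snd_le[of "S z - z"] by simp
    then have "jb (snd z) \<le> 2 * jb (snd (S z))" by (rule jb_shift)
    moreover have "norm (snd u - snd (S z)) \<le> 1"
      using u snd_le[of "S z - u"] by (simp add: S_def norm_minus_commute)
    then have "jb (snd (S z)) \<le> 2 * jb (snd u)" by (rule jb_shift)
    ultimately have "jb (snd z) \<le> 4 * jb (snd u)" by linarith
    then have "jb (snd z) ^ 3 \<le> (4 * jb (snd u)) ^ 3" by (intro power_mono) (auto simp: less_imp_le)
    then show "jb (snd z) ^ 3 \<le> 64 * jb (snd u) ^ 3" by (simp add: power_mult_distrib)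
  qed (use close \<kappa> in auto)
  also have "(\<integral>\<^sup>+z. ennreal (jb (snd z) ^ 3) * G z \<partial>lborel) = L1_norm (\<lambda>(x, p). jb p ^ 3 *\<^sub>R df0 (x, p))"
    unfolding L1_norm_def nn_integral_completion
    using G by (intro nn_integral_cong_AE, eventually_elim) (auto simp: split_beta ennreal_mult power_abs less_imp_le[OF jb_pos])
  finally show ?thesis .
qed

lemma Linf_norm_leI:
  assumes "continuous_on UNIV u" "\<And>x. norm (u x) \<le> B"
  shows "Linf_norm u \<le> ennreal B"
  unfolding Linf_norm_def
proof (rule esssup_I)
  have "(\<lambda>x. ennreal (norm (u x))) \<in> borel_measurable borel"
    using assms(1) by (intro measurable_compose[OF _ measurable_ennreal] borel_measurable_continuous_onI continuous_intros)
  then show "(\<lambda>x. ennreal (norm (u x))) \<in> borel_measurable lebesgue"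
    by (auto intro: measurable_completion)
qed (use assms(2) in \<open>auto intro!: AE_I2 ennreal_leI\<close>)

text \<open>Fatou's lemma along integer times, using only the pointwise convergence to the scattering states.\<close>

lemma nn_integral_scattering_le:
  assumes s1: "scattering_state c1 f1 f1p" and s2: "scattering_state c2 f2 f2p"
    and c1: "\<And>t. 0 \<le> t \<Longrightarrow> continuous_on UNIV (\<lambda>z. f1 t (fst z) (snd z))"
    and c2: "\<And>t. 0 \<le> t \<Longrightarrow> continuous_on UNIV (\<lambda>z. f2 t (fst z) (snd z))"
    and bd: "\<And>t. 0 \<le> t \<Longrightarrow> (\<integral>\<^sup>+z. ennreal \<bar>f1 t (fst z + t *\<^sub>R vel c1 (snd z)) (snd z)
        - f2 t (fst z + t *\<^sub>R vel c2 (snd z)) (snd z)\<bar> \<partial>lborel) \<le> B"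
  shows "L1_norm (\<lambda>(x, p). f1p x p - f2p x p) \<le> B"
proof -
  let ?g = "\<lambda>n z. ennreal \<bar>f1 (real n) (fst z + real n *\<^sub>R vel c1 (snd z)) (snd z)
        - f2 (real n) (fst z + real n *\<^sub>R vel c2 (snd z)) (snd z)\<bar>"
  have vm: "(vel c :: vec3 \<Rightarrow> vec3) \<in> borel_measurable borel" for c
    unfolding vel_relvel by measurable
  have gm: "?g n \<in> borel_measurable lborel" for n
  proof -
    note [measurable] = vm borel_measurable_continuous_onI[OF c1[of "real n"]] borel_measurable_continuous_onI[OF c2[of "real n"]]
    have m1: "(\<lambda>z. (fst z + real n *\<^sub>R vel c (snd z), snd z)) \<in> borel_measurable (borel :: phase measure)" for c
      by (simp add: borel_prod[symmetric]) measurable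
    have "(\<lambda>z. f1 (real n) (fst z + real n *\<^sub>R vel c1 (snd z)) (snd z)) \<in> borel_measurable (borel :: phase measure)"
      using measurable_compose[OF m1[of c1] borel_measurable_continuous_onI[OF c1[of "real n"]]] by simp
    moreover have "(\<lambda>z. f2 (real n) (fst z + real n *\<^sub>R vel c2 (snd z)) (snd z)) \<in> borel_measurable (borel :: phase measure)"
      using measurable_compose[OF m1[of c2] borel_measurable_continuous_onI[OF c2[of "real n"]]] by simp
    ultimately show ?thesis by simp
  qed
  have "L1_norm (\<lambda>(x, p). f1p x p - f2p x p) = (\<integral>\<^sup>+z. liminf (\<lambda>n. ?g n z) \<partial>lborel)"
    unfolding L1_norm_def nn_integral_completion
  proof (intro nn_integral_cong)
    fix z :: phase
    have "((\<lambda>t. f1 t (fst z + t *\<^sub>R vel c1 (snd z)) (snd z)) \<longlongrightarrow> f1p (fst z) (snd z)) at_top"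
      "((\<lambda>t. f2 t (fst z + t *\<^sub>R vel c2 (snd z)) (snd z)) \<longlongrightarrow> f2p (fst z) (snd z)) at_top"
      using s1 s2 unfolding scattering_state_def by auto
    from this[THEN filterlim_compose[OF _ filterlim_real_sequentially]]
    have "(\<lambda>n. ?g n z) \<longlonglongrightarrow> ennreal \<bar>f1p (fst z) (snd z) - f2p (fst z) (snd z)\<bar>"
      by (intro tendsto_ennrealI tendsto_intros)
    then have "ennreal \<bar>f1p (fst z) (snd z) - f2p (fst z) (snd z)\<bar> = liminf (\<lambda>n. ?g n z)"
      by (intro lim_imp_Liminf[symmetric]) auto
    then show "ennreal (norm (case z of (x, p) \<Rightarrow> f1p x p - f2p x p)) = liminf (\<lambda>n. ?g n z)"
      by (simp only: split_beta real_norm_def)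
  qed
  also have "\<dots> \<le> liminf (\<lambda>n. \<integral>\<^sup>+z. ?g n z \<partial>lborel)" by (rule nn_integral_liminf[OF gm])
  also have "\<dots> \<le> liminf (\<lambda>n. B)" by (intro Liminf_mono always_eventually allI bd) simp
  finally show ?thesis by (simp add: Liminf_const)
qed


lemma vlasov_solution_continuous:
  assumes "vlasov_solution c \<beta> dw f0 f" "0 \<le> t"
  shows "continuous_on UNIV (\<lambda>z. f t (fst z) (snd z))" and "regular_density dw f t"
proof -
  have c: "continuous_on ({0..} \<times> UNIV \<times> UNIV) (\<lambda>(t, x, p). f t x p)"
    using assms unfolding vlasov_solution_def by blast
  have "continuous_on UNIV (\<lambda>z. (\<lambda>(t, x, p). f t x p) (t, fst z, snd z))"
    by (rule continuous_on_compose2[OF c]) (auto intro!: continuous_intros simp: assms)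
  then show "continuous_on UNIV (\<lambda>z. f t (fst z) (snd z))" by (simp add: split_beta)
  have "continuous_on UNIV (\<lambda>p. (\<lambda>(t, x, p). f t x p) (t, x, p))" for x
    by (rule continuous_on_compose2[OF c]) (auto intro!: continuous_intros simp: assms)
  then show "regular_density dw f t"
    using assms unfolding vlasov_solution_def regular_density_def by auto
qed

text \<open>The estimate of the field is closed first, by bootstrapping over d; the estimates of the wave maps and of the
scattering states then follow by inserting the resulting d, a multiple of \<eta> / c^2, into the comparison
of profiles.\<close>

lemma two_system_comparison:
  assumes \<alpha>: "1 < \<alpha>" and k: "3 < k" and C0: "0 < C\<^sub>0" and K: "0 \<le> K"
    and force: "force_comparison \<alpha> \<beta> dw k K"
  defines "M \<equiv> 48 / (\<alpha> - 1)"
  defines "L \<equiv> K * 2 powr (k + 19) * (M + 1)"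
  assumes small: "C\<^sub>0 * \<eta> / (\<alpha> - 1) \<le> 1 / 96" "C\<^sub>0 * \<eta> \<le> 1" "L * \<eta> \<le> 1 / 2" "\<eta> \<le> 1"
  assumes f0: "continuous_on UNIV f0" and df0: "has_weak_gradient UNIV f0 df0" and size: "data_size k f0 df0 < ennreal \<eta>"
  assumes c: "1 \<le> c"
    and sol1: "vlasov_solution c \<beta> dw f0 f1" and sol2: "vlasov_solution \<infinity> \<beta> dw f0 f2"
    and dec1: "force_decay \<alpha> (C\<^sub>0 * \<eta>) (force \<beta> dw f1)" and dec2: "force_decay \<alpha> (C\<^sub>0 * \<eta>) (force \<beta> dw f2)"
    and ch1: "characteristics c (force \<beta> dw f1) X1 P1" and ch2: "characteristics \<infinity> (force \<beta> dw f2) X2 P2"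
    and tr1: "\<forall>t\<ge>0. \<forall>x p. f1 t x p = f0 (X1 0 t x p, P1 0 t x p)"
    and tr2: "\<forall>t\<ge>0. \<forall>x p. f2 t x p = f0 (X2 0 t x p, P2 0 t x p)"
    and sc1: "scattering_state c f1 f1p" and sc2: "scattering_state \<infinity> f2 f2p"
  shows "L1_norm (\<lambda>(x, p). f1p x p - f2p x p)
      \<le> ennreal (16 / 9 * 8 ^ DIM(phase) * (M * (C\<^sub>0 + 2 * L)) * 64 * inv_sq c) * L1_norm (\<lambda>(x, p). jb p ^ 3 *\<^sub>R df0 (x, p))"
    and "0 \<le> t \<Longrightarrow> norm (wave_map c X1 P1 t x p - wave_map \<infinity> X2 P2 t x p)
      \<le> M * (C\<^sub>0 + 2 * L) * \<eta> * inv_sq c * jb p ^ 3"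
    and "0 \<le> t \<Longrightarrow> norm (force \<beta> dw f1 t x - force \<beta> dw f2 t x) \<le> 2 * L * \<eta> * inv_sq c * (1 + t) powr - (\<alpha> + 1)"
proof -
  define a where "a = inv_sq c"
  have a: "0 \<le> a" "a \<le> 1" using inv_sq_bounds[OF c] by (auto simp: a_def)
  define b where "b = C\<^sub>0 * \<eta>"
  let ?E1 = "force \<beta> dw f1" and ?E2 = "force \<beta> dw f2"
  have \<eta>: "0 < \<eta>" by (rule data_size_bounds(3)[OF size f0])
  have b: "0 \<le> b" "b / (\<alpha> - 1) \<le> 1 / 96" "b \<le> 1" using C0 \<eta> small by (auto simp: b_def)
  have b3: "3 * b / (\<alpha> - 1) \<le> 1 / 2" using b(2) unfolding times_divide_eq_right[symmetric] by linarith
  have M: "0 \<le> M" using \<alpha> by (simp add: M_def)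
  have L: "0 \<le> L" using K M by (simp add: L_def)
  have E1: "decaying_field \<alpha> b ?E1" and E2: "decaying_field \<alpha> b ?E2"
    using force_decay_imp_decaying_field dec1 dec2 b by (auto simp: b_def)
  define Z1 where "Z1 = (\<lambda>t z. (X1 0 t (fst z + t *\<^sub>R relvel a (snd z)) (snd z), P1 0 t (fst z + t *\<^sub>R relvel a (snd z)) (snd z)))"
  define Z2 where "Z2 = (\<lambda>t z. (X2 0 t (fst z + t *\<^sub>R snd z) (snd z), P2 0 t (fst z + t *\<^sub>R snd z) (snd z)))"
  have pm1: "profile_map a ?E1 t (Z1 t)" if "0 \<le> t" for t
    using backward_profile_map[OF ch1 that] by (simp add: Z1_def a_def)
  have pm2: "profile_map 0 ?E2 t (Z2 t)" if "0 \<le> t" for t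
    using backward_profile_map[OF ch2 that] by (simp add: Z2_def)
  have F1: "f1 t (y + t *\<^sub>R relvel a p) p = f0 (Z1 t (y, p))" if "0 \<le> t" for t y p
    using tr1 that by (simp add: Z1_def)
  have F2: "f2 t (y + t *\<^sub>R p) p = f0 (Z2 t (y, p))" if "0 \<le> t" for t y p
    using tr2 that by (simp add: Z2_def)
  have near1: "norm (Z1 t z - z) \<le> 1 / 32" if "0 \<le> t" for t z
    by (rule profile_map_near[OF E1 pm1[OF that] a(1) \<alpha> that b(2)])
  have near2: "norm (Z2 t z - z) \<le> 1 / 32" if "0 \<le> t" for t z
    by (rule profile_map_near[OF E2 pm2[OF that] order_refl \<alpha> that b(2)])
  have lip1: "norm ((Z1 t z - Z1 t z') - (z - z')) \<le> 1 / 4 * norm (z - z')" if "0 \<le> t" for t z z'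
    by (rule profile_map_lipschitz[OF E1 pm1[OF that] a \<alpha> that b(2)])
  have lip2: "norm ((Z2 t z - Z2 t z') - (z - z')) \<le> 1 / 4 * norm (z - z')" if "0 \<le> t" for t z z'
    by (rule profile_map_lipschitz[OF E2 pm2[OF that] order_refl _ \<alpha> that b(2)]) simp
  have step: "norm (?E1 t x - ?E2 t x) \<le> (L * \<eta> * d + L * \<eta> * a) * (1 + t) powr - (\<alpha> + 1)"
    if d: "0 \<le> d" and close: "\<And>s x. 0 \<le> s \<Longrightarrow> norm (?E1 s x - ?E2 s x) \<le> d * (1 + s) powr - (\<alpha> + 1)" and t: "0 \<le> t"
    for d t x
  proof -
    define \<kappa> where "\<kappa> = M * (b * a + d)"
    define N where "N = 2 powr (k + 19) * \<eta>"
    have \<kappa>: "0 \<le> \<kappa>" using M a b d by (simp add: \<kappa>_def)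
    have N: "0 \<le> N" using \<eta> by (simp add: N_def)
    have Zc: "norm (Z1 t z - Z2 t z) \<le> \<kappa> * jb (snd z) ^ 3" for z
      unfolding \<kappa>_def M_def
      by (rule profile_map_close[OF E1 E2 close pm1[OF t] pm2[OF t] a(1) \<alpha> t b(2) d])
    have k0: "0 \<le> k" using k by simp
    note B1 = composition_bounds[OF f0 df0 size k0 near1[OF t] near2[OF t], folded N_def]
    note B2 = composition_bounds[OF f0 df0 size k0 near2[OF t] near2[OF t], folded N_def]
    have "comparable_profiles k a t N \<kappa> (f1 t) (f2 t)"
      unfolding comparable_profiles_def
    proof (intro conjI)
      show "\<forall>y p. \<bar>f1 t (y + t *\<^sub>R relvel a p) p\<bar> \<le> N * jb y powr - k * jb p powr - 8"
        unfolding F1[OF t] using B1(1) by blast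
      show "\<forall>y p. \<bar>f2 t (y + t *\<^sub>R p) p\<bar> \<le> N * jb y powr - k * jb p powr - 8"
        unfolding F2[OF t] using B2(1) by blast
      show "\<forall>y p. \<bar>f1 t (y + t *\<^sub>R relvel a p) p - f2 t (y + t *\<^sub>R p) p\<bar> \<le> N * \<kappa> * jb y powr - k * jb p powr - 6"
      proof (intro allI)
        fix y p
        have "\<bar>f1 t (y + t *\<^sub>R relvel a p) p - f2 t (y + t *\<^sub>R p) p\<bar>
            \<le> N * jb y powr - k * jb p powr - 9 * norm (Z1 t (y, p) - Z2 t (y, p))"
          unfolding F1[OF t] F2[OF t] by (rule B1(2))
        also have "\<dots> \<le> N * jb y powr - k * jb p powr - 9 * (\<kappa> * jb p ^ 3)"
          using Zc[of "(y, p)"] N by (intro mult_left_mono) auto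
        also have "\<dots> = N * \<kappa> * jb y powr - k * (jb p powr - 9 * jb p ^ 3)" by (simp only: mult_ac)
        finally show "\<bar>f1 t (y + t *\<^sub>R relvel a p) p - f2 t (y + t *\<^sub>R p) p\<bar> \<le> N * \<kappa> * jb y powr - k * jb p powr - 6"
          unfolding jb_powr_absorb(3) .
      qed
      show "\<forall>y p l. 1 / 2 \<le> l \<longrightarrow> l \<le> 1 \<longrightarrow>
          \<bar>f2 t (y + t *\<^sub>R p) p - f2 t (y + t *\<^sub>R l *\<^sub>R p) (l *\<^sub>R p)\<bar>
          \<le> N * jb y powr - k * jb p powr - 9 * norm (p - l *\<^sub>R p)"
        unfolding F2[OF t] using B2(3) profile_map_bilipschitz(1)[of "Z2 t", OF lip2[OF t]] by blast
    qed
    then have "norm (?E1 t x - ?E2 t x) \<le> K * N * (\<kappa> + a) * (1 + t) powr - (\<alpha> + 1)"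
      using force a t N \<kappa> vlasov_solution_continuous(2)[OF sol1 t] vlasov_solution_continuous(2)[OF sol2 t]
      unfolding force_comparison_def by blast
    also have "\<dots> \<le> K * N * ((M + 1) * (d + a)) * (1 + t) powr - (\<alpha> + 1)"
    proof -
      have "b * a \<le> 1 * a" using a b by (intro mult_right_mono) auto
      then have "\<kappa> \<le> M * (a + d)" unfolding \<kappa>_def using M by (intro mult_left_mono) auto
      then have "\<kappa> + a \<le> (M + 1) * (d + a)" using d by (simp add: algebra_simps)
      then show ?thesis using K N by (intro mult_right_mono mult_left_mono) auto
    qed
    also have "\<dots> = (L * \<eta> * d + L * \<eta> * a) * (1 + t) powr - (\<alpha> + 1)"
      by (simp add: L_def N_def algebra_simps)
    finally show ?thesis .
  qed
  have field: "norm (?E1 t x - ?E2 t x) \<le> 2 * (L * \<eta> * a) * (1 + t) powr - (\<alpha> + 1)" if t: "0 \<le> t" for t x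
  proof (rule uniform_bootstrap[where u = "\<lambda>t x. norm (?E1 t x - ?E2 t x)" and w = "\<lambda>t. (1 + t) powr - (\<alpha> + 1)" and B = "2 * b" and q = "L * \<eta>"])
    fix t x assume "0 \<le> (t::real)"
    then show "norm (?E1 t x - ?E2 t x) \<le> 2 * b * (1 + t) powr - (\<alpha> + 1)"
      using decaying_fieldD(2)[OF E1, of t x] decaying_fieldD(2)[OF E2, of t x]
        norm_triangle_ineq4[of "?E1 t x" "?E2 t x"] by linarith
  qed (use small b L \<eta> a t step in auto)
  show "norm (?E1 t x - ?E2 t x) \<le> 2 * L * \<eta> * inv_sq c * (1 + t) powr - (\<alpha> + 1)" if "0 \<le> t"
    using field[OF that, of x] by (simp add: a_def mult.assoc)
  define d where "d = 2 * (L * \<eta> * a)"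
  have d: "0 \<le> d" using L \<eta> a by (simp add: d_def)
  have field': "norm (?E1 t x - ?E2 t x) \<le> d * (1 + t) powr - (\<alpha> + 1)" if "0 \<le> t" for t x
    using field[OF that] by (simp add: d_def)
  have \<kappa>eq: "48 / (\<alpha> - 1) * (b * a + d) = M * (C\<^sub>0 + 2 * L) * \<eta> * a"
    unfolding M_def[symmetric] b_def d_def by (simp add: algebra_simps)
  show "norm (wave_map c X1 P1 t x p - wave_map \<infinity> X2 P2 t x p) \<le> M * (C\<^sub>0 + 2 * L) * \<eta> * inv_sq c * jb p ^ 3"
    if t: "0 \<le> t"
  proof -
    have fl1: "flow_line a ?E1 (\<lambda>s. X1 s 0 x p) (\<lambda>s. P1 s 0 x p)"
      unfolding a_def by (rule characteristics_flow_line[OF ch1 order_refl])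
    have fl2: "flow_line 0 ?E2 (\<lambda>s. X2 s 0 x p) (\<lambda>s. P2 s 0 x p)"
      using characteristics_flow_line(1)[OF ch2 order_refl] by simp
    have "norm (profile a (\<lambda>s. X1 s 0 x p) (\<lambda>s. P1 s 0 x p) t - profile 0 (\<lambda>s. X2 s 0 x p) (\<lambda>s. P2 s 0 x p) t)
        \<le> 48 / (\<alpha> - 1) * (b * a + d) * jb (snd (x, p)) ^ 3"
      using b3 characteristics_flow_line(2,3)[OF ch1 order_refl] characteristics_flow_line(2,3)[OF ch2 order_refl]
      by (intro profile_speed_comparison[OF E1 E2 field' fl1 fl2 _ _ a(1) \<alpha> _ d t order_refl])
        (auto simp: profile_def)
    then show ?thesis
      unfolding \<kappa>eq by (simp add: wave_map_def profile_def vel_relvel a_def)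
  qed
  show "L1_norm (\<lambda>(x, p). f1p x p - f2p x p)
      \<le> ennreal (16 / 9 * 8 ^ DIM(phase) * (M * (C\<^sub>0 + 2 * L)) * 64 * inv_sq c) * L1_norm (\<lambda>(x, p). jb p ^ 3 *\<^sub>R df0 (x, p))"
  proof (rule nn_integral_scattering_le[OF sc1 sc2 vlasov_solution_continuous(1)[OF sol1] vlasov_solution_continuous(1)[OF sol2]])
    fix t :: real assume t: "0 \<le> t"
    let ?\<kappa> = "M * (C\<^sub>0 + 2 * L) * a"
    have close: "norm (Z1 t z - Z2 t z) \<le> ?\<kappa> * jb (snd z) ^ 3" for z
    proof -
      have "norm (Z1 t z - Z2 t z) \<le> M * (C\<^sub>0 + 2 * L) * \<eta> * a * jb (snd z) ^ 3"
        unfolding \<kappa>eq[symmetric]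
        by (rule profile_map_close[OF E1 E2 field' pm1[OF t] pm2[OF t] a(1) \<alpha> t b(2) d])
      also have "\<dots> \<le> M * (C\<^sub>0 + 2 * L) * 1 * a * jb (snd z) ^ 3"
        using M C0 L a small less_imp_le[OF jb_pos, of "snd z"] by (intro mult_right_mono mult_left_mono) auto
      finally show ?thesis by simp
    qed
    have "(\<integral>\<^sup>+z. ennreal \<bar>f1 t (fst z + t *\<^sub>R vel c (snd z)) (snd z) - f2 t (fst z + t *\<^sub>R vel \<infinity> (snd z)) (snd z)\<bar> \<partial>lborel)
        = (\<integral>\<^sup>+z. ennreal \<bar>f0 (Z1 t z) - f0 (Z2 t z)\<bar> \<partial>lborel)"
      using F1[OF t] F2[OF t] by (simp add: vel_relvel a_def)
    also have "\<dots> \<le> ennreal (16 / 9 * 8 ^ DIM(phase) * ?\<kappa> * 64) * L1_norm (\<lambda>(x, p). jb p ^ 3 *\<^sub>R df0 (x, p))"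
      using M C0 L a
      by (intro L1_distance_of_profiles[OF f0 df0 near1[OF t] near2[OF t] lip1[OF t] lip2[OF t] close]) auto
    finally show "(\<integral>\<^sup>+z. ennreal \<bar>f1 t (fst z + t *\<^sub>R vel c (snd z)) (snd z) - f2 t (fst z + t *\<^sub>R vel \<infinity> (snd z)) (snd z)\<bar> \<partial>lborel)
        \<le> ennreal (16 / 9 * 8 ^ DIM(phase) * (M * (C\<^sub>0 + 2 * L)) * 64 * inv_sq c) * L1_norm (\<lambda>(x, p). jb p ^ 3 *\<^sub>R df0 (x, p))"
      by (simp add: a_def mult_ac)
  qed
qed

theorem theorem1p3:
  fixes \<alpha> \<beta> k C\<^sub>0 :: real
    and w :: "vec3 \<Rightarrow> real" and dw :: "vec3 \<Rightarrow> vec3"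
  assumes "1 < \<alpha>" and "\<alpha> < 2"
    and "\<beta> \<in> {-1, 0, 1}"
    and "3 < k"
    and "0 < C\<^sub>0"
    and "admissible_potential \<alpha> w dw"
  shows "\<exists>\<epsilon>>0. \<exists>C>0.
    \<forall>(\<eta>\<^sub>0 :: real) (f0 :: phase \<Rightarrow> real) (df0 :: phase \<Rightarrow> phase)
     (f :: ereal \<Rightarrow> real \<Rightarrow> vec3 \<Rightarrow> vec3 \<Rightarrow> real)
     (X :: ereal \<Rightarrow> real \<Rightarrow> real \<Rightarrow> vec3 \<Rightarrow> vec3 \<Rightarrow> vec3)
     (P :: ereal \<Rightarrow> real \<Rightarrow> real \<Rightarrow> vec3 \<Rightarrow> vec3 \<Rightarrow> vec3)
     (fplus :: ereal \<Rightarrow> vec3 \<Rightarrow> vec3 \<Rightarrow> real).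
      (\<forall>z. 0 \<le> f0 z) \<and> continuous_on UNIV f0 \<and> has_weak_gradient UNIV f0 df0 \<and>
      0 < data_size k f0 df0 \<and> data_size k f0 df0 < ennreal \<eta>\<^sub>0 \<and> \<eta>\<^sub>0 \<le> \<epsilon> \<and>
      (\<forall>c\<ge>1.
        vlasov_solution c \<beta> dw f0 (f c) \<and>
        force_decay \<alpha> (C\<^sub>0 * \<eta>\<^sub>0) (force \<beta> dw (f c)) \<and>
        characteristics c (force \<beta> dw (f c)) (X c) (P c) \<and>
        (\<forall>t\<ge>0. \<forall>x p. f c t x p = f0 (X c 0 t x p, P c 0 t x p)) \<and>
        scattering_state c (f c) (fplus c))
      \<longrightarrow>
      (\<forall>c\<ge>1.
        L1_norm (\<lambda>(x, p). fplus c x p - fplus \<infinity> x p)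
          \<le> ennreal (C * inv_sq c) * L1_norm (\<lambda>(x, p). jb p ^ 3 *\<^sub>R df0 (x, p)) \<and>
        (SUP t\<in>{0..}. SUP (x, p)\<in>UNIV.
            ennreal (1 / jb p ^ 3 * norm (wave_map c (X c) (P c) t x p
                                         - wave_map \<infinity> (X \<infinity>) (P \<infinity>) t x p)))
          \<le> ennreal (C * \<eta>\<^sub>0 * inv_sq c) \<and>
        (\<forall>t\<ge>0. Linf_norm (\<lambda>x. force \<beta> dw (f c) t x - force \<beta> dw (f \<infinity>) t x)
          \<le> ennreal (C * \<eta>\<^sub>0 * inv_sq c / jb t powr (\<alpha> + 1))))"
proof -
  note \<alpha> = assms(1,2) and k = assms(4) and C0 = assms(5)
  have \<beta>: "\<bar>\<beta>\<bar> \<le> 1" using assms(3) by auto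
  obtain K where K: "0 \<le> K" and force: "force_comparison \<alpha> \<beta> dw k K"
    using force_difference_bound[OF \<alpha> k assms(6) \<beta>] by blast
  define M where "M = 48 / (\<alpha> - 1)"
  define L where "L = K * 2 powr (k + 19) * (M + 1)"
  have M: "0 < M" using \<alpha> by (simp add: M_def)
  have L: "0 \<le> L" using K M by (simp add: L_def)
  \<comment> \<open>The four numbers make profile maps contractive perturbations of the identity, bound b by 1, permit the bootstrap, and bound \<eta> by 1.\<close>
  define \<epsilon> where "\<epsilon> = Min {(\<alpha> - 1) / (96 * C\<^sub>0), 1 / C\<^sub>0, 1 / (2 * (L + 1)), 1}"
  have \<epsilon>: "0 < \<epsilon>" using \<alpha> C0 L by (simp add: \<epsilon>_def)
  have \<epsilon>_le: "\<epsilon> \<le> (\<alpha> - 1) / (96 * C\<^sub>0)" "\<epsilon> \<le> 1 / C\<^sub>0" "\<epsilon> \<le> 1 / (2 * (L + 1))" "\<epsilon> \<le> 1"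
    unfolding \<epsilon>_def by (auto intro: Min_le)
  define A1 where "A1 = 16 / 9 * 8 ^ DIM(phase) * (M * (C\<^sub>0 + 2 * L)) * 64"
  define A2 where "A2 = M * (C\<^sub>0 + 2 * L)"
  define A3 where "A3 = 2 * L"
  define C where "C = A1 + A2 + A3"
  have A: "0 < A1" "0 \<le> A2" "0 \<le> A3" using M C0 L by (auto simp: A1_def A2_def A3_def add_pos_nonneg)
  then have C: "0 < C" "A1 \<le> C" "A2 \<le> C" "A3 \<le> C" by (auto simp: C_def)
  show ?thesis
  proof (rule exI[of _ \<epsilon>], rule conjI[OF \<epsilon>], rule exI[of _ C], rule conjI[OF C(1)], intro allI impI, goal_cases)
    case (1 \<eta> f0 df0 f X P fplus c)
    then have f0: "continuous_on UNIV f0" and df0: "has_weak_gradient UNIV f0 df0"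
      and size: "data_size k f0 df0 < ennreal \<eta>" and le: "\<eta> \<le> \<epsilon>" and c: "1 \<le> c" by auto
    have sys: "vlasov_solution c \<beta> dw f0 (f c)" "force_decay \<alpha> (C\<^sub>0 * \<eta>) (force \<beta> dw (f c))"
        "characteristics c (force \<beta> dw (f c)) (X c) (P c)"
        "\<forall>t\<ge>0. \<forall>x p. f c t x p = f0 (X c 0 t x p, P c 0 t x p)"
        "scattering_state c (f c) (fplus c)" if "1 \<le> c" for c
      using 1 that by blast+
    have \<eta>: "0 < \<eta>" by (rule data_size_bounds(3)[OF size f0])
    have inf: "1 \<le> (\<infinity>::ereal)" by simp
    have a: "0 \<le> inv_sq c" using inv_sq_bounds[OF c] by simp
    have "C\<^sub>0 * \<eta> \<le> C\<^sub>0 * ((\<alpha> - 1) / (96 * C\<^sub>0))"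
      using le \<epsilon>_le(1) C0 by (intro mult_left_mono) auto
    also have "\<dots> = (\<alpha> - 1) / 96" using C0 by simp
    finally have s1: "C\<^sub>0 * \<eta> / (\<alpha> - 1) \<le> 1 / 96" using \<alpha> by (simp add: divide_le_eq)
    have "C\<^sub>0 * \<eta> \<le> C\<^sub>0 * (1 / C\<^sub>0)" using le \<epsilon>_le(2) C0 by (intro mult_left_mono) auto
    then have s2: "C\<^sub>0 * \<eta> \<le> 1" using C0 by simp
    have "L * \<eta> \<le> (L + 1) * (1 / (2 * (L + 1)))" using le \<epsilon>_le(3) L \<eta> by (intro mult_mono) auto
    also have "\<dots> = 1 / 2" using L by simp
    finally have s3: "L * \<eta> \<le> 1 / 2" .
    have s4: "\<eta> \<le> 1" using le \<epsilon>_le(4) by simp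
    note cmp = two_system_comparison[OF \<alpha>(1) k C0 K force, folded M_def, folded L_def, OF s1 s2 s3 s4 f0 df0 size c
        sys(1)[OF c] sys(1)[OF inf] sys(2)[OF c] sys(2)[OF inf] sys(3)[OF c] sys(3)[OF inf]
        sys(4)[OF c] sys(4)[OF inf] sys(5)[OF c] sys(5)[OF inf]]
    show ?case
    proof (intro conjI allI impI)
      have "L1_norm (\<lambda>(x, p). fplus c x p - fplus \<infinity> x p) \<le> ennreal (A1 * inv_sq c) * L1_norm (\<lambda>(x, p). jb p ^ 3 *\<^sub>R df0 (x, p))"
        unfolding A1_def by (rule cmp(1))
      also have "\<dots> \<le> ennreal (C * inv_sq c) * L1_norm (\<lambda>(x, p). jb p ^ 3 *\<^sub>R df0 (x, p))"
        using C a by (intro mult_right_mono ennreal_leI) auto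
      finally show "L1_norm (\<lambda>(x, p). fplus c x p - fplus \<infinity> x p) \<le> ennreal (C * inv_sq c) * L1_norm (\<lambda>(x, p). jb p ^ 3 *\<^sub>R df0 (x, p))" .
    next
      have "1 / jb p ^ 3 * norm (wave_map c (X c) (P c) t x p - wave_map \<infinity> (X \<infinity>) (P \<infinity>) t x p) \<le> C * \<eta> * inv_sq c"
        if "0 \<le> t" for t x p
      proof -
        have j: "0 < jb p ^ 3" by simp
        have "norm (wave_map c (X c) (P c) t x p - wave_map \<infinity> (X \<infinity>) (P \<infinity>) t x p) \<le> A2 * \<eta> * inv_sq c * jb p ^ 3"
          unfolding A2_def by (rule cmp(2)[OF that])
        then have "1 / jb p ^ 3 * norm (wave_map c (X c) (P c) t x p - wave_map \<infinity> (X \<infinity>) (P \<infinity>) t x p) \<le> A2 * \<eta> * inv_sq c"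
          using j by (simp add: divide_le_eq)
        also have "\<dots> \<le> C * \<eta> * inv_sq c" using C \<eta> a by (intro mult_right_mono) auto
        finally show ?thesis .
      qed
      then show "(SUP t\<in>{0..}. SUP (x, p)\<in>UNIV.
            ennreal (1 / jb p ^ 3 * norm (wave_map c (X c) (P c) t x p - wave_map \<infinity> (X \<infinity>) (P \<infinity>) t x p)))
          \<le> ennreal (C * \<eta> * inv_sq c)"
        by (intro SUP_least) (auto intro!: ennreal_leI)
    next
      fix t :: real assume t: "0 \<le> t"
      have cont: "continuous_on UNIV (force \<beta> dw (f c) t)" if "1 \<le> c" for c
        using sys(2)[OF that] t unfolding force_decay_def
        by (intro continuous_at_imp_continuous_on ballI differentiable_imp_continuous_within) auto
      show "Linf_norm (\<lambda>x. force \<beta> dw (f c) t x - force \<beta> dw (f \<infinity>) t x) \<le> ennreal (C * \<eta> * inv_sq c / jb t powr (\<alpha> + 1))"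
      proof (rule Linf_norm_leI)
        show "continuous_on UNIV (\<lambda>x. force \<beta> dw (f c) t x - force \<beta> dw (f \<infinity>) t x)"
          by (intro continuous_on_diff cont c inf)
        fix x
        have "norm (force \<beta> dw (f c) t x - force \<beta> dw (f \<infinity>) t x) \<le> A3 * \<eta> * inv_sq c * (1 + t) powr - (\<alpha> + 1)"
          unfolding A3_def by (rule cmp(3)[OF t])
        also have "\<dots> \<le> C * \<eta> * inv_sq c * jb t powr - (\<alpha> + 1)"
          using C A \<eta> a \<alpha> t jb_le[of t] by (intro mult_mono powr_mono2') auto
        also have "\<dots> = C * \<eta> * inv_sq c / jb t powr (\<alpha> + 1)"
          by (simp only: powr_minus_divide) simp
        finally show "norm (force \<beta> dw (f c) t x - force \<beta> dw (f \<infinity>) t x) \<le> C * \<eta> * inv_sq c / jb t powr (\<alpha> + 1)" .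
      qed
    qed
  qed
qed

end
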